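(* Assume $0<R_\ast<\infty$. There exists an absolute constant $C>0$ such that, for every $\mu\in\Delta(T)$ with $\Phi_{\mu,\ast}<\infty$, every $r_0>0$ and every $s_0\in(0,R_\ast]$, \[ \mathbb E\left[\sup_{x\in T}\frac{\bigl(|X_x|-C\max\{\Phi_\mu(x),r_0\}\bigr)_+}{\max\{\sigma(x),s_0\}}\right]\le C\sqrt{\log(eM_{r_0,s_0})}. \] Consequently, for every $x\in T$, \[ \mathbb E|X_x|\le C\max\{\Phi_\mu(x),r_0\}+C\max\{\sigma(x),s_0\}\sqrt{\log(eM_{r_0,s_0})}. \] If $r_0\ge\Phi_{\mu,\ast}$ and $s_0=R_\ast$, then $M_{r_0,s_0}=1$ and \[ \mathbb E\sup_{x\in T}|X_x|\le C(r_0+R_\ast). \] Moreover, \[ \mathbb E\sup_{x\in T}|X_x|\asymp R_\ast+\inf_{\mu\in\Delta(T)}\Phi_{\mu,\ast}. \]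
   Context: $T$ is a finite set and $\{X_x\}_{x\in T}$ is a centered Gaussian process. Fix an anchor $x_0\in T$ with $X_{x_0}=0$ almost surely. Define \[ d(x,y):=(\mathbb E|X_x-X_y|^2)^{1/2},\quad \sigma(x):=(\mathbb E X_x^2)^{1/2}=d(x,x_0),\quad R_\ast:=\sup_{x\in T}\sigma(x),\quad B_d(x,\varepsilon):=\{y\in T: d(x,y)\le\varepsilon\}. \] $\Delta(T)$ is the set of probability measures on $T$. For $\mu\in\Delta(T)$, \[ \Phi_\mu(x):=\int_0^{4\sigma(x)}\sqrt{\log\frac1{\mu(B_d(x,\varepsilon))}}\,d\varepsilon,\qquad \Phi_{\mu,\ast}:=\sup_{x\in T}\Phi_\mu(x) \] (with $\log(1/0)=+\infty$). With $\log_2^+(u):=\max\{\log_2u,0\}$, \[ M_{r_0,s_0}:=\bigl(1+\lceil\log_2^+(\Phi_{\mu,\ast}/r_0)\rceil\bigr)\bigl(1+\lceil\log_2(R_\ast/s_0)\rceil\bigr). \] $(u)_+=\max\{u,0\}$; $a\asymp b$ means equality up to absolute positive multiplicative constants. *)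

theory Defs
  imports "HOL-Probability.Probability"
begin

text \<open>A Gaussian law may be degenerate, in which case it is a point mass.\<close>

definition gaussian_rv :: "'w measure \<Rightarrow> ('w \<Rightarrow> real) \<Rightarrow> bool" where
  "gaussian_rv M Y \<longleftrightarrow> Y \<in> borel_measurable M \<and>
     ((\<exists>c. AE \<omega> in M. Y \<omega> = c) \<or>
      (\<exists>m s. s > 0 \<and> distributed M lborel Y (\<lambda>y. ennreal (normal_density m s y))))"

definition gaussian_process :: "'w measure \<Rightarrow> 'i set \<Rightarrow> ('i \<Rightarrow> 'w \<Rightarrow> real) \<Rightarrow> bool" where
  "gaussian_process M T X \<longleftrightarrow>
     (\<forall>a :: 'i \<Rightarrow> real. gaussian_rv M (\<lambda>\<omega>. \<Sum>x\<in>T. a x * X x \<omega>))"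

definition anchored_gaussian_process ::
  "'w measure \<Rightarrow> 'i set \<Rightarrow> ('i \<Rightarrow> 'w \<Rightarrow> real) \<Rightarrow> 'i \<Rightarrow> bool" where
  "anchored_gaussian_process M T X x0 \<longleftrightarrow>
     prob_space M \<and> finite T \<and> gaussian_process M T X \<and>
     (\<forall>x\<in>T. (LINT \<omega>|M. X x \<omega>) = 0) \<and>
     x0 \<in> T \<and> (AE \<omega> in M. X x0 \<omega> = 0)"

definition gp_dist :: "'w measure \<Rightarrow> ('i \<Rightarrow> 'w \<Rightarrow> real) \<Rightarrow> 'i \<Rightarrow> 'i \<Rightarrow> real" where
  "gp_dist M X x y = sqrt (LINT \<omega>|M. \<bar>X x \<omega> - X y \<omega>\<bar>\<^sup>2)"

definition gp_sd :: "'w measure \<Rightarrow> ('i \<Rightarrow> 'w \<Rightarrow> real) \<Rightarrow> 'i \<Rightarrow> real" where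
  "gp_sd M X x = sqrt (LINT \<omega>|M. (X x \<omega>)\<^sup>2)"

definition gp_radius :: "'w measure \<Rightarrow> 'i set \<Rightarrow> ('i \<Rightarrow> 'w \<Rightarrow> real) \<Rightarrow> real" where
  "gp_radius M T X = (SUP x\<in>T. gp_sd M X x)"

definition gp_ball :: "'w measure \<Rightarrow> 'i set \<Rightarrow> ('i \<Rightarrow> 'w \<Rightarrow> real) \<Rightarrow> 'i \<Rightarrow> real \<Rightarrow> 'i set" where
  "gp_ball M T X x \<epsilon> = {y \<in> T. gp_dist M X x y \<le> \<epsilon>}"

definition prob_measures_on :: "'i set \<Rightarrow> 'i pmf set" where
  "prob_measures_on T = {\<mu>. set_pmf \<mu> \<subseteq> T}"

text \<open>\<open>log (1 / 0) = \<infinity>\<close> here, in contrast to the library's \<open>ln (1 / 0) = 0\<close>.\<close>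

definition sqrt_log_inv :: "real \<Rightarrow> ennreal" where
  "sqrt_log_inv p = (if p = 0 then \<infinity> else ennreal (sqrt (ln (1 / p))))"

definition mm_integral ::
  "'w measure \<Rightarrow> 'i set \<Rightarrow> ('i \<Rightarrow> 'w \<Rightarrow> real) \<Rightarrow> 'i pmf \<Rightarrow> 'i \<Rightarrow> ennreal" where
  "mm_integral M T X \<mu> x =
     (\<integral>\<^sup>+ \<epsilon> \<in> {0..4 * gp_sd M X x}.
        sqrt_log_inv (measure_pmf.prob \<mu> (gp_ball M T X x \<epsilon>)) \<partial>lborel)"

definition mm_sup :: "'w measure \<Rightarrow> 'i set \<Rightarrow> ('i \<Rightarrow> 'w \<Rightarrow> real) \<Rightarrow> 'i pmf \<Rightarrow> ennreal" where
  "mm_sup M T X \<mu> = (SUP x\<in>T. mm_integral M T X \<mu> x)"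

text \<open>Since \<open>log 2 0 = 0\<close> in the library, \<open>log2_plus 0 = 0\<close>, in agreement with
  \<open>max (-\<infinity>) 0 = 0\<close>.\<close>

definition log2_plus :: "real \<Rightarrow> real" where
  "log2_plus u = max (log 2 u) 0"

definition scale_count ::
  "'w measure \<Rightarrow> 'i set \<Rightarrow> ('i \<Rightarrow> 'w \<Rightarrow> real) \<Rightarrow> 'i pmf \<Rightarrow> real \<Rightarrow> real \<Rightarrow> int" where
  "scale_count M T X \<mu> r0 s0 =
     (1 + \<lceil>log2_plus (enn2real (mm_sup M T X \<mu>) / r0)\<rceil>) *
     (1 + \<lceil>log 2 (gp_radius M T X / s0)\<rceil>)"

text \<open>\<open>admissible_constant TYPE('w) TYPE('i) C\<close>: all the estimates hold with the constant
  \<open>C\<close> for every anchored Gaussian process on a sample space of type \<open>'w\<close> with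
  index set in \<open>'i\<close>. The types are explicit arguments because the witness of
  \<open>\<exists>C\<close> in a polymorphic theorem may depend on the type variables; an absolute constant
  is one that is admissible at all pairs of types simultaneously. The two-sided comparison is stated in the extended nonnegative reals,
  so that the infimum needs no separate finiteness claim.\<close>

definition admissible_constant :: "'w itself \<Rightarrow> 'i itself \<Rightarrow> real \<Rightarrow> bool" where
  "admissible_constant (_ :: 'w itself) (_ :: 'i itself) C \<longleftrightarrow>
    (\<forall>(M :: 'w measure) (T :: 'i set) (X :: 'i \<Rightarrow> 'w \<Rightarrow> real) (x0 :: 'i).
      anchored_gaussian_process M T X x0 \<and> 0 < gp_radius M T X \<longrightarrow>
      (let \<sigma> = gp_sd M X; R = gp_radius M T X;
           \<Phi> = (\<lambda>\<mu> x. enn2real (mm_integral M T X \<mu> x));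
           N = (\<lambda>\<mu> r0 s0. real_of_int (scale_count M T X \<mu> r0 s0))
       in
        (\<forall>\<mu>\<in>prob_measures_on T. \<forall>r0 s0 :: real.
          mm_sup M T X \<mu> < \<infinity> \<and> 0 < r0 \<and> 0 < s0 \<and> s0 \<le> R \<longrightarrow>
            (LINT \<omega>|M. (SUP x\<in>T. max (\<bar>X x \<omega>\<bar> - C * max (\<Phi> \<mu> x) r0) 0 / max (\<sigma> x) s0))
              \<le> C * sqrt (ln (exp 1 * N \<mu> r0 s0)) \<and>
            (\<forall>x\<in>T. (LINT \<omega>|M. \<bar>X x \<omega>\<bar>)
              \<le> C * max (\<Phi> \<mu> x) r0 + C * max (\<sigma> x) s0 * sqrt (ln (exp 1 * N \<mu> r0 s0))) \<and>
            (mm_sup M T X \<mu> \<le> ennreal r0 \<and> s0 = R \<longrightarrow>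
              scale_count M T X \<mu> r0 s0 = 1 \<and>
              (LINT \<omega>|M. (SUP x\<in>T. \<bar>X x \<omega>\<bar>)) \<le> C * (r0 + R))) \<and>
        ennreal (LINT \<omega>|M. (SUP x\<in>T. \<bar>X x \<omega>\<bar>))
          \<le> ennreal C * (ennreal R + (INF \<mu>\<in>prob_measures_on T. mm_sup M T X \<mu>)) \<and>
        ennreal R + (INF \<mu>\<in>prob_measures_on T. mm_sup M T X \<mu>)
          \<le> ennreal C * ennreal (LINT \<omega>|M. (SUP x\<in>T. \<bar>X x \<omega>\<bar>))))"

end

theory Submission imports Defs
begin

text \<open>Choosing a constant for all types is harmless because a process with finite index set can be
  replaced by its law on \<open>nat \<Rightarrow> real\<close>.

  The upper bound is a pathwise chaining argument. Let \<open>Y k\<close> be the \<open>\<mu>\<close>-average of the process over the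
  ball of radius \<open>2 powr -k * \<sigma> x\<close> around \<open>x\<close>. The elementary inequality
  \<open>u \<le> sqrt (ln a) + exp (u\<^sup>2) / a\<close> bounds \<open>\<bar>Y (Suc k) - Y k\<bar>\<close> by the radius times the square roots of the
  logarithms of the two masses plus one random variable \<open>W\<close>, a double \<open>\<mu>\<close>-average of
  \<open>exp ((X y - X z)\<^sup>2 / (4 * d(y,z)\<^sup>2))\<close>, which depends neither on \<open>x\<close> nor on \<open>k\<close> and has mean at most 4.
  Summing up, \<open>\<bar>X x\<bar> \<le> 32 * \<Phi> x + 12 * \<sigma> x * W\<close> for all \<open>x\<close> simultaneously, and
  \<open>N \<ge> 1\<close> makes the square root in the first two estimates at least 1.

  The lower bound is the majorizing measure theorem. Its growth condition follows from the
  Sudakov--Fernique inequality, which is obtained by exchanging small independent increments of the two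
  processes one at a time inside \<open>log_sum_exp\<close> (stability of Gaussian laws comes from uniqueness of
  joint characteristic functions). A greedy partition into pieces of radius \<open>a / 4\<close>, in which the
  \<open>i\<close>-th piece receives mass of order \<open>1 / i\<^sup>2\<close>, is iterated over the scales; the growth condition
  makes a potential decrease by the cost of each piece.\<close>

section \<open>Centered normal random variables\<close>

text \<open>Gaussianity is given through one-dimensional laws of linear combinations, while the
  comparison of two processes needs equality of the laws of whole finite families that live on
  different product spaces. A quadratic form is therefore carried along with each family; two
  families with the same form have the same joint law. On the chaining side the variable
  \<open>W\<close> is common to all points, so the supremum may stay inside the expectation and no
  union bound over points occurs. On the lower side the growth condition compares a set with several
  separated small balls inside it. The greedy choice of centres makes the latest of these balls the
  weakest one, and this is what lets a late piece pay for its small mass. Distances between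
  different points may vanish, and \<open>X x0\<close> is almost surely 0. Normal laws are therefore
  encoded as images of the standard normal law under scaling, which includes variance 0, and
  quotients by a vanishing distance are governed by the convention \<open>x / 0 = 0\<close>.\<close>

definition centered_normal :: "'a measure \<Rightarrow> ('a \<Rightarrow> real) \<Rightarrow> real \<Rightarrow> bool" where
  "centered_normal P Y v \<longleftrightarrow> prob_space P \<and> Y \<in> borel_measurable P \<and> 0 \<le> v \<and>
     distr P borel Y = distr std_normal_distribution borel (\<lambda>x. sqrt v * x)"

lemma prob_space_std_normal: "prob_space std_normal_distribution"
  by (rule prob_space_normal_density) simp

lemma distr_std_normal_mult_1:
  "distr std_normal_distribution borel (\<lambda>x. 1 * x) = std_normal_distribution"
proof -
  have "distr std_normal_distribution borel (\<lambda>x. 1 * x)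
      = distr std_normal_distribution std_normal_distribution (\<lambda>x. x)"
    by (rule distr_cong) auto
  then show ?thesis by simp
qed

lemma centered_normalD:
  assumes "centered_normal P Y v"
  shows "prob_space P" "Y \<in> borel_measurable P" "0 \<le> v"
  using assms by (auto simp: centered_normal_def)

lemma
  fixes f :: "real \<Rightarrow> 'b::{banach, second_countable_topology}"
  assumes cn: "centered_normal P Y v" and f[measurable]: "f \<in> borel_measurable borel"
  shows centered_normal_integral:
      "(\<integral>\<omega>. f (Y \<omega>) \<partial>P) = (\<integral>x. f (sqrt v * x) \<partial>std_normal_distribution)"
    and centered_normal_integrable_iff:
      "integrable P (\<lambda>\<omega>. f (Y \<omega>)) \<longleftrightarrow> integrable std_normal_distribution (\<lambda>x. f (sqrt v * x))"
proof -
  note [measurable] = centered_normalD(2)[OF cn]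
  have eq: "distr P borel Y = distr std_normal_distribution borel (\<lambda>x. sqrt v * x)"
    using cn by (simp add: centered_normal_def)
  have "(\<integral>\<omega>. f (Y \<omega>) \<partial>P) = integral\<^sup>L (distr P borel Y) f"
    by (subst integral_distr) auto
  also have "\<dots> = (\<integral>x. f (sqrt v * x) \<partial>std_normal_distribution)"
    unfolding eq by (subst integral_distr) auto
  finally show "(\<integral>\<omega>. f (Y \<omega>) \<partial>P) = (\<integral>x. f (sqrt v * x) \<partial>std_normal_distribution)" .
  have "integrable P (\<lambda>\<omega>. f (Y \<omega>)) \<longleftrightarrow> integrable (distr P borel Y) f"
    by (subst integrable_distr_eq) auto
  also have "\<dots> \<longleftrightarrow> integrable std_normal_distribution (\<lambda>x. f (sqrt v * x))"
    unfolding eq by (subst integrable_distr_eq) auto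
  finally show "integrable P (\<lambda>\<omega>. f (Y \<omega>)) \<longleftrightarrow> integrable std_normal_distribution (\<lambda>x. f (sqrt v * x))" .
qed

lemma centered_normal_char:
  assumes "centered_normal P Y v"
  shows "(\<integral>\<omega>. iexp (u * Y \<omega>) \<partial>P) = of_real (exp (- (v * u\<^sup>2) / 2))"
proof -
  have "(\<integral>\<omega>. iexp (u * Y \<omega>) \<partial>P) = (\<integral>x. iexp (u * (sqrt v * x)) \<partial>std_normal_distribution)"
    by (rule centered_normal_integral[OF assms]) measurable
  also have "\<dots> = char std_normal_distribution (u * sqrt v)"
    unfolding char_def by (simp add: mult.assoc)
  also have "\<dots> = of_real (exp (- (v * u\<^sup>2) / 2))"
    using centered_normalD(3)[OF assms]
    by (simp add: char_std_normal_distribution power_mult_distrib mult.commute)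
  finally show ?thesis .
qed

text \<open>Levy uniqueness makes this the introduction rule by which multiples, independent sums
  and point masses at 0 are recognized as centered normal.\<close>

lemma centered_normalI_char:
  assumes P: "prob_space P" and Y[measurable]: "Y \<in> borel_measurable P" and v: "0 \<le> v"
    and char: "\<And>u. (\<integral>\<omega>. iexp (u * Y \<omega>) \<partial>P) = of_real (exp (- (v * u\<^sup>2) / 2))"
  shows "centered_normal P Y v"
proof -
  interpret P: prob_space P by fact
  interpret S: prob_space std_normal_distribution by (rule prob_space_std_normal)
  have "distr P borel Y = distr std_normal_distribution borel (\<lambda>x. sqrt v * x)"
  proof (rule Levy_uniqueness)
    show "real_distribution (distr P borel Y)"
      by (rule P.real_distribution_distr) measurable
    show "real_distribution (distr std_normal_distribution borel (\<lambda>x. sqrt v * x))"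
      by (rule S.real_distribution_distr) measurable
    show "char (distr P borel Y) = char (distr std_normal_distribution borel (\<lambda>x. sqrt v * x))"
    proof
      fix u
      have "char (distr P borel Y) u = of_real (exp (- (v * u\<^sup>2) / 2))"
        using char[of u] by (simp add: char_def integral_distr)
      also have "\<dots> = char std_normal_distribution (u * sqrt v)"
        using v by (simp add: char_std_normal_distribution power_mult_distrib mult.commute)
      also have "\<dots> = char (distr std_normal_distribution borel (\<lambda>x. sqrt v * x)) u"
        by (simp add: char_def integral_distr mult.assoc)
      finally show "char (distr P borel Y) u = char (distr std_normal_distribution borel (\<lambda>x. sqrt v * x)) u" .
    qed
  qed
  then show ?thesis using assms by (simp add: centered_normal_def)
qed

section \<open>Moments of a centered normal variable\<close>

lemma centered_normal_integrable_abs_power: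
  assumes "centered_normal P Y v"
  shows "integrable P (\<lambda>\<omega>. \<bar>Y \<omega>\<bar> ^ k)"
proof -
  have "integrable std_normal_distribution (\<lambda>x. \<bar>x\<bar> ^ k)"
    using integrable_abs[OF integrable_std_normal_distribution_moment[of k]] by (simp add: power_abs)
  then have "integrable std_normal_distribution (\<lambda>x. \<bar>sqrt v * x\<bar> ^ k)"
    by (simp add: abs_mult power_mult_distrib)
  then show ?thesis
    by (subst centered_normal_integrable_iff[OF assms, of "\<lambda>y. \<bar>y\<bar> ^ k"]) auto
qed

lemma centered_normal_integrable:
  assumes "centered_normal P Y v"
  shows "integrable P Y"
proof -
  note [measurable] = centered_normalD(2)[OF assms]
  have "integrable P (\<lambda>\<omega>. \<bar>Y \<omega>\<bar>)"
    using centered_normal_integrable_abs_power[OF assms, of 1] by simp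
  then show ?thesis by (simp add: integrable_abs_iff)
qed

lemma centered_normal_integrable_square:
  assumes "centered_normal P Y v"
  shows "integrable P (\<lambda>\<omega>. (Y \<omega>)\<^sup>2)"
  using centered_normal_integrable_abs_power[OF assms, of 2] by simp

lemma centered_normal_mean:
  assumes "centered_normal P Y v"
  shows "(\<integral>\<omega>. Y \<omega> \<partial>P) = 0"
  using integral_std_normal_distribution_moment_odd[of 1]
  by (subst centered_normal_integral[OF assms, of "\<lambda>y. y"]) auto

lemma centered_normal_second_moment:
  assumes "centered_normal P Y v"
  shows "(\<integral>\<omega>. (Y \<omega>)\<^sup>2 \<partial>P) = v"
  using std_normal_distribution_even_moments(1)[of 1] centered_normalD(3)[OF assms]
  by (subst centered_normal_integral[OF assms, of "\<lambda>y. y\<^sup>2"]) (auto simp: power_mult_distrib)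

lemma centered_normal_abs_moment:
  assumes "centered_normal P Y v"
  shows "(\<integral>\<omega>. \<bar>Y \<omega>\<bar> \<partial>P) = sqrt (2 / pi) * sqrt v"
  using std_normal_distribution_odd_moments_abs[of 0] centered_normalD(3)[OF assms]
  by (subst centered_normal_integral[OF assms, of "\<lambda>y. \<bar>y\<bar>"]) (auto simp: abs_mult)

text \<open>The mean of the absolute value is \<open>sqrt (2 / pi)\<close> times the standard
  deviation, and \<open>sqrt (2 / pi)\<close> is at least 1/2. This bounds the radius of the process
  by its expected supremum.\<close>

lemma centered_normal_sd_le:
  assumes "centered_normal P Y v"
  shows "sqrt v \<le> 2 * (\<integral>\<omega>. \<bar>Y \<omega>\<bar> \<partial>P)"
proof -
  have "1 / 2 \<le> sqrt (2 / pi)"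
    by (rule real_le_rsqrt) (use pi_less_4 in \<open>simp add: field_simps power2_eq_square\<close>)
  then show ?thesis
    using centered_normalD(3)[OF assms] mult_right_mono[of "1/2" "sqrt (2/pi)" "sqrt v"]
    by (simp add: centered_normal_abs_moment[OF assms])
qed

text \<open>Multiplying the standard normal density by \<open>exp (x\<^sup>2 / 4)\<close> gives
  \<open>sqrt 2\<close> times the density of variance 2, so the integral is \<open>sqrt 2\<close>.
  For \<open>v = 0\<close> the quotient in the exponent is 0 and the integral is 1. The bound 2
  covers both cases.\<close>

lemma
  assumes "centered_normal P Y v"
  shows centered_normal_integrable_exp_square: "integrable P (\<lambda>\<omega>. exp ((Y \<omega>)\<^sup>2 / (4 * v)))"
    and centered_normal_exp_square_le: "(\<integral>\<omega>. exp ((Y \<omega>)\<^sup>2 / (4 * v)) \<partial>P) \<le> 2"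
proof -
  interpret S: prob_space std_normal_distribution by (rule prob_space_std_normal)
  have *: "has_bochner_integral std_normal_distribution
      (\<lambda>x. exp ((sqrt v * x)\<^sup>2 / (4 * v))) (if v = 0 then 1 else sqrt 2)"
  proof (cases "v = 0")
    case True
    have "has_bochner_integral std_normal_distribution (\<lambda>x. 1 :: real) 1"
      using S.prob_space by (simp add: has_bochner_integral_iff)
    then show ?thesis using True by simp
  next
    case False
    with centered_normalD(3)[OF assms] have v: "v > 0" by simp
    have eq: "exp ((sqrt v * x)\<^sup>2 / (4 * v)) = exp (x\<^sup>2 / 4)" for x
      using v by (simp add: power_mult_distrib)
    have dens: "std_normal_density x * exp (x\<^sup>2 / 4) = sqrt 2 * normal_density 0 (sqrt 2) x" for x :: real
    proof -
      have "exp (- x\<^sup>2 / 2) * exp (x\<^sup>2 / 4) = exp (- x\<^sup>2 / 4)"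
        unfolding exp_add[symmetric] by (rule arg_cong[of _ _ exp]) (simp add: field_simps)
      moreover have "sqrt (2 * pi * (sqrt 2)\<^sup>2) = sqrt 2 * sqrt (2 * pi)"
        by (simp add: real_sqrt_mult)
      ultimately show ?thesis
        by (simp add: normal_density_def)
    qed
    have "has_bochner_integral lborel (\<lambda>x. sqrt 2 * normal_density 0 (sqrt 2) x) (sqrt 2)"
      using has_bochner_integral_mult_right[of "sqrt 2" lborel "normal_density 0 (sqrt 2)" 1]
      by (simp add: has_bochner_integral_iff)
    then show ?thesis
      using v by (subst has_bochner_integral_density) (simp_all add: eq dens del: power_mult_distrib)
  qed
  show "integrable P (\<lambda>\<omega>. exp ((Y \<omega>)\<^sup>2 / (4 * v)))"
    using * by (subst centered_normal_integrable_iff[OF assms, of "\<lambda>y. exp (y\<^sup>2 / (4 * v))"])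
      (auto simp: has_bochner_integral_iff)
  have "(\<integral>\<omega>. exp ((Y \<omega>)\<^sup>2 / (4 * v)) \<partial>P) = (if v = 0 then 1 else sqrt 2)"
    using * by (subst centered_normal_integral[OF assms, of "\<lambda>y. exp (y\<^sup>2 / (4 * v))"])
      (auto simp: has_bochner_integral_iff)
  also have "\<dots> \<le> 2"
    using real_sqrt_le_mono[of 2 4] by (simp split: if_splits)
  finally show "(\<integral>\<omega>. exp ((Y \<omega>)\<^sup>2 / (4 * v)) \<partial>P) \<le> 2" .
qed

section \<open>Stability under scaling and independent sums\<close>

lemma centered_normal_cmult:
  assumes "centered_normal P Y v"
  shows "centered_normal P (\<lambda>\<omega>. c * Y \<omega>) (c\<^sup>2 * v)"
proof (rule centered_normalI_char)
  note cn = centered_normalD[OF assms]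
  show "prob_space P" by fact
  show "(\<lambda>\<omega>. c * Y \<omega>) \<in> borel_measurable P" using cn(2) by measurable
  show "0 \<le> c\<^sup>2 * v" using cn(3) by simp
  fix u
  have "(\<integral>\<omega>. iexp (u * (c * Y \<omega>)) \<partial>P) = (\<integral>\<omega>. iexp ((u * c) * Y \<omega>) \<partial>P)"
    by (simp add: mult.assoc)
  also have "\<dots> = of_real (exp (- (v * (u * c)\<^sup>2) / 2))"
    by (rule centered_normal_char[OF assms])
  finally show "(\<integral>\<omega>. iexp (u * (c * Y \<omega>)) \<partial>P) = of_real (exp (- ((c\<^sup>2 * v) * u\<^sup>2) / 2))"
    by (simp add: power_mult_distrib mult_ac)
qed

lemma centered_normal_std: "centered_normal std_normal_distribution (\<lambda>x. x) 1"
  unfolding centered_normal_def using prob_space_std_normal by (auto intro!: distr_cong)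

lemma centered_normal_pair_add:
  assumes Y: "centered_normal P Y v" and Z: "centered_normal Q Z w"
  shows "centered_normal (P \<Otimes>\<^sub>M Q) (\<lambda>p. Y (fst p) + Z (snd p)) (v + w)"
proof (rule centered_normalI_char)
  note cY = centered_normalD[OF Y] and cZ = centered_normalD[OF Z]
  note [measurable] = cY(2) cZ(2)
  interpret P: prob_space P by fact
  interpret Q: prob_space Q by fact
  interpret PQ: pair_prob_space P Q ..
  show "prob_space (P \<Otimes>\<^sub>M Q)" by unfold_locales
  show "(\<lambda>p. Y (fst p) + Z (snd p)) \<in> borel_measurable (P \<Otimes>\<^sub>M Q)" by measurable
  show "0 \<le> v + w" using cY cZ by simp
  fix u
  have int: "integrable (P \<Otimes>\<^sub>M Q) (\<lambda>p. iexp (u * (Y (fst p) + Z (snd p))))"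
    by (rule PQ.integrable_iexp) auto
  have "(\<integral>p. iexp (u * (Y (fst p) + Z (snd p))) \<partial>(P \<Otimes>\<^sub>M Q))
      = (\<integral>x. \<integral>y. iexp (u * (Y x + Z y)) \<partial>Q \<partial>P)"
    using PQ.integral_fst'[OF int, symmetric] by simp
  also have "\<dots> = (\<integral>x. iexp (u * Y x) * (\<integral>y. iexp (u * Z y) \<partial>Q) \<partial>P)"
    by (simp add: ring_distribs exp_add)
  also have "\<dots> = of_real (exp (- (v * u\<^sup>2) / 2)) * of_real (exp (- (w * u\<^sup>2) / 2))"
    using centered_normal_char[OF Y, of u] centered_normal_char[OF Z, of u] by simp
  also have "\<dots> = of_real (exp (- (v * u\<^sup>2) / 2 + - (w * u\<^sup>2) / 2))"
    by (simp only: exp_add of_real_mult)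
  finally show "(\<integral>p. iexp (u * (Y (fst p) + Z (snd p))) \<partial>(P \<Otimes>\<^sub>M Q))
      = of_real (exp (- ((v + w) * u\<^sup>2) / 2))"
    by (simp add: field_simps)
qed

lemma centered_normal_PiM_sum:
  assumes I: "finite I" and Y: "\<And>i. i \<in> I \<Longrightarrow> centered_normal P (Y i) (v i)"
    and P: "prob_space P"
  shows "centered_normal (PiM I (\<lambda>_. P)) (\<lambda>\<omega>. \<Sum>i\<in>I. Y i (\<omega> i)) (\<Sum>i\<in>I. v i)"
proof (rule centered_normalI_char)
  interpret P: prob_space P by fact
  interpret PP: product_prob_space "\<lambda>_. P" I ..
  have [measurable]: "Y i \<in> borel_measurable P" if "i \<in> I" for i
    using centered_normalD(2)[OF Y[OF that]] .
  show "prob_space (PiM I (\<lambda>_. P))" by (intro prob_space_PiM P)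
  show "(\<lambda>\<omega>. \<Sum>i\<in>I. Y i (\<omega> i)) \<in> borel_measurable (PiM I (\<lambda>_. P))"
    by measurable
  show "0 \<le> (\<Sum>i\<in>I. v i)" using centered_normalD(3)[OF Y] by (intro sum_nonneg) auto
  fix u
  have "(\<integral>\<omega>. iexp (u * (\<Sum>i\<in>I. Y i (\<omega> i))) \<partial>PiM I (\<lambda>_. P))
      = (\<integral>\<omega>. (\<Prod>i\<in>I. iexp (u * Y i (\<omega> i))) \<partial>PiM I (\<lambda>_. P))"
    by (simp add: sum_distrib_left exp_sum[OF I])
  also have "\<dots> = (\<Prod>i\<in>I. \<integral>x. iexp (u * Y i x) \<partial>P)"
    by (rule PP.product_integral_prod[OF I, where f = "\<lambda>i x. iexp (u * Y i x)"])
       (auto intro!: P.integrable_iexp)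
  also have "\<dots> = (\<Prod>i\<in>I. of_real (exp (- (v i * u\<^sup>2) / 2)))"
    using centered_normal_char[OF Y] by simp
  also have "\<dots> = of_real (exp (\<Sum>i\<in>I. - (v i * u\<^sup>2) / 2))"
    unfolding exp_sum[OF I] of_real_prod ..
  also have "(\<Sum>i\<in>I. - (v i * u\<^sup>2) / 2) = - ((\<Sum>i\<in>I. v i) * u\<^sup>2) / 2"
    by (simp add: sum_distrib_right sum_negf sum_divide_distrib)
  finally show "(\<integral>\<omega>. iexp (u * (\<Sum>i\<in>I. Y i (\<omega> i))) \<partial>PiM I (\<lambda>_. P))
      = of_real (exp (- ((\<Sum>i\<in>I. v i) * u\<^sup>2) / 2))" .
qed

lemma gaussian_rv_integrable:
  assumes P: "prob_space P" and Y: "gaussian_rv P Y"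
  shows "integrable P Y"
proof -
  interpret prob_space P by fact
  have [measurable]: "Y \<in> borel_measurable P" using Y by (simp add: gaussian_rv_def)
  consider (const) c where "AE \<omega> in P. Y \<omega> = c"
    | (normal) m s where "s > 0" "distributed P lborel Y (\<lambda>y. ennreal (normal_density m s y))"
    using Y by (auto simp: gaussian_rv_def)
  then show ?thesis
  proof cases
    case const
    then show ?thesis by (subst integrable_cong_AE[where g = "\<lambda>_. c"]) auto
  next
    case normal
    then show ?thesis
      by (intro distributed_integrable_var[OF normal(2)] integrable_normal_moment_nz_1) auto
  qed
qed

text \<open>Mean 0 forces the point mass in one alternative of \<open>gaussian_rv\<close> to sit at
  0, and the location parameter in the other to be 0. Either way a scaled standard normal remains,
  and its parameter is recovered as the second moment.\<close>

lemma gaussian_rv_centered_normal: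
  assumes P: "prob_space P" and Y: "gaussian_rv P Y" and mean: "(\<integral>\<omega>. Y \<omega> \<partial>P) = 0"
  shows "centered_normal P Y (\<integral>\<omega>. (Y \<omega>)\<^sup>2 \<partial>P)"
proof -
  interpret prob_space P by fact
  have Ym[measurable]: "Y \<in> borel_measurable P" using Y by (simp add: gaussian_rv_def)
  consider (const) c where "AE \<omega> in P. Y \<omega> = c"
    | (normal) m s where "s > 0" "distributed P lborel Y (\<lambda>y. ennreal (normal_density m s y))"
    using Y by (auto simp: gaussian_rv_def)
  then have "\<exists>v. centered_normal P Y v"
  proof cases
    case const
    have "(\<integral>\<omega>. Y \<omega> \<partial>P) = (\<integral>\<omega>. c \<partial>P)" using const by (intro integral_cong_AE) auto
    then have "c = 0" using mean prob_space by simp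
    have "(\<integral>\<omega>. iexp (u * Y \<omega>) \<partial>P) = (\<integral>\<omega>. 1 \<partial>P)" for u
      using const \<open>c = 0\<close> by (intro integral_cong_AE) auto
    then have "centered_normal P Y 0"
      using prob_space by (intro centered_normalI_char P Ym) auto
    then show ?thesis ..
  next
    case normal
    then have "m = 0" using normal_distributed_expectation[OF normal] mean by simp
    let ?Z = "\<lambda>\<omega>. (Y \<omega> - m) / s"
    have Z: "distributed P lborel ?Z (\<lambda>y. ennreal (std_normal_density y))"
      using normal normal_standard_normal_convert by blast
    have "distr P borel ?Z = distr P lborel ?Z" by (intro distr_cong) auto
    also have "\<dots> = std_normal_distribution" using Z by (simp add: distributed_def)
    finally have "centered_normal P ?Z 1"
      unfolding centered_normal_def using P by (simp add: distr_std_normal_mult_1)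
    from centered_normal_cmult[OF this, of s] show ?thesis
      using \<open>s > 0\<close> \<open>m = 0\<close> by auto
  qed
  then obtain v where v: "centered_normal P Y v" ..
  then show ?thesis using centered_normal_second_moment[OF v] by simp
qed

section \<open>Joint characteristic functions\<close>

text \<open>The case \<open>a = 0\<close> shows that both weights have the same total mass. Division
  by it turns them into probability densities, to which Levy uniqueness applies; total mass 0 is
  treated apart. In the induction over coordinates the weights record those coordinates that are
  already confined to Borel sets.\<close>

lemma weighted_char_unique:
  fixes X :: "'a \<Rightarrow> real" and Y :: "'b \<Rightarrow> real"
  assumes u: "integrable M u" "\<And>\<omega>. 0 \<le> u \<omega>" and v: "integrable N v" "\<And>\<omega>. 0 \<le> v \<omega>"
    and X[measurable]: "X \<in> borel_measurable M" and Y[measurable]: "Y \<in> borel_measurable N"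
    and eq: "\<And>a. (\<integral>\<omega>. of_real (u \<omega>) * iexp (a * X \<omega>) \<partial>M) = (\<integral>\<omega>. of_real (v \<omega>) * iexp (a * Y \<omega>) \<partial>N)"
    and B[measurable]: "B \<in> sets borel"
  shows "(\<integral>\<omega>. u \<omega> * indicator B (X \<omega>) \<partial>M) = (\<integral>\<omega>. v \<omega> * indicator B (Y \<omega>) \<partial>N)"
proof -
  note [measurable] = borel_measurable_integrable[OF u(1)] borel_measurable_integrable[OF v(1)]
  define c where "c = (\<integral>\<omega>. u \<omega> \<partial>M)"
  have "complex_of_real c = of_real (\<integral>\<omega>. v \<omega> \<partial>N)"
    using eq[of 0] by (simp add: c_def)
  then have cv: "c = (\<integral>\<omega>. v \<omega> \<partial>N)" by (simp only: of_real_eq_iff)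
  have "0 \<le> c" unfolding c_def using u by simp
  show ?thesis
  proof (cases "c = 0")
    case True
    have "AE \<omega> in M. u \<omega> = 0" using integral_nonneg_eq_0_iff_AE[OF u(1)] u(2) True c_def by simp
    then have "(\<integral>\<omega>. u \<omega> * indicator B (X \<omega>) \<partial>M) = (\<integral>\<omega>. 0 \<partial>M)"
      by (intro integral_cong_AE) auto
    moreover have "AE \<omega> in N. v \<omega> = 0" using integral_nonneg_eq_0_iff_AE[OF v(1)] v(2) True cv by simp
    then have "(\<integral>\<omega>. v \<omega> * indicator B (Y \<omega>) \<partial>N) = (\<integral>\<omega>. 0 \<partial>N)"
      by (intro integral_cong_AE) auto
    ultimately show ?thesis by simp
  next
    case False
    with \<open>0 \<le> c\<close> have c: "c > 0" by simp
    have prob: "prob_space (density L (\<lambda>\<omega>. w \<omega> / c))"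
      if w: "integrable L w" "\<And>\<omega>. 0 \<le> w \<omega>" "c = (\<integral>\<omega>. w \<omega> \<partial>L)" for L :: "'c measure" and w
    proof
      note [measurable] = borel_measurable_integrable[OF w(1)]
      show "emeasure (density L (\<lambda>\<omega>. w \<omega> / c)) (space (density L (\<lambda>\<omega>. w \<omega> / c))) = 1"
        using c w by (simp add: emeasure_density nn_integral_eq_integral)
    qed
    let ?P = "density M (\<lambda>\<omega>. u \<omega> / c)" and ?Q = "density N (\<lambda>\<omega>. v \<omega> / c)"
    interpret P: prob_space ?P by (rule prob) (use u c_def in auto)
    interpret Q: prob_space ?Q by (rule prob) (use v cv in auto)
    have "distr ?P borel X = distr ?Q borel Y"
    proof (rule Levy_uniqueness)
      show "real_distribution (distr ?P borel X)" by (rule P.real_distribution_distr) simp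
      show "real_distribution (distr ?Q borel Y)" by (rule Q.real_distribution_distr) simp
      show "char (distr ?P borel X) = char (distr ?Q borel Y)"
      proof
        fix a
        have "char (distr ?P borel X) a = (\<integral>\<omega>. (u \<omega> / c) *\<^sub>R iexp (a * X \<omega>) \<partial>M)"
          unfolding char_def using u(2) c by (subst integral_distr, simp, simp, subst integral_density) auto
        also have "\<dots> = (\<integral>\<omega>. of_real (u \<omega>) * iexp (a * X \<omega>) \<partial>M) / of_real c"
          by (simp add: scaleR_conv_of_real)
        also have "\<dots> = (\<integral>\<omega>. of_real (v \<omega>) * iexp (a * Y \<omega>) \<partial>N) / of_real c"
          using eq by simp
        also have "\<dots> = (\<integral>\<omega>. (v \<omega> / c) *\<^sub>R iexp (a * Y \<omega>) \<partial>N)"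
          by (simp add: scaleR_conv_of_real)
        also have "\<dots> = char (distr ?Q borel Y) a"
          unfolding char_def using v(2) c by (subst integral_distr, simp, simp, subst integral_density) auto
        finally show "char (distr ?P borel X) a = char (distr ?Q borel Y) a" .
      qed
    qed
    then have "(\<integral>x. indicator B x \<partial>distr ?P borel X) = (\<integral>x. (indicator B x :: real) \<partial>distr ?Q borel Y)"
      by simp
    moreover have "(\<integral>x. (indicator B x :: real) \<partial>distr ?P borel X) = (\<integral>\<omega>. (u \<omega> / c) *\<^sub>R indicator B (X \<omega>) \<partial>M)"
      using u(2) c by (subst integral_distr, simp, simp, subst integral_density) auto
    moreover have "(\<integral>x. (indicator B x :: real) \<partial>distr ?Q borel Y) = (\<integral>\<omega>. (v \<omega> / c) *\<^sub>R indicator B (Y \<omega>) \<partial>N)"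
      using v(2) c by (subst integral_distr, simp, simp, subst integral_density) auto
    ultimately show ?thesis using c by simp
  qed
qed

lemma cos_diff_iexp:
  "complex_of_real (cos (x - \<theta>)) = (iexp (- \<theta>) * iexp x + iexp \<theta> * iexp (- x)) / 2"
proof -
  have "complex_of_real (cos (x - \<theta>)) = (iexp (x - \<theta>) + iexp (- (x - \<theta>))) / 2"
    by (simp add: cos_of_real[symmetric] cos_exp_eq algebra_simps)
  then show ?thesis by (simp add: exp_add[symmetric] ring_distribs)
qed

text \<open>Induction over the coordinates. The indicator of \<open>X s\<close> in
  \<open>B s\<close> is moved into the weight, and the hypothesis must be re-established for the new
  weight and the remaining coordinates. Their exponential cannot serve as a weight, being complex,
  but \<open>1 + cos (L - \<theta>)\<close> can, where \<open>L\<close> is a linear combination of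
  the remaining coordinates. The transform in \<open>X s\<close> of the resulting weight is a
  combination of the given joint characteristic functions.\<close>

lemma weighted_joint_char_unique:
  fixes X :: "'i \<Rightarrow> 'a \<Rightarrow> real" and Y :: "'i \<Rightarrow> 'b \<Rightarrow> real"
  assumes "finite T"
    and "integrable M u" "\<And>\<omega>. 0 \<le> u \<omega>" and "integrable N v" "\<And>\<omega>. 0 \<le> v \<omega>"
    and "\<And>t. t \<in> T \<Longrightarrow> X t \<in> borel_measurable M" and "\<And>t. t \<in> T \<Longrightarrow> Y t \<in> borel_measurable N"
    and "\<And>c. (\<integral>\<omega>. of_real (u \<omega>) * iexp (\<Sum>t\<in>T. c t * X t \<omega>) \<partial>M)
            = (\<integral>\<omega>. of_real (v \<omega>) * iexp (\<Sum>t\<in>T. c t * Y t \<omega>) \<partial>N)"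
    and "\<And>t. t \<in> T \<Longrightarrow> B t \<in> sets borel"
  shows "(\<integral>\<omega>. u \<omega> * (\<Prod>t\<in>T. indicator (B t) (X t \<omega>)) \<partial>M)
       = (\<integral>\<omega>. v \<omega> * (\<Prod>t\<in>T. indicator (B t) (Y t \<omega>)) \<partial>N)"
  using assms
proof (induction T arbitrary: u v rule: finite_induct)
  case empty
  have "complex_of_real (\<integral>\<omega>. u \<omega> \<partial>M) = of_real (\<integral>\<omega>. v \<omega> \<partial>N)"
    using empty.prems(7) by simp
  then show ?case by (simp only: of_real_eq_iff prod.empty mult_1_right)
next
  case (insert s S)
  note [measurable] = borel_measurable_integrable[OF insert.prems(1)] borel_measurable_integrable[OF insert.prems(3)]
  have [measurable]: "X s \<in> borel_measurable M" "Y s \<in> borel_measurable N" "B s \<in> sets borel"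
    "\<And>t. t \<in> S \<Longrightarrow> X t \<in> borel_measurable M" "\<And>t. t \<in> S \<Longrightarrow> Y t \<in> borel_measurable N"
    using insert.prems by auto
  have expand: "(\<integral>\<omega>. of_real (w \<omega> * (1 + cos (L \<omega> - \<theta>))) * iexp (a * Z \<omega>) \<partial>K) =
       (\<integral>\<omega>. of_real (w \<omega>) * iexp (a * Z \<omega>) \<partial>K)
       + iexp (- \<theta>) / 2 * (\<integral>\<omega>. of_real (w \<omega>) * iexp (a * Z \<omega> + L \<omega>) \<partial>K)
       + iexp \<theta> / 2 * (\<integral>\<omega>. of_real (w \<omega>) * iexp (a * Z \<omega> + - L \<omega>) \<partial>K)"
    if w: "integrable K w" and [measurable]: "L \<in> borel_measurable K" "Z \<in> borel_measurable K"
    for K :: "'c measure" and w L Z \<theta> a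
  proof -
    note [measurable] = borel_measurable_integrable[OF w]
    have int: "integrable K (\<lambda>\<omega>. of_real (w \<omega>) * iexp (g \<omega>))"
      if [measurable]: "g \<in> borel_measurable K" for g
      by (rule Bochner_Integration.integrable_bound[OF w]) (auto simp: norm_mult)
    have "(\<lambda>\<omega>. of_real (w \<omega> * (1 + cos (L \<omega> - \<theta>))) * iexp (a * Z \<omega>)) =
      (\<lambda>\<omega>. of_real (w \<omega>) * iexp (a * Z \<omega>)
        + iexp (- \<theta>) / 2 * (of_real (w \<omega>) * iexp (a * Z \<omega> + L \<omega>))
        + iexp \<theta> / 2 * (of_real (w \<omega>) * iexp (a * Z \<omega> + - L \<omega>)))" (is "?f = ?g")
    proof
      fix \<omega>
      have add: "iexp (a * Z \<omega> + y) = iexp (a * Z \<omega>) * iexp y" for y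
        by (simp add: exp_add[symmetric] ring_distribs)
      have alg: "(b * (1 + (p * l + q * m) / 2)) * z = b * z + p / 2 * (b * (z * l)) + q / 2 * (b * (z * m))"
        for b p l q m z :: complex
        by (simp add: field_simps)
      show "?f \<omega> = ?g \<omega>"
        unfolding add of_real_mult[of "w \<omega>"] of_real_add[of 1] cos_diff_iexp of_real_1 by (rule alg)
    qed
    then have "integral\<^sup>L K ?f = integral\<^sup>L K ?g" by (rule arg_cong)
    also have "\<dots> = (\<integral>\<omega>. of_real (w \<omega>) * iexp (a * Z \<omega>) \<partial>K)
       + iexp (- \<theta>) / 2 * (\<integral>\<omega>. of_real (w \<omega>) * iexp (a * Z \<omega> + L \<omega>) \<partial>K)
       + iexp \<theta> / 2 * (\<integral>\<omega>. of_real (w \<omega>) * iexp (a * Z \<omega> + - L \<omega>) \<partial>K)"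
      by (subst Bochner_Integration.integral_add Bochner_Integration.integral_mult_right,
          (intro Bochner_Integration.integrable_add integrable_mult_right int; measurable)+)+ simp
    finally show ?thesis .
  qed
  have comb: "(\<integral>\<omega>. of_real (u \<omega>) * iexp (a * X s \<omega> + (\<Sum>t\<in>S. c t * X t \<omega>)) \<partial>M)
            = (\<integral>\<omega>. of_real (v \<omega>) * iexp (a * Y s \<omega> + (\<Sum>t\<in>S. c t * Y t \<omega>)) \<partial>N)" for a c
  proof -
    have "(\<Sum>t\<in>insert s S. (c(s := a)) t * g t) = a * g s + (\<Sum>t\<in>S. c t * g t)" for g :: "'i \<Rightarrow> real"
      using insert.hyps by (simp add: sum.insert) (intro sum.cong, auto)
    then show ?thesis using insert.prems(7)[of "c(s := a)"] by simp
  qed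
  define u' where "u' = (\<lambda>\<omega>. u \<omega> * indicator (B s) (X s \<omega>))"
  define v' where "v' = (\<lambda>\<omega>. v \<omega> * indicator (B s) (Y s \<omega>))"
  have u': "integrable M u'" "\<And>\<omega>. 0 \<le> u' \<omega>"
    unfolding u'_def using insert.prems(1,2)
    by (auto intro!: Bochner_Integration.integrable_bound[OF insert.prems(1)] split: split_indicator)
  have v': "integrable N v'" "\<And>\<omega>. 0 \<le> v' \<omega>"
    unfolding v'_def using insert.prems(3,4)
    by (auto intro!: Bochner_Integration.integrable_bound[OF insert.prems(3)] split: split_indicator)
  have cos_eq: "(\<integral>\<omega>. u' \<omega> * cos ((\<Sum>t\<in>S. c t * X t \<omega>) - \<theta>) \<partial>M)
             = (\<integral>\<omega>. v' \<omega> * cos ((\<Sum>t\<in>S. c t * Y t \<omega>) - \<theta>) \<partial>N)" for c \<theta>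
  proof -
    let ?L = "\<lambda>\<omega>. \<Sum>t\<in>S. c t * X t \<omega>" and ?K = "\<lambda>\<omega>. \<Sum>t\<in>S. c t * Y t \<omega>"
    have iu: "integrable M (\<lambda>\<omega>. w \<omega> * cos (?L \<omega> - \<theta>))" if "integrable M w" for w
      by (rule Bochner_Integration.integrable_bound[OF that])
         (use borel_measurable_integrable[OF that] in \<open>auto simp: abs_mult intro!: mult_left_le\<close>)
    have iv: "integrable N (\<lambda>\<omega>. w \<omega> * cos (?K \<omega> - \<theta>))" if "integrable N w" for w
      by (rule Bochner_Integration.integrable_bound[OF that])
         (use borel_measurable_integrable[OF that] in \<open>auto simp: abs_mult intro!: mult_left_le\<close>)
    \<comment> \<open>The summand 1 makes the weight nonnegative; its own contribution is known from
      the case without cosine and is subtracted below.\<close>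
    have pos: "0 \<le> 1 + cos x" for x :: real
      using cos_ge_minus_one[of x] by linarith
    have m: "?L \<in> borel_measurable M" "?K \<in> borel_measurable N" by measurable
    have "(\<integral>\<omega>. (u \<omega> * (1 + cos (?L \<omega> - \<theta>))) * indicator (B s) (X s \<omega>) \<partial>M)
        = (\<integral>\<omega>. (v \<omega> * (1 + cos (?K \<omega> - \<theta>))) * indicator (B s) (Y s \<omega>) \<partial>N)"
    proof (rule weighted_char_unique)
      fix a
      show "(\<integral>\<omega>. of_real (u \<omega> * (1 + cos (?L \<omega> - \<theta>))) * iexp (a * X s \<omega>) \<partial>M)
          = (\<integral>\<omega>. of_real (v \<omega> * (1 + cos (?K \<omega> - \<theta>))) * iexp (a * Y s \<omega>) \<partial>N)"
        unfolding expand[OF insert.prems(1) m(1) \<open>X s \<in> borel_measurable M\<close>]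
          expand[OF insert.prems(3) m(2) \<open>Y s \<in> borel_measurable N\<close>]
        using comb[of a c] comb[of a "\<lambda>t. - c t"] comb[of a "\<lambda>_. 0"] by (simp add: sum_negf)
    next
      show "0 \<le> u \<omega> * (1 + cos (?L \<omega> - \<theta>))" "0 \<le> v \<omega>' * (1 + cos (?K \<omega>' - \<theta>))" for \<omega> \<omega>'
        using insert.prems(2,4) pos by (auto intro!: mult_nonneg_nonneg)
    qed (use insert.prems(1,3) iu iv in \<open>auto simp: ring_distribs\<close>)
    moreover have "(\<integral>\<omega>. u \<omega> * indicator (B s) (X s \<omega>) \<partial>M) = (\<integral>\<omega>. v \<omega> * indicator (B s) (Y s \<omega>) \<partial>N)"
      using comb[of _ "\<lambda>_. 0"] by (intro weighted_char_unique insert.prems(1-4)) auto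
    moreover have "(\<integral>\<omega>. (u \<omega> * (1 + cos (?L \<omega> - \<theta>))) * indicator (B s) (X s \<omega>) \<partial>M)
       = (\<integral>\<omega>. u' \<omega> \<partial>M) + (\<integral>\<omega>. u' \<omega> * cos (?L \<omega> - \<theta>) \<partial>M)"
      using u' iu[OF u'(1)]
      by (subst Bochner_Integration.integral_add[symmetric]) (auto simp: u'_def ring_distribs mult_ac)
    moreover have "(\<integral>\<omega>. (v \<omega> * (1 + cos (?K \<omega> - \<theta>))) * indicator (B s) (Y s \<omega>) \<partial>N)
       = (\<integral>\<omega>. v' \<omega> \<partial>N) + (\<integral>\<omega>. v' \<omega> * cos (?K \<omega> - \<theta>) \<partial>N)"
      using v' iv[OF v'(1)]
      by (subst Bochner_Integration.integral_add[symmetric]) (auto simp: v'_def ring_distribs mult_ac)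
    ultimately show ?thesis by (simp add: u'_def v'_def)
  qed
  have "(\<integral>\<omega>. u' \<omega> * (\<Prod>t\<in>S. indicator (B t) (X t \<omega>)) \<partial>M)
       = (\<integral>\<omega>. v' \<omega> * (\<Prod>t\<in>S. indicator (B t) (Y t \<omega>)) \<partial>N)"
  proof (rule insert.IH[OF u' v'])
    fix c
    let ?L = "\<lambda>\<omega>. \<Sum>t\<in>S. c t * X t \<omega>" and ?K = "\<lambda>\<omega>. \<Sum>t\<in>S. c t * Y t \<omega>"
    note [measurable] = borel_measurable_integrable[OF u'(1)] borel_measurable_integrable[OF v'(1)]
    have "integrable M (\<lambda>\<omega>. of_real (u' \<omega>) * iexp (?L \<omega>))"
      by (rule Bochner_Integration.integrable_bound[OF u'(1)]) (auto simp: norm_mult)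
    moreover have "integrable N (\<lambda>\<omega>. of_real (v' \<omega>) * iexp (?K \<omega>))"
      by (rule Bochner_Integration.integrable_bound[OF v'(1)]) (auto simp: norm_mult)
    \<comment> \<open>The phases \<open>0\<close> and \<open>pi / 2\<close> deliver the real and the
      imaginary part.\<close>
    ultimately show "(\<integral>\<omega>. of_real (u' \<omega>) * iexp (?L \<omega>) \<partial>M) = (\<integral>\<omega>. of_real (v' \<omega>) * iexp (?K \<omega>) \<partial>N)"
      using cos_eq[of c 0] cos_eq[of c "pi / 2"]
      by (intro complex_eqI) (simp_all add: Re_exp Im_exp cos_diff
          flip: integral_Re integral_Im)
  qed (use insert.prems in auto)
  then show ?case
    using insert.hyps by (simp add: u'_def v'_def mult.assoc)
qed

text \<open>With weight 1 the preceding lemma computes the mass of every box, and the boxes generate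
  the product algebra and are closed under intersection.\<close>

lemma joint_char_unique:
  fixes X :: "'i \<Rightarrow> 'a \<Rightarrow> real" and Y :: "'i \<Rightarrow> 'b \<Rightarrow> real"
  assumes T: "finite T" and M: "prob_space M" and N: "prob_space N"
    and [measurable]: "\<And>t. t \<in> T \<Longrightarrow> X t \<in> borel_measurable M" "\<And>t. t \<in> T \<Longrightarrow> Y t \<in> borel_measurable N"
    and char: "\<And>c. (\<integral>\<omega>. iexp (\<Sum>t\<in>T. c t * X t \<omega>) \<partial>M) = (\<integral>\<omega>. iexp (\<Sum>t\<in>T. c t * Y t \<omega>) \<partial>N)"
  shows "distr M (PiM T (\<lambda>_. borel)) (\<lambda>\<omega>. \<lambda>t\<in>T. X t \<omega>) = distr N (PiM T (\<lambda>_. borel)) (\<lambda>\<omega>. \<lambda>t\<in>T. Y t \<omega>)"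
proof -
  interpret M: prob_space M by fact
  interpret N: prob_space N by fact
  have box: "emeasure (distr K (PiM T (\<lambda>_. borel)) (\<lambda>\<omega>. \<lambda>t\<in>T. Z t \<omega>)) (Pi\<^sub>E T A)
      = ennreal (\<integral>\<omega>. 1 * (\<Prod>t\<in>T. indicator (A t) (Z t \<omega>)) \<partial>K)"
    if K: "prob_space K" and [measurable]: "\<And>t. t \<in> T \<Longrightarrow> Z t \<in> borel_measurable K"
      "\<And>t. t \<in> T \<Longrightarrow> A t \<in> sets borel"
    for K :: "'c measure" and Z :: "'i \<Rightarrow> 'c \<Rightarrow> real" and A
  proof -
    interpret K: prob_space K by fact
    have S: "{\<omega> \<in> space K. \<forall>t\<in>T. Z t \<omega> \<in> A t} \<in> sets K"
      using T by measurable
    have "emeasure (distr K (PiM T (\<lambda>_. borel)) (\<lambda>\<omega>. \<lambda>t\<in>T. Z t \<omega>)) (Pi\<^sub>E T A)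
        = emeasure K ((\<lambda>\<omega>. \<lambda>t\<in>T. Z t \<omega>) -` Pi\<^sub>E T A \<inter> space K)"
      by (rule emeasure_distr) (auto intro!: sets_PiM_I_finite T)
    also have "(\<lambda>\<omega>. \<lambda>t\<in>T. Z t \<omega>) -` Pi\<^sub>E T A \<inter> space K = {\<omega> \<in> space K. \<forall>t\<in>T. Z t \<omega> \<in> A t}"
      by (auto simp: PiE_iff)
    also have "emeasure K \<dots> = ennreal (\<integral>\<omega>. indicator {\<omega> \<in> space K. \<forall>t\<in>T. Z t \<omega> \<in> A t} \<omega> \<partial>K)"
      using S by (simp add: K.emeasure_eq_measure)
    also have "(\<integral>\<omega>. (indicator {\<omega> \<in> space K. \<forall>t\<in>T. Z t \<omega> \<in> A t} \<omega> :: real) \<partial>K)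
        = (\<integral>\<omega>. 1 * (\<Prod>t\<in>T. indicator (A t) (Z t \<omega>)) \<partial>K)"
    proof (rule Bochner_Integration.integral_cong[OF refl])
      fix \<omega> assume "\<omega> \<in> space K"
      then show "indicator {\<omega> \<in> space K. \<forall>t\<in>T. Z t \<omega> \<in> A t} \<omega> = 1 * (\<Prod>t\<in>T. indicator (A t) (Z t \<omega>) :: real)"
        by (cases "\<forall>t\<in>T. Z t \<omega> \<in> A t") (auto intro!: prod_zero[OF T] bexI simp: indicator_eq_0_iff)
    qed
    finally show ?thesis .
  qed
  show ?thesis
  proof (rule measure_eqI_PiM_finite[OF T])
    fix A :: "'i \<Rightarrow> real set" assume A: "\<And>t. t \<in> T \<Longrightarrow> A t \<in> sets borel"
    show "emeasure (distr M (PiM T (\<lambda>_. borel)) (\<lambda>\<omega>. \<lambda>t\<in>T. X t \<omega>)) (Pi\<^sub>E T A)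
        = emeasure (distr N (PiM T (\<lambda>_. borel)) (\<lambda>\<omega>. \<lambda>t\<in>T. Y t \<omega>)) (Pi\<^sub>E T A)"
      using weighted_joint_char_unique[OF T, of M "\<lambda>_. 1" N "\<lambda>_. 1" X Y A] char A
        box[of M X A] box[of N Y A] assms by simp
  next
    show "range (\<lambda>_::nat. Pi\<^sub>E T (\<lambda>_. UNIV :: real set)) \<subseteq> prod_algebra T (\<lambda>_. borel)"
      using T by (auto intro!: prod_algebraI_finite)
    have "prob_space (distr M (PiM T (\<lambda>_. borel)) (\<lambda>\<omega>. \<lambda>t\<in>T. X t \<omega>))"
      by (rule M.prob_space_distr) measurable
    then show "emeasure (distr M (PiM T (\<lambda>_. borel)) (\<lambda>\<omega>. \<lambda>t\<in>T. X t \<omega>)) (Pi\<^sub>E T (\<lambda>_. UNIV)) \<noteq> \<infinity>" for i :: nat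
      by (simp add: finite_measure.emeasure_finite prob_space.finite_measure)
  qed (auto simp: space_PiM)
qed

section \<open>Gaussian families and the Sudakov--Fernique comparison\<close>

text \<open>\<open>q\<close> is the quadratic form of the covariance. Keeping it as a parameter
  turns equality in law of families on different spaces into an algebraic identity between
  forms.\<close>

definition gaussian_family :: "'a measure \<Rightarrow> 'i set \<Rightarrow> ('i \<Rightarrow> 'a \<Rightarrow> real) \<Rightarrow> (('i \<Rightarrow> real) \<Rightarrow> real) \<Rightarrow> bool" where
  "gaussian_family P T X q \<longleftrightarrow> finite T \<and> (\<forall>c. centered_normal P (\<lambda>\<omega>. \<Sum>t\<in>T. c t * X t \<omega>) (q c))"

lemma gaussian_familyD:
  "gaussian_family P T X q \<Longrightarrow> centered_normal P (\<lambda>\<omega>. \<Sum>t\<in>T. c t * X t \<omega>) (q c)"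
  by (simp add: gaussian_family_def)

lemma gaussian_family_prob_space: "gaussian_family P T X q \<Longrightarrow> prob_space P"
  using centered_normalD(1)[OF gaussian_familyD] .

lemma gaussian_family_component:
  assumes "gaussian_family P T X q" "t \<in> T"
  shows "centered_normal P (X t) (q (\<lambda>s. if s = t then 1 else 0))"
proof -
  have T: "finite T" using assms by (simp add: gaussian_family_def)
  have "(\<lambda>\<omega>. \<Sum>s\<in>T. (if s = t then 1 else 0) * X s \<omega>) = X t"
    using T assms(2) by (simp add: if_distrib[of "\<lambda>c. c * _"] cong: if_cong)
  moreover have "centered_normal P (\<lambda>\<omega>. \<Sum>s\<in>T. (if s = t then 1 else 0) * X s \<omega>) (q (\<lambda>s. if s = t then 1 else 0))"
    by (rule gaussian_familyD[OF assms(1)])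
  ultimately show ?thesis by (simp only:)
qed

lemma gaussian_family_difference:
  assumes "gaussian_family P T X q" "s \<in> T" "t \<in> T"
  shows "centered_normal P (\<lambda>\<omega>. X s \<omega> - X t \<omega>) (q (\<lambda>r. (if r = s then 1 else 0) - (if r = t then 1 else 0)))"
proof -
  have T: "finite T" using assms by (simp add: gaussian_family_def)
  have "(\<lambda>\<omega>. \<Sum>r\<in>T. ((if r = s then 1 else 0) - (if r = t then 1 else 0)) * X r \<omega>) = (\<lambda>\<omega>. X s \<omega> - X t \<omega>)"
    using T assms(2,3) by (simp add: left_diff_distrib sum_subtractf if_distrib[of "\<lambda>c. c * _"] cong: if_cong)
  moreover have "centered_normal P
      (\<lambda>\<omega>. \<Sum>r\<in>T. ((if r = s then 1 else 0) - (if r = t then 1 else 0)) * X r \<omega>)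
      (q (\<lambda>r. (if r = s then 1 else 0) - (if r = t then 1 else 0)))"
    by (rule gaussian_familyD[OF assms(1)])
  ultimately show ?thesis by (simp only:)
qed

lemma gaussian_family_measurable:
  "gaussian_family P T X q \<Longrightarrow> t \<in> T \<Longrightarrow> X t \<in> borel_measurable P"
  using centered_normalD(2)[OF gaussian_family_component] .

lemma gaussian_family_integrable:
  "gaussian_family P T X q \<Longrightarrow> t \<in> T \<Longrightarrow> integrable P (X t)"
  using centered_normal_integrable[OF gaussian_family_component] .

lemma gaussian_family_cmult:
  assumes "gaussian_family P T X q"
  shows "gaussian_family P T (\<lambda>t \<omega>. a * X t \<omega>) (\<lambda>c. a\<^sup>2 * q c)"
  unfolding gaussian_family_def
proof (intro conjI allI)
  show "finite T" using assms by (simp add: gaussian_family_def)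
  fix c
  have "centered_normal P (\<lambda>\<omega>. a * (\<Sum>t\<in>T. c t * X t \<omega>)) (a\<^sup>2 * q c)"
    using assms by (intro centered_normal_cmult) (simp add: gaussian_family_def)
  then show "centered_normal P (\<lambda>\<omega>. \<Sum>t\<in>T. c t * (a * X t \<omega>)) (a\<^sup>2 * q c)"
    by (simp add: sum_distrib_left mult.left_commute)
qed

lemma gaussian_family_pair_add:
  assumes "gaussian_family P T X q" "gaussian_family Q T Y r"
  shows "gaussian_family (P \<Otimes>\<^sub>M Q) T (\<lambda>t p. X t (fst p) + Y t (snd p)) (\<lambda>c. q c + r c)"
  unfolding gaussian_family_def
proof (intro conjI allI)
  show "finite T" using assms by (simp add: gaussian_family_def)
  fix c
  have "centered_normal (P \<Otimes>\<^sub>M Q)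
      (\<lambda>p. (\<Sum>t\<in>T. c t * X t (fst p)) + (\<Sum>t\<in>T. c t * Y t (snd p))) (q c + r c)"
    using assms by (intro centered_normal_pair_add) (simp_all add: gaussian_family_def)
  then show "centered_normal (P \<Otimes>\<^sub>M Q) (\<lambda>p. \<Sum>t\<in>T. c t * (X t (fst p) + Y t (snd p))) (q c + r c)"
    by (simp add: ring_distribs sum.distrib)
qed

section \<open>Log-sum-exp as a smooth maximum\<close>

definition log_sum_exp :: "'i set \<Rightarrow> ('i \<Rightarrow> real) \<Rightarrow> real" where
  "log_sum_exp T x = ln (\<Sum>t\<in>T. exp (x t))"

text \<open>The gap \<open>ln (card T)\<close> does not depend on \<open>x\<close>, so it becomes
  negligible relative to the maximum when \<open>x\<close> is multiplied by a large factor.\<close>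

lemma log_sum_exp_bounds:
  assumes T: "finite T" "T \<noteq> {}"
  shows "Max (x ` T) \<le> log_sum_exp T x" "log_sum_exp T x \<le> Max (x ` T) + ln (card T)"
proof -
  have "Max (x ` T) \<in> x ` T" using T by (intro Max_in) auto
  then obtain t where t: "t \<in> T" "Max (x ` T) = x t" by auto
  have "exp (x t) \<le> (\<Sum>t\<in>T. exp (x t))"
    by (rule member_le_sum[OF t(1)]) (use T in auto)
  then have "ln (exp (x t)) \<le> log_sum_exp T x"
    unfolding log_sum_exp_def by (subst ln_le_cancel_iff) (auto intro: less_le_trans[OF exp_gt_zero])
  then show "Max (x ` T) \<le> log_sum_exp T x" using t by simp
  have "(\<Sum>t\<in>T. exp (x t)) \<le> (\<Sum>t\<in>T. exp (Max (x ` T)))"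
    using T by (intro sum_mono) auto
  then have le: "(\<Sum>t\<in>T. exp (x t)) \<le> card T * exp (Max (x ` T))" by simp
  have pos: "0 < (\<Sum>t\<in>T. exp (x t))" using T by (intro sum_pos) auto
  have "card T > 0" using T by (simp add: card_gt_0_iff)
  then have "log_sum_exp T x \<le> ln (card T * exp (Max (x ` T)))"
    unfolding log_sum_exp_def using le pos by (subst ln_le_cancel_iff) auto
  also have "\<dots> = ln (card T) + Max (x ` T)"
    using \<open>card T > 0\<close> by (subst ln_mult) auto
  finally show "log_sum_exp T x \<le> Max (x ` T) + ln (card T)" by simp
qed

lemma abs_Max_le_sum:
  assumes T: "finite T" "T \<noteq> {}"
  shows "\<bar>Max (x ` T)\<bar> \<le> (\<Sum>t\<in>T. \<bar>x t :: real\<bar>)"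
proof -
  have "Max (x ` T) \<in> x ` T" using T by (intro Max_in) auto
  then obtain t where t: "t \<in> T" "Max (x ` T) = x t" by auto
  show ?thesis unfolding t(2) by (rule member_le_sum[OF t(1), of "\<lambda>t. \<bar>x t\<bar>"]) (use T in auto)
qed

lemma borel_measurable_log_sum_exp[measurable]:
  assumes "\<And>t. t \<in> T \<Longrightarrow> X t \<in> borel_measurable M"
  shows "(\<lambda>\<omega>. log_sum_exp T (\<lambda>t. X t \<omega>)) \<in> borel_measurable M"
  unfolding log_sum_exp_def using assms by measurable

lemma integrable_log_sum_exp:
  assumes T: "finite T" "T \<noteq> {}" and X: "\<And>t. t \<in> T \<Longrightarrow> integrable M (X t)" and M: "prob_space M"
  shows "integrable M (\<lambda>\<omega>. log_sum_exp T (\<lambda>t. X t \<omega>))"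
proof -
  interpret prob_space M by fact
  have "card T > 0" using T by (simp add: card_gt_0_iff)
  have b: "\<bar>log_sum_exp T x\<bar> \<le> ln (card T) + (\<Sum>t\<in>T. \<bar>x t\<bar>)" for x
    using log_sum_exp_bounds[OF T, of x] abs_Max_le_sum[OF T, of x] \<open>card T > 0\<close>
      ln_ge_zero[of "real (card T)"] by linarith
  show ?thesis
  proof (rule Bochner_Integration.integrable_bound)
    show "integrable M (\<lambda>\<omega>. ln (card T) + (\<Sum>t\<in>T. \<bar>X t \<omega>\<bar>))"
      using X by (intro Bochner_Integration.integrable_add Bochner_Integration.integrable_sum) auto
    show "AE \<omega> in M. norm (log_sum_exp T (\<lambda>t. X t \<omega>)) \<le> norm (ln (card T) + (\<Sum>t\<in>T. \<bar>X t \<omega>\<bar>))"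
      using b order_trans[OF b abs_ge_self] by (intro AE_I2) (simp only: real_norm_def)
  qed (use X in measurable)
qed

text \<open>The quadratic form of the second derivative of \<open>log_sum_exp\<close> depends on the increments
  \<open>x i - x j\<close> only, with nonnegative weights: this is what makes the comparison of increments
  sufficient.\<close>

lemma log_sum_exp_taylor:
  fixes v x :: "'i \<Rightarrow> real"
  assumes T: "finite T" "T \<noteq> {}"
  defines "p \<equiv> (\<lambda>t. exp (v t) / (\<Sum>t\<in>T. exp (v t)))"
  shows "\<bar>log_sum_exp T (\<lambda>t. v t + x t) - log_sum_exp T v - (\<Sum>t\<in>T. p t * x t)
    - (\<Sum>i\<in>T. \<Sum>j\<in>T. p i * p j * (x i - x j)\<^sup>2) / 4\<bar> \<le> (\<Sum>t\<in>T. \<bar>x t\<bar> ^ 3)"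
proof -
  \<comment> \<open>Along the segment \<open>v + s * x\<close>, \<open>S k\<close> is the
    unnormalized and \<open>r k\<close> the normalized \<open>k\<close>-th moment of
    \<open>x\<close> under the weights \<open>exp (v t + s * x t)\<close>. The functions
    \<open>D 1\<close>, \<open>D 2\<close>, \<open>D 3\<close> are the first three cumulants, hence
    the derivatives of \<open>D 0\<close>.\<close>
  define S where "S k s = (\<Sum>t\<in>T. x t ^ k * exp (v t + s * x t))" for k s
  define r where "r k s = S k s / S 0 s" for k s
  define D where "D k = (\<lambda>s. if k = 0 then ln (S 0 s) else if k = 1 then r 1 s
    else if k = 2 then r 2 s - (r 1 s)\<^sup>2
    else r 3 s - 3 * (r 1 s * r 2 s) + 2 * r 1 s ^ 3)" for k :: nat
  have S0: "S 0 s > 0" for s unfolding S_def using T by (intro sum_pos) auto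
  have dS: "(S k has_real_derivative S (Suc k) s) (at s)" for k s
    unfolding S_def
  proof (rule DERIV_sum)
    fix t
    show "((\<lambda>s. x t ^ k * exp (v t + s * x t)) has_real_derivative x t ^ Suc k * exp (v t + s * x t)) (at s)"
      by (auto intro!: derivative_eq_intros)
  qed
  have dr: "(r k has_real_derivative (r (Suc k) s - r k s * r 1 s)) (at s)" for k s
  proof -
    have "(r k has_real_derivative (S (Suc k) s * S 0 s - S k s * S 1 s) / (S 0 s * S 0 s)) (at s)"
      unfolding r_def using DERIV_divide[OF dS[of k s] dS[of 0 s]] S0[of s] by simp
    moreover have "(S (Suc k) s * S 0 s - S k s * S 1 s) / (S 0 s * S 0 s) = r (Suc k) s - r k s * r 1 s"
      using S0[of s] by (simp add: r_def diff_divide_distrib)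
    ultimately show ?thesis by simp
  qed
  have dr': "(r 1 has_real_derivative (r 2 s - r 1 s * r 1 s)) (at s)"
     "(r 2 has_real_derivative (r 3 s - r 2 s * r 1 s)) (at s)" for s
    using dr[of 1 s] dr[of 2 s] by (simp_all add: numeral_2_eq_2 numeral_3_eq_3)
  have dD: "(D m has_real_derivative D (Suc m) s) (at s)" if m: "m < 3" for m s
  proof -
    consider "m = 0" | "m = 1" | "m = 2" using m by linarith
    then show ?thesis
    proof cases
      case 1
      then show ?thesis using DERIV_ln_divide[OF S0[of s]] DERIV_chain2[of ln "1 / S 0 s" "S 0" s "S 1 s" UNIV] dS[of 0 s]
        unfolding D_def by (simp add: r_def)
    next
      case 2
      have "D 1 = r 1" "D 2 s = r 2 s - r 1 s * r 1 s" by (auto simp: D_def power2_eq_square)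
      then show ?thesis using 2 dr'(1)[of s] by (simp add: numeral_2_eq_2)
    next
      case 3
      have "((\<lambda>s. r 2 s - r 1 s * r 1 s) has_real_derivative
          (r 3 s - r 2 s * r 1 s) - ((r 2 s - r 1 s * r 1 s) * r 1 s + (r 2 s - r 1 s * r 1 s) * r 1 s)) (at s)"
        by (intro DERIV_diff DERIV_mult dr')
      moreover have "(r 3 s - r 2 s * r 1 s) - ((r 2 s - r 1 s * r 1 s) * r 1 s + (r 2 s - r 1 s * r 1 s) * r 1 s) = D 3 s"
        by (simp add: D_def algebra_simps power3_eq_cube)
      moreover have "D 2 = (\<lambda>s. r 2 s - r 1 s * r 1 s)" by (simp add: D_def power2_eq_square)
      ultimately show ?thesis using 3 by (simp add: numeral_3_eq_3 numeral_2_eq_2)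
    qed
  qed
  obtain s where s: "ln (S 0 1) = (\<Sum>m<3. D m 0 / fact m * 1 ^ m) + D 3 s / fact 3 * 1 ^ 3"
    using Maclaurin[of 1 3 D "\<lambda>s. ln (S 0 s)"] dD by (auto simp: D_def[of 0])
  have "Max ((\<lambda>t. \<bar>x t\<bar>) ` T) \<in> (\<lambda>t. \<bar>x t\<bar>) ` T" using T by (intro Max_in) auto
  then obtain t0 where t0: "t0 \<in> T" "Max ((\<lambda>t. \<bar>x t\<bar>) ` T) = \<bar>x t0\<bar>" by blast
  define m where "m = \<bar>x t0\<bar>"
  have m: "\<bar>x t\<bar> \<le> m" if "t \<in> T" for t
    unfolding m_def t0(2)[symmetric] using that T by simp
  have "0 \<le> m" by (simp add: m_def)
  have ratio: "\<bar>r k s\<bar> \<le> m ^ k" for k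
  proof -
    have "\<bar>S k s\<bar> \<le> (\<Sum>t\<in>T. \<bar>x t ^ k * exp (v t + s * x t)\<bar>)"
      unfolding S_def by (rule sum_abs)
    also have "\<dots> \<le> (\<Sum>t\<in>T. m ^ k * exp (v t + s * x t))"
      using m by (intro sum_mono) (auto simp: abs_mult power_abs intro!: power_mono)
    also have "\<dots> = m ^ k * S 0 s" by (simp add: S_def sum_distrib_left)
    finally show ?thesis using S0[of s] by (simp add: r_def pos_divide_le_eq)
  qed
  \<comment> \<open>The three terms of the third cumulant contribute 1, 3 and 2 times
    \<open>m ^ 3\<close>; the sum 6 cancels the \<open>fact 3\<close> of the Maclaurin
    remainder.\<close>
  have "\<bar>D 3 s\<bar> \<le> 6 * m ^ 3"
  proof -
    have "\<bar>r 1 s * r 2 s\<bar> \<le> m * m ^ 2"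
      unfolding abs_mult using ratio[of 1] ratio[of 2] \<open>0 \<le> m\<close> by (intro mult_mono) auto
    then have r12: "\<bar>r 1 s * r 2 s\<bar> \<le> m ^ 3" by (simp add: power3_eq_cube power2_eq_square)
    have r1: "\<bar>r 1 s ^ 3\<bar> \<le> m ^ 3"
      unfolding power_abs using ratio[of 1] by (intro power_mono) auto
    have "D 3 s = r 3 s - 3 * (r 1 s * r 2 s) + 2 * r 1 s ^ 3"
      by (simp add: D_def)
    then show ?thesis
      using ratio[of 3] r12 r1 by linarith
  qed
  also have "m ^ 3 \<le> (\<Sum>t\<in>T. \<bar>x t\<bar> ^ 3)"
    unfolding m_def by (rule member_le_sum[OF t0(1), of "\<lambda>t. \<bar>x t\<bar> ^ 3"]) (use T in auto)
  finally have D3: "\<bar>D 3 s\<bar> / 6 \<le> (\<Sum>t\<in>T. \<bar>x t\<bar> ^ 3)" by simp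
  have p1: "(\<Sum>t\<in>T. p t) = 1"
    unfolding p_def sum_divide_distrib[symmetric] using S0[of 0] by (simp add: S_def)
  have D1: "D 1 0 = (\<Sum>t\<in>T. p t * x t)"
    by (simp add: D_def r_def S_def p_def sum_divide_distrib mult.commute)
  have S2: "r 2 0 = (\<Sum>t\<in>T. p t * (x t)\<^sup>2)"
    by (simp add: r_def S_def p_def sum_divide_distrib mult.commute)
  have S1: "r 1 0 = (\<Sum>t\<in>T. p t * x t)"
    by (simp add: r_def S_def p_def sum_divide_distrib mult.commute)
  \<comment> \<open>A variance is half the mean squared difference of two independent copies;
    together with the 1/2 of the expansion this gives the factor 1/4.\<close>
  have "(\<Sum>i\<in>T. \<Sum>j\<in>T. p i * p j * (x i - x j)\<^sup>2)
      = (\<Sum>i\<in>T. \<Sum>j\<in>T. (p i * (x i)\<^sup>2) * p j + p i * (p j * (x j)\<^sup>2) - 2 * ((p i * x i) * (p j * x j)))"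
    by (intro sum.cong) (auto simp: power2_eq_square algebra_simps)
  also have "\<dots> = (\<Sum>t\<in>T. p t * (x t)\<^sup>2) * (\<Sum>t\<in>T. p t) + (\<Sum>t\<in>T. p t) * (\<Sum>t\<in>T. p t * (x t)\<^sup>2)
      - 2 * ((\<Sum>t\<in>T. p t * x t) * (\<Sum>t\<in>T. p t * x t))"
    by (simp only: sum_subtractf sum.distrib sum_product sum_distrib_left[symmetric])
  also have "\<dots> = 2 * D 2 0"
    using S1 S2 by (simp add: p1 D_def power2_eq_square)
  finally have D2: "D 2 0 / 2 = (\<Sum>i\<in>T. \<Sum>j\<in>T. p i * p j * (x i - x j)\<^sup>2) / 4" by simp
  have "log_sum_exp T (\<lambda>t. v t + x t) = ln (S 0 1)" "log_sum_exp T v = D 0 0"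
    by (simp_all add: log_sum_exp_def S_def D_def)
  moreover have "ln (S 0 1) = D 0 0 + D 1 0 + D 2 0 / 2 + D 3 s / 6"
  proof -
    have "{..<3::nat} = {0, 1, 2}" by auto
    then show ?thesis using s by (simp add: fact_numeral)
  qed
  ultimately have "log_sum_exp T (\<lambda>t. v t + x t) - log_sum_exp T v - (\<Sum>t\<in>T. p t * x t)
    - (\<Sum>i\<in>T. \<Sum>j\<in>T. p i * p j * (x i - x j)\<^sup>2) / 4 = D 3 s / 6"
    using D1 D2 by simp
  then show ?thesis using D3 by simp
qed

text \<open>This is what permits a Gaussian family to be replaced by a sum of independent pieces
  with the same total quadratic form.\<close>

lemma gaussian_family_log_sum_exp_eq:
  assumes X: "gaussian_family P T X q" and Y: "gaussian_family Q T Y q"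
  shows "(\<integral>\<omega>. log_sum_exp T (\<lambda>t. X t \<omega>) \<partial>P) = (\<integral>\<omega>. log_sum_exp T (\<lambda>t. Y t \<omega>) \<partial>Q)"
proof -
  have T: "finite T" using X by (simp add: gaussian_family_def)
  note mX[measurable] = gaussian_family_measurable[OF X] and mY[measurable] = gaussian_family_measurable[OF Y]
  have "distr P (PiM T (\<lambda>_. borel)) (\<lambda>\<omega>. \<lambda>t\<in>T. X t \<omega>) = distr Q (PiM T (\<lambda>_. borel)) (\<lambda>\<omega>. \<lambda>t\<in>T. Y t \<omega>)"
  proof (rule joint_char_unique[OF T])
    fix c
    have "centered_normal P (\<lambda>\<omega>. \<Sum>t\<in>T. c t * X t \<omega>) (q c)" "centered_normal Q (\<lambda>\<omega>. \<Sum>t\<in>T. c t * Y t \<omega>) (q c)"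
      using X Y by (auto simp: gaussian_family_def)
    from this[THEN centered_normal_char, of 1]
    show "(\<integral>\<omega>. iexp (\<Sum>t\<in>T. c t * X t \<omega>) \<partial>P) = (\<integral>\<omega>. iexp (\<Sum>t\<in>T. c t * Y t \<omega>) \<partial>Q)"
      by simp
  qed (use X Y gaussian_family_prob_space mX mY in auto)
  then have "(\<integral>x. log_sum_exp T (\<lambda>t. x t) \<partial>distr P (PiM T (\<lambda>_. borel)) (\<lambda>\<omega>. \<lambda>t\<in>T. X t \<omega>))
      = (\<integral>x. log_sum_exp T (\<lambda>t. x t) \<partial>distr Q (PiM T (\<lambda>_. borel)) (\<lambda>\<omega>. \<lambda>t\<in>T. Y t \<omega>))"
    by (rule arg_cong)
  moreover have "(\<lambda>x. log_sum_exp T (\<lambda>t. x t)) \<in> borel_measurable (PiM T (\<lambda>_. borel :: real measure))"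
    by (rule borel_measurable_log_sum_exp) simp
  ultimately show ?thesis
    by (subst (asm) (1 2) integral_distr) (auto simp: log_sum_exp_def)
qed

text \<open>The linear term of the expansion has mean 0, so to second order only the variances of
  the increments are felt. The error is of third order in \<open>s\<close>.\<close>

lemma log_sum_exp_perturbation:
  fixes v :: "'i \<Rightarrow> real"
  assumes X: "gaussian_family P T X q" and T: "T \<noteq> {}" and s: "0 \<le> s"
  defines "p \<equiv> (\<lambda>t. exp (v t) / (\<Sum>t\<in>T. exp (v t)))"
  shows "\<bar>(\<integral>\<omega>. log_sum_exp T (\<lambda>t. v t + s * X t \<omega>) \<partial>P) - log_sum_exp T v
     - s\<^sup>2 / 4 * (\<Sum>i\<in>T. \<Sum>j\<in>T. p i * p j * (\<integral>\<omega>. (X i \<omega> - X j \<omega>)\<^sup>2 \<partial>P))\<bar>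
     \<le> s ^ 3 * (\<Sum>t\<in>T. \<integral>\<omega>. \<bar>X t \<omega>\<bar> ^ 3 \<partial>P)"
proof -
  have fT: "finite T" using X by (simp add: gaussian_family_def)
  interpret prob_space P using X by (rule gaussian_family_prob_space)
  have cX: "centered_normal P (X t) (q (\<lambda>s. if s = t then 1 else 0))" if "t \<in> T" for t
    using gaussian_family_component[OF X that] .
  have [simp, intro]: "integrable P (X t)" "integrable P (\<lambda>\<omega>. \<bar>X t \<omega>\<bar> ^ 3)" "(\<integral>\<omega>. X t \<omega> \<partial>P) = 0" if "t \<in> T" for t
    using cX[OF that] by (auto intro: centered_normal_integrable centered_normal_integrable_abs_power centered_normal_mean)
  have [simp, intro]: "integrable P (\<lambda>\<omega>. (X i \<omega> - X j \<omega>)\<^sup>2)" if "i \<in> T" "j \<in> T" for i j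
    by (rule centered_normal_integrable_square[OF gaussian_family_difference[OF X that]])
  define L where "L = (\<lambda>\<omega>. log_sum_exp T (\<lambda>t. v t + s * X t \<omega>) - log_sum_exp T v - (\<Sum>t\<in>T. p t * (s * X t \<omega>))
     - (\<Sum>i\<in>T. \<Sum>j\<in>T. p i * p j * (s * X i \<omega> - s * X j \<omega>)\<^sup>2) / 4)"
  have L': "L = (\<lambda>\<omega>. log_sum_exp T (\<lambda>t. v t + s * X t \<omega>) - log_sum_exp T v - (\<Sum>t\<in>T. p t * (s * X t \<omega>))
     - (\<Sum>i\<in>T. \<Sum>j\<in>T. p i * p j * (s\<^sup>2 * (X i \<omega> - X j \<omega>)\<^sup>2)) / 4)"
    unfolding L_def by (simp add: power_mult_distrib flip: right_diff_distrib)
  have bound: "\<bar>L \<omega>\<bar> \<le> s ^ 3 * (\<Sum>t\<in>T. \<bar>X t \<omega>\<bar> ^ 3)" for \<omega>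
    using log_sum_exp_taylor[OF fT T, of v "\<lambda>t. s * X t \<omega>"] s
    by (simp add: L_def p_def abs_mult power_mult_distrib sum_distrib_left)
  have int: "integrable P (\<lambda>\<omega>. log_sum_exp T (\<lambda>t. v t + s * X t \<omega>))"
    by (intro integrable_log_sum_exp fT T prob_space_axioms) auto
  have intL: "integrable P L"
    unfolding L' by (intro Bochner_Integration.integrable_diff int integrable_divide
        Bochner_Integration.integrable_sum integrable_mult_right) auto
  have "(\<integral>\<omega>. L \<omega> \<partial>P) = (\<integral>\<omega>. log_sum_exp T (\<lambda>t. v t + s * X t \<omega>) \<partial>P) - log_sum_exp T v
     - s\<^sup>2 / 4 * (\<Sum>i\<in>T. \<Sum>j\<in>T. p i * p j * (\<integral>\<omega>. (X i \<omega> - X j \<omega>)\<^sup>2 \<partial>P))"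
  proof -
    have "(\<integral>\<omega>. (\<Sum>t\<in>T. p t * (s * X t \<omega>)) \<partial>P) = 0"
      by (subst Bochner_Integration.integral_sum) auto
    moreover have "(\<integral>\<omega>. (\<Sum>i\<in>T. \<Sum>j\<in>T. p i * p j * (s\<^sup>2 * (X i \<omega> - X j \<omega>)\<^sup>2)) / 4 \<partial>P)
        = s\<^sup>2 / 4 * (\<Sum>i\<in>T. \<Sum>j\<in>T. p i * p j * (\<integral>\<omega>. (X i \<omega> - X j \<omega>)\<^sup>2 \<partial>P))"
      by (simp add: Bochner_Integration.integral_sum sum_distrib_left mult_ac)
    moreover have "(\<integral>\<omega>. L \<omega> \<partial>P) = (\<integral>\<omega>. log_sum_exp T (\<lambda>t. v t + s * X t \<omega>) \<partial>P) - (\<integral>\<omega>. log_sum_exp T v \<partial>P)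
       - (\<integral>\<omega>. (\<Sum>t\<in>T. p t * (s * X t \<omega>)) \<partial>P)
       - (\<integral>\<omega>. (\<Sum>i\<in>T. \<Sum>j\<in>T. p i * p j * (s\<^sup>2 * (X i \<omega> - X j \<omega>)\<^sup>2)) / 4 \<partial>P)"
      unfolding L' using int
      by (subst Bochner_Integration.integral_diff, (intro Bochner_Integration.integrable_diff integrable_divide
        Bochner_Integration.integrable_sum integrable_mult_right; auto)+)+ auto
    ultimately show ?thesis using prob_space by simp
  qed
  moreover have "\<bar>\<integral>\<omega>. L \<omega> \<partial>P\<bar> \<le> (\<integral>\<omega>. \<bar>L \<omega>\<bar> \<partial>P)"
    by (rule integral_abs_bound)
  moreover have "(\<integral>\<omega>. \<bar>L \<omega>\<bar> \<partial>P) \<le> (\<integral>\<omega>. s ^ 3 * (\<Sum>t\<in>T. \<bar>X t \<omega>\<bar> ^ 3) \<partial>P)"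
    using bound intL by (intro integral_mono) auto
  moreover have "(\<integral>\<omega>. s ^ 3 * (\<Sum>t\<in>T. \<bar>X t \<omega>\<bar> ^ 3) \<partial>P) = s ^ 3 * (\<Sum>t\<in>T. \<integral>\<omega>. \<bar>X t \<omega>\<bar> ^ 3 \<partial>P)"
    by (simp add: Bochner_Integration.integral_sum)
  ultimately show ?thesis by linarith
qed

text \<open>Both families perturb the same deterministic point \<open>v\<close>, hence their
  second-order terms carry the same nonnegative weights and can be compared termwise.\<close>

lemma log_sum_exp_perturbation_mono:
  fixes v :: "'i \<Rightarrow> real"
  assumes X: "gaussian_family P T X q" and Z: "gaussian_family Q T Z r" and T: "T \<noteq> {}" and s: "0 \<le> s"
    and incr: "\<And>i j. i \<in> T \<Longrightarrow> j \<in> T \<Longrightarrow>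
      (\<integral>\<omega>. (Z i \<omega> - Z j \<omega>)\<^sup>2 \<partial>Q) \<le> (\<integral>\<omega>. (X i \<omega> - X j \<omega>)\<^sup>2 \<partial>P)"
  shows "(\<integral>\<omega>. log_sum_exp T (\<lambda>t. v t + s * Z t \<omega>) \<partial>Q) \<le> (\<integral>\<omega>. log_sum_exp T (\<lambda>t. v t + s * X t \<omega>) \<partial>P)
    + s ^ 3 * ((\<Sum>t\<in>T. \<integral>\<omega>. \<bar>X t \<omega>\<bar> ^ 3 \<partial>P) + (\<Sum>t\<in>T. \<integral>\<omega>. \<bar>Z t \<omega>\<bar> ^ 3 \<partial>Q))"
proof -
  define p where "p t = exp (v t) / (\<Sum>t\<in>T. exp (v t))" for t
  have p: "0 \<le> p t" for t by (simp add: p_def sum_nonneg)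
  have "(\<Sum>i\<in>T. \<Sum>j\<in>T. p i * p j * (\<integral>\<omega>. (Z i \<omega> - Z j \<omega>)\<^sup>2 \<partial>Q))
      \<le> (\<Sum>i\<in>T. \<Sum>j\<in>T. p i * p j * (\<integral>\<omega>. (X i \<omega> - X j \<omega>)\<^sup>2 \<partial>P))"
    using p incr by (intro sum_mono mult_left_mono) auto
  then have "s\<^sup>2 / 4 * (\<Sum>i\<in>T. \<Sum>j\<in>T. p i * p j * (\<integral>\<omega>. (Z i \<omega> - Z j \<omega>)\<^sup>2 \<partial>Q))
      \<le> s\<^sup>2 / 4 * (\<Sum>i\<in>T. \<Sum>j\<in>T. p i * p j * (\<integral>\<omega>. (X i \<omega> - X j \<omega>)\<^sup>2 \<partial>P))"
    by (intro mult_left_mono) auto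
  with log_sum_exp_perturbation[OF X T s, of v] log_sum_exp_perturbation[OF Z T s, of v]
  show ?thesis unfolding p_def[symmetric] by (simp add: distrib_left)
qed

text \<open>An extra amount \<open>e\<close> of variance in either family is realized by a fresh
  independent copy scaled by \<open>sqrt e\<close>. Conditionally on the common part
  \<open>V\<close>, the two copies are perturbations of one fixed point, so they can be exchanged at
  a cost of order \<open>sqrt e ^ 3\<close>.\<close>

lemma log_sum_exp_interpolation_step:
  assumes X: "gaussian_family P T X q" and Z: "gaussian_family Q T Z r" and T: "T \<noteq> {}"
    and incr: "\<And>i j. i \<in> T \<Longrightarrow> j \<in> T \<Longrightarrow>
      (\<integral>\<omega>. (Z i \<omega> - Z j \<omega>)\<^sup>2 \<partial>Q) \<le> (\<integral>\<omega>. (X i \<omega> - X j \<omega>)\<^sup>2 \<partial>P)"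
    and nonneg: "0 \<le> a" "0 \<le> b" "0 \<le> e"
  defines "A \<equiv> (\<lambda>a b. \<integral>p. log_sum_exp T (\<lambda>t. sqrt a * X t (fst p) + sqrt b * Z t (snd p)) \<partial>(P \<Otimes>\<^sub>M Q))"
  shows "A a (b + e) \<le> A (a + e) b
    + sqrt e ^ 3 * ((\<Sum>t\<in>T. \<integral>\<omega>. \<bar>X t \<omega>\<bar> ^ 3 \<partial>P) + (\<Sum>t\<in>T. \<integral>\<omega>. \<bar>Z t \<omega>\<bar> ^ 3 \<partial>Q))"
proof -
  define K where "K = (\<Sum>t\<in>T. \<integral>\<omega>. \<bar>X t \<omega>\<bar> ^ 3 \<partial>P) + (\<Sum>t\<in>T. \<integral>\<omega>. \<bar>Z t \<omega>\<bar> ^ 3 \<partial>Q)"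
  have fT: "finite T" using X by (simp add: gaussian_family_def)
  interpret P: prob_space P using X by (rule gaussian_family_prob_space)
  interpret Q: prob_space Q using Z by (rule gaussian_family_prob_space)
  interpret PQ: pair_prob_space P Q ..
  define R where "R = P \<Otimes>\<^sub>M Q"
  define V where "V = (\<lambda>t p. sqrt a * X t (fst p) + sqrt b * Z t (snd p))"
  interpret R: prob_space R unfolding R_def by (rule PQ.prob_space_axioms)
  interpret RP: pair_prob_space R P ..
  interpret RQ: pair_prob_space R Q ..
  have V: "gaussian_family R T V (\<lambda>c. (sqrt a)\<^sup>2 * q c + (sqrt b)\<^sup>2 * r c)"
    unfolding R_def V_def by (intro gaussian_family_pair_add gaussian_family_cmult X Z)
  have VX: "gaussian_family (R \<Otimes>\<^sub>M P) T (\<lambda>t p. V t (fst p) + sqrt e * X t (snd p))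
      (\<lambda>c. ((sqrt a)\<^sup>2 * q c + (sqrt b)\<^sup>2 * r c) + (sqrt e)\<^sup>2 * q c)"
    by (intro gaussian_family_pair_add gaussian_family_cmult X V)
  have VZ: "gaussian_family (R \<Otimes>\<^sub>M Q) T (\<lambda>t p. V t (fst p) + sqrt e * Z t (snd p))
      (\<lambda>c. ((sqrt a)\<^sup>2 * q c + (sqrt b)\<^sup>2 * r c) + (sqrt e)\<^sup>2 * r c)"
    by (intro gaussian_family_pair_add gaussian_family_cmult Z V)
  have A1: "gaussian_family R T (\<lambda>t p. sqrt (a + e) * X t (fst p) + sqrt b * Z t (snd p))
      (\<lambda>c. (sqrt (a + e))\<^sup>2 * q c + (sqrt b)\<^sup>2 * r c)"
    unfolding R_def by (intro gaussian_family_pair_add gaussian_family_cmult X Z)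
  have A2: "gaussian_family R T (\<lambda>t p. sqrt a * X t (fst p) + sqrt (b + e) * Z t (snd p))
      (\<lambda>c. (sqrt a)\<^sup>2 * q c + (sqrt (b + e))\<^sup>2 * r c)"
    unfolding R_def by (intro gaussian_family_pair_add gaussian_family_cmult X Z)
  \<comment> \<open>Equality of these forms is the equality in law between one family of enlarged
    variance and the sum with an independent copy.\<close>
  have q1: "(\<lambda>c. (sqrt (a + e))\<^sup>2 * q c + (sqrt b)\<^sup>2 * r c) = (\<lambda>c. ((sqrt a)\<^sup>2 * q c + (sqrt b)\<^sup>2 * r c) + (sqrt e)\<^sup>2 * q c)"
    using nonneg by (simp add: algebra_simps)
  have q2: "(\<lambda>c. (sqrt a)\<^sup>2 * q c + (sqrt (b + e))\<^sup>2 * r c) = (\<lambda>c. ((sqrt a)\<^sup>2 * q c + (sqrt b)\<^sup>2 * r c) + (sqrt e)\<^sup>2 * r c)"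
    using nonneg by (simp add: algebra_simps)
  have intX: "integrable (R \<Otimes>\<^sub>M P) (\<lambda>p. log_sum_exp T (\<lambda>t. V t (fst p) + sqrt e * X t (snd p)))"
    by (intro integrable_log_sum_exp fT T gaussian_family_integrable[OF VX] gaussian_family_prob_space[OF VX])
  have intZ: "integrable (R \<Otimes>\<^sub>M Q) (\<lambda>p. log_sum_exp T (\<lambda>t. V t (fst p) + sqrt e * Z t (snd p)))"
    by (intro integrable_log_sum_exp fT T gaussian_family_integrable[OF VZ] gaussian_family_prob_space[OF VZ])
  have AX: "A (a + e) b = (\<integral>w. (\<integral>\<omega>. log_sum_exp T (\<lambda>t. V t w + sqrt e * X t \<omega>) \<partial>P) \<partial>R)"
    unfolding A_def using gaussian_family_log_sum_exp_eq[OF A1 VX[folded q1]] RP.integral_fst'[OF intX]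
    by (simp add: R_def)
  have AZ: "A a (b + e) = (\<integral>w. (\<integral>\<omega>. log_sum_exp T (\<lambda>t. V t w + sqrt e * Z t \<omega>) \<partial>Q) \<partial>R)"
    unfolding A_def using gaussian_family_log_sum_exp_eq[OF A2 VZ[folded q2]] RQ.integral_fst'[OF intZ]
    by (simp add: R_def)
  have iX: "integrable R (\<lambda>w. \<integral>\<omega>. log_sum_exp T (\<lambda>t. V t w + sqrt e * X t \<omega>) \<partial>P)"
    using RP.integrable_fst'[OF intX] by simp
  have iZ: "integrable R (\<lambda>w. \<integral>\<omega>. log_sum_exp T (\<lambda>t. V t w + sqrt e * Z t \<omega>) \<partial>Q)"
    using RQ.integrable_fst'[OF intZ] by simp
  have "A a (b + e) \<le> (\<integral>w. (\<integral>\<omega>. log_sum_exp T (\<lambda>t. V t w + sqrt e * X t \<omega>) \<partial>P) + sqrt e ^ 3 * K \<partial>R)"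
    unfolding AZ K_def
    using nonneg iX iZ by (intro integral_mono log_sum_exp_perturbation_mono[OF X Z T _ incr]) auto
  also have "\<dots> = A (a + e) b + sqrt e ^ 3 * K"
    unfolding AX using iX R.prob_space by simp
  finally show ?thesis unfolding K_def .
qed

text \<open>The variance is moved from one family to the other in \<open>n\<close> portions of size
  \<open>1 / n\<close>. Each portion costs \<open>K\<close> times the power -3/2 of
  \<open>n\<close>, so the total error \<open>K / sqrt n\<close> tends to 0.\<close>

lemma sudakov_fernique_log_sum_exp:
  assumes X: "gaussian_family P T X q" and Z: "gaussian_family Q T Z r" and T: "T \<noteq> {}"
    and incr: "\<And>i j. i \<in> T \<Longrightarrow> j \<in> T \<Longrightarrow>
      (\<integral>\<omega>. (Z i \<omega> - Z j \<omega>)\<^sup>2 \<partial>Q) \<le> (\<integral>\<omega>. (X i \<omega> - X j \<omega>)\<^sup>2 \<partial>P)"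
  shows "(\<integral>\<omega>. log_sum_exp T (\<lambda>t. Z t \<omega>) \<partial>Q) \<le> (\<integral>\<omega>. log_sum_exp T (\<lambda>t. X t \<omega>) \<partial>P)"
proof -
  define K where "K = (\<Sum>t\<in>T. \<integral>\<omega>. \<bar>X t \<omega>\<bar> ^ 3 \<partial>P) + (\<Sum>t\<in>T. \<integral>\<omega>. \<bar>Z t \<omega>\<bar> ^ 3 \<partial>Q)"
  define A where "A = (\<lambda>a b. \<integral>p. log_sum_exp T (\<lambda>t. sqrt a * X t (fst p) + sqrt b * Z t (snd p)) \<partial>(P \<Otimes>\<^sub>M Q))"
  have step: "A a (b + e) \<le> A (a + e) b + sqrt e ^ 3 * K" if "0 \<le> a" "0 \<le> b" "0 \<le> e" for a b e
    unfolding A_def K_def by (rule log_sum_exp_interpolation_step[OF X Z T incr that])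
  have gA: "gaussian_family (P \<Otimes>\<^sub>M Q) T (\<lambda>t p. sqrt a * X t (fst p) + sqrt b * Z t (snd p))
      (\<lambda>c. (sqrt a)\<^sup>2 * q c + (sqrt b)\<^sup>2 * r c)" for a b
    by (intro gaussian_family_pair_add gaussian_family_cmult X Z)
  have A10: "A 1 0 = (\<integral>\<omega>. log_sum_exp T (\<lambda>t. X t \<omega>) \<partial>P)"
    unfolding A_def by (rule gaussian_family_log_sum_exp_eq[OF gA]) (use X in simp)
  have A01: "A 0 1 = (\<integral>\<omega>. log_sum_exp T (\<lambda>t. Z t \<omega>) \<partial>Q)"
    unfolding A_def by (rule gaussian_family_log_sum_exp_eq[OF gA]) (use Z in simp)
  have "A 0 1 \<le> A 1 0 + K / sqrt (real n)" if n: "n > 0" for n :: nat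
  proof -
    have "A 0 1 \<le> A (k / n) (1 - k / n) + k * (sqrt (1 / n) ^ 3 * K)" if "k \<le> n" for k
      using that
    proof (induction k)
      case (Suc k)
      have "A (k / n) ((1 - Suc k / n) + 1 / n) \<le> A (k / n + 1 / n) (1 - Suc k / n) + sqrt (1 / n) ^ 3 * K"
        using Suc.prems n by (intro step) (auto simp: field_simps)
      moreover have "(1 - Suc k / n) + 1 / n = 1 - k / n" "k / n + 1 / n = Suc k / n"
        using n by (simp_all add: field_simps)
      ultimately have "A (k / n) (1 - k / n) \<le> A (Suc k / n) (1 - Suc k / n) + sqrt (1 / n) ^ 3 * K"
        by (simp only:)
      with Suc.IH Suc.prems show ?case by (simp add: ring_distribs)
    qed simp
    from this[of n] have "A 0 1 \<le> A 1 0 + n * (sqrt (1 / n) ^ 3 * K)" using n by simp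
    also have "n * (sqrt (1 / n) ^ 3 * K) = K / sqrt (real n)"
      using n by (simp add: power3_eq_cube real_sqrt_divide field_simps)
    finally show ?thesis .
  qed
  then have "\<forall>\<^sub>F n in sequentially. A 0 1 \<le> A 1 0 + K / sqrt (real n)"
    by (intro eventually_sequentiallyI[of 1]) auto
  moreover have "(\<lambda>n. A 1 0 + K / sqrt (real n)) \<longlonglongrightarrow> A 1 0 + 0"
    by (intro tendsto_add tendsto_const tendsto_divide_0[OF tendsto_const]
        filterlim_at_top_imp_at_infinity filterlim_compose[OF sqrt_at_top] filterlim_real_sequentially)
  ultimately have "A 0 1 \<le> A 1 0 + 0"
    by (intro tendsto_lowerbound[where F = sequentially]) auto
  then show ?thesis using A10 A01 by simp
qed

lemma borel_measurable_Max_image: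
  assumes "finite T" "T \<noteq> {}" "\<And>t. t \<in> T \<Longrightarrow> (X t :: 'a \<Rightarrow> real) \<in> borel_measurable M"
  shows "(\<lambda>\<omega>. Max ((\<lambda>t. X t \<omega>) ` T)) \<in> borel_measurable M"
  using assms by measurable

lemma integrable_Max_image:
  assumes T: "finite T" "T \<noteq> {}" and X: "\<And>t. t \<in> T \<Longrightarrow> integrable M (X t :: 'a \<Rightarrow> real)"
  shows "integrable M (\<lambda>\<omega>. Max ((\<lambda>t. X t \<omega>) ` T))"
proof (rule Bochner_Integration.integrable_bound)
  show "integrable M (\<lambda>\<omega>. \<Sum>t\<in>T. \<bar>X t \<omega>\<bar>)"
    using X by (intro Bochner_Integration.integrable_sum) auto
  show "(\<lambda>\<omega>. Max ((\<lambda>t. X t \<omega>) ` T)) \<in> borel_measurable M"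
    using X by (intro borel_measurable_Max_image T) auto
  show "AE \<omega> in M. norm (Max ((\<lambda>t. X t \<omega>) ` T)) \<le> norm (\<Sum>t\<in>T. \<bar>X t \<omega>\<bar>)"
    using order_trans[OF abs_Max_le_sum[OF T] abs_ge_self] by (intro AE_I2) (simp only: real_norm_def)
qed

text \<open>Scaling both families by \<open>l\<close> preserves the comparison of increments. After
  division by \<open>l\<close>, the gap between the smooth and the true maximum is at most
  \<open>ln (card T) / l\<close>, which vanishes in the limit.\<close>

theorem sudakov_fernique:
  assumes X: "gaussian_family P T X q" and Z: "gaussian_family Q T Z r" and T: "T \<noteq> {}"
    and incr: "\<And>i j. i \<in> T \<Longrightarrow> j \<in> T \<Longrightarrow>
      (\<integral>\<omega>. (Z i \<omega> - Z j \<omega>)\<^sup>2 \<partial>Q) \<le> (\<integral>\<omega>. (X i \<omega> - X j \<omega>)\<^sup>2 \<partial>P)"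
  shows "(\<integral>\<omega>. Max ((\<lambda>t. Z t \<omega>) ` T) \<partial>Q) \<le> (\<integral>\<omega>. Max ((\<lambda>t. X t \<omega>) ` T) \<partial>P)"
proof -
  have fT: "finite T" using X by (simp add: gaussian_family_def)
  interpret P: prob_space P using X by (rule gaussian_family_prob_space)
  interpret Q: prob_space Q using Z by (rule gaussian_family_prob_space)
  have max_mult: "Max ((\<lambda>t. l * f t) ` T) = l * Max (f ` T)" if "l > 0" for l and f :: "_ \<Rightarrow> real"
    using mono_Max_commute[of "\<lambda>x. l * x" "f ` T"] fT T that
    by (simp add: image_image mono_def)
  note iX = integrable_Max_image[OF fT T gaussian_family_integrable[OF X]]
  note iZ = integrable_Max_image[OF fT T gaussian_family_integrable[OF Z]]
  have "(\<integral>\<omega>. Max ((\<lambda>t. Z t \<omega>) ` T) \<partial>Q) \<le> (\<integral>\<omega>. Max ((\<lambda>t. X t \<omega>) ` T) \<partial>P) + ln (card T) / l"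
    if l: "l > 0" for l
  proof -
    note lX = gaussian_family_cmult[OF X, of l] and lZ = gaussian_family_cmult[OF Z, of l]
    have "l * (\<integral>\<omega>. Max ((\<lambda>t. Z t \<omega>) ` T) \<partial>Q) = (\<integral>\<omega>. Max ((\<lambda>t. l * Z t \<omega>) ` T) \<partial>Q)"
      using l by (simp add: max_mult)
    also have "\<dots> \<le> (\<integral>\<omega>. log_sum_exp T (\<lambda>t. l * Z t \<omega>) \<partial>Q)"
      by (intro integral_mono integrable_Max_image integrable_log_sum_exp fT T log_sum_exp_bounds
          gaussian_family_integrable[OF lZ] Q.prob_space_axioms)
    also have "\<dots> \<le> (\<integral>\<omega>. log_sum_exp T (\<lambda>t. l * X t \<omega>) \<partial>P)"
      using incr l by (intro sudakov_fernique_log_sum_exp[OF lX lZ T])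
        (simp add: right_diff_distrib[symmetric] power_mult_distrib)
    also have "\<dots> \<le> (\<integral>\<omega>. Max ((\<lambda>t. l * X t \<omega>) ` T) + ln (card T) \<partial>P)"
      by (intro integral_mono integrable_Max_image integrable_log_sum_exp fT T log_sum_exp_bounds
          gaussian_family_integrable[OF lX] P.prob_space_axioms Bochner_Integration.integrable_add P.integrable_const)
    also have "\<dots> = l * (\<integral>\<omega>. Max ((\<lambda>t. X t \<omega>) ` T) \<partial>P) + ln (card T)"
      using l iX P.prob_space by (simp add: max_mult)
    finally show ?thesis using l by (simp add: field_simps)
  qed
  then have "\<forall>\<^sub>F l in at_top. (\<integral>\<omega>. Max ((\<lambda>t. Z t \<omega>) ` T) \<partial>Q) \<le> (\<integral>\<omega>. Max ((\<lambda>t. X t \<omega>) ` T) \<partial>P) + ln (card T) / l"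
    using eventually_gt_at_top[of "0::real"] by (rule eventually_mono[rotated])
  moreover have "((\<lambda>l. (\<integral>\<omega>. Max ((\<lambda>t. X t \<omega>) ` T) \<partial>P) + ln (card T) / l)
      \<longlongrightarrow> (\<integral>\<omega>. Max ((\<lambda>t. X t \<omega>) ` T) \<partial>P) + 0) at_top"
    by (intro tendsto_add tendsto_const tendsto_divide_0[OF tendsto_const]
        filterlim_at_top_imp_at_infinity filterlim_ident)
  ultimately have "(\<integral>\<omega>. Max ((\<lambda>t. Z t \<omega>) ` T) \<partial>Q) \<le> (\<integral>\<omega>. Max ((\<lambda>t. X t \<omega>) ` T) \<partial>P) + 0"
    by (intro tendsto_lowerbound[where F = at_top]) auto
  then show ?thesis by simp
qed

section \<open>The growth condition\<close>

text \<open>With \<open>u = sqrt (ln m)\<close>, one variable reaches \<open>u\<close> with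
  probability at least \<open>1 / (m * exp 1 * sqrt (2 * pi))\<close>, so all \<open>m\<close> stay
  below \<open>u\<close> with probability bounded away from 1 uniformly in \<open>m\<close>. On that
  event the maximum is still at least \<open>- \<bar>g 0\<bar>\<close>, which costs at most 1 in the
  mean.\<close>

lemma PiM_std_normal_Max_ge:
  fixes m :: nat
  assumes m: "0 < m"
  defines "G \<equiv> (\<integral>g. Max (g ` {..<m}) \<partial>PiM {..<m} (\<lambda>_. std_normal_distribution))"
  shows "sqrt (ln m) * (1 - exp (- 1 / (exp 1 * sqrt (2 * pi)))) - 1 \<le> G"
proof -
  let ?N = "std_normal_distribution" and ?P = "PiM {..<m} (\<lambda>_. std_normal_distribution)"
  interpret N: prob_space ?N by (rule prob_space_std_normal)
  interpret PP: product_prob_space "\<lambda>_. ?N" "{..<m}" ..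
  define u where "u = sqrt (ln m)"
  have u: "0 \<le> u" "u\<^sup>2 = ln m" using m by (auto simp: u_def)
  have density_ge: "std_normal_density (u + 1) \<ge> 1 / (m * exp 1 * sqrt (2 * pi))"
  proof -
    \<comment> \<open>Equivalent to the nonnegativity of \<open>(u - 1)\<^sup>2\<close>. It trades
      the factor 1/2 in the exponent for the constant \<open>exp 1\<close>.\<close>
    have "(u + 1)\<^sup>2 / 2 \<le> u\<^sup>2 + 1" using sum_squares_ge_zero[of "u - 1" 0] by (simp add: power2_eq_square field_simps)
    then have "exp (- (u\<^sup>2 + 1)) \<le> exp (- (u + 1)\<^sup>2 / 2)" by simp
    moreover have "exp (- (u\<^sup>2 + 1)) = 1 / (m * exp 1)"
      unfolding u(2) exp_minus exp_add using m by (simp add: inverse_eq_divide)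
    ultimately have "1 / (m * exp 1) \<le> exp (- (u + 1)\<^sup>2 / 2)" by (simp only:)
    then have "1 / sqrt (2 * pi) * (1 / (m * exp 1)) \<le> std_normal_density (u + 1)"
      unfolding std_normal_density_def by (intro mult_left_mono) auto
    then show ?thesis by (simp add: mult_ac)
  qed
  have tail: "std_normal_density (u + 1) \<le> measure ?N {u..u + 1}"
  proof -
    have int: "integrable lborel (\<lambda>x. indicator {u..u+1} x * std_normal_density x)"
      by (rule Bochner_Integration.integrable_bound[OF integrable_normal_density[of 1 0]]) (auto split: split_indicator)
    have "std_normal_density (u + 1) = (\<integral>x. indicator {u..u+1} x * std_normal_density (u + 1) \<partial>lborel)"
      by simp
    also have "\<dots> \<le> (\<integral>x. indicator {u..u+1} x * std_normal_density x \<partial>lborel)"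
    proof (rule integral_mono[OF _ int])
      show "integrable lborel (\<lambda>x. indicator {u..u+1} x * std_normal_density (u + 1))" by simp
      fix x
      have "std_normal_density (u + 1) \<le> std_normal_density x" if "x \<in> {u..u+1}"
        unfolding std_normal_density_def using that u
        by (intro mult_left_mono) (auto intro!: power_mono)
      then show "indicator {u..u+1} x * std_normal_density (u + 1) \<le> indicator {u..u+1} x * std_normal_density x"
        by (auto split: split_indicator)
    qed
    also have "\<dots> = (\<integral>x. indicator {u..u+1} x \<partial>?N)"
      by (subst integral_density) (auto simp: mult.commute)
    also have "\<dots> = measure ?N {u..u+1}" by simp
    finally show ?thesis .
  qed
  have below: "measure ?N {..<u} \<le> 1 - std_normal_density (u + 1)"
  proof -
    have "measure ?N {..<u} + measure ?N {u..u+1} = measure ?N ({..<u} \<union> {u..u+1})"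
      by (rule N.finite_measure_Union[symmetric]) auto
    also have "\<dots> \<le> 1" by simp
    finally show ?thesis using tail by simp
  qed
  \<comment> \<open>The indicator of the event that all variables stay below \<open>u\<close>, in
    product form so that independence applies.\<close>
  define I where "I g = (\<Prod>i<m. indicator {..<u} (g i) :: real)" for g :: "nat \<Rightarrow> real"
  have ind: "integrable ?N (indicator {..<u} :: real \<Rightarrow> real)"
    by (rule N.integrable_const_bound[where B = 1]) auto
  have I_int: "integrable ?P I"
    unfolding I_def using ind by (intro PP.product_integrable_prod) auto
  have "(\<integral>g. I g \<partial>?P) = (\<Prod>i<m. measure ?N {..<u})"
    unfolding I_def using ind by (subst PP.product_integral_prod) auto
  also have "\<dots> = measure ?N {..<u} ^ m" by simp
  also have "\<dots> \<le> exp (- 1 / (m * exp 1 * sqrt (2 * pi))) ^ m"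
  proof (rule power_mono)
    have "measure ?N {..<u} \<le> 1 + - 1 / (m * exp 1 * sqrt (2 * pi))"
      using below density_ge by simp
    also have "\<dots> \<le> exp (- 1 / (m * exp 1 * sqrt (2 * pi)))" by (rule exp_ge_add_one_self)
    finally show "measure ?N {..<u} \<le> exp (- 1 / (m * exp 1 * sqrt (2 * pi)))" .
  qed simp
  also have "\<dots> = exp (- 1 / (exp 1 * sqrt (2 * pi)))"
    using m by (simp add: exp_of_nat_mult[symmetric])
  finally have I_le: "(\<integral>g. I g \<partial>?P) \<le> exp (- 1 / (exp 1 * sqrt (2 * pi)))" .
  have comp_int: "integrable ?P (\<lambda>g. g i)" if "i < m" for i
    using integrable_distr[OF measurable_component_singleton, of i "{..<m}" "\<lambda>_. ?N" "\<lambda>x. x"]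
      integrable_std_normal_distribution_moment[of 1] that by (simp add: PP.PiM_component)
  have abs0: "(\<integral>g. \<bar>g 0\<bar> \<partial>?P) \<le> 1"
  proof -
    have "(\<integral>g. \<bar>g 0\<bar> \<partial>?P) = (\<integral>x. \<bar>x\<bar> \<partial>distr ?P ?N (\<lambda>g. g 0))"
      using m by (subst integral_distr) auto
    also have "\<dots> = sqrt (2 / pi)"
      using m std_normal_distribution_odd_moments_abs[of 0] by (simp add: PP.PiM_component)
    also have "\<dots> \<le> 1" using pi_ge_two by (simp add: real_sqrt_le_1_iff)
    finally show ?thesis .
  qed
  have ne: "{..<m} \<noteq> {}" using m by auto
  have "u * (1 - (\<integral>g. I g \<partial>?P)) - (\<integral>g. \<bar>g 0\<bar> \<partial>?P) = (\<integral>g. u * (1 - I g) - \<bar>g 0\<bar> \<partial>?P)"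
    using I_int comp_int[OF m] PP.P.prob_space by simp
  also have "\<dots> \<le> G"
    unfolding G_def
  proof (rule integral_mono)
    show "integrable ?P (\<lambda>g. u * (1 - I g) - \<bar>g 0\<bar>)" using I_int comp_int[OF m] by simp
    show "integrable ?P (\<lambda>g. Max (g ` {..<m}))"
      using integrable_Max_image[of "{..<m}" ?P "\<lambda>i g. g i"] comp_int ne by simp
    fix g :: "nat \<Rightarrow> real"
    have g0: "g 0 \<le> Max (g ` {..<m})" using m by simp
    show "u * (1 - I g) - \<bar>g 0\<bar> \<le> Max (g ` {..<m})"
    proof (cases "\<forall>i<m. g i < u")
      case True
      then have "I g = 1" by (simp add: I_def)
      then show ?thesis using g0 by simp
    next
      case False
      then obtain i where i: "i < m" "u \<le> g i" by (auto simp: not_less)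
      then have "I g = 0" unfolding I_def by (intro prod_zero) (auto intro!: bexI[of _ i])
      then have "u * (1 - I g) - \<bar>g 0\<bar> \<le> g i" using i by simp
      also have "g i \<le> Max (g ` {..<m})" using i by simp
      finally show ?thesis .
    qed
  qed
  finally have "u * (1 - (\<integral>g. I g \<partial>?P)) - (\<integral>g. \<bar>g 0\<bar> \<partial>?P) \<le> G" .
  moreover have "u * (1 - exp (- 1 / (exp 1 * sqrt (2 * pi)))) \<le> u * (1 - (\<integral>g. I g \<partial>?P))"
    using I_le u by (intro mult_left_mono) auto
  ultimately show ?thesis using abs0 unfolding u_def by linarith
qed

text \<open>Stating the form as a second moment avoids transporting \<open>q\<close> through the
  matrix \<open>B\<close>; the parameter of a centered normal variable is its second moment.\<close>

lemma gaussian_family_linear_image: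
  assumes X: "gaussian_family P T X q" and U: "finite U"
    and Y: "\<And>u \<omega>. u \<in> U \<Longrightarrow> Y u \<omega> = (\<Sum>t\<in>T. B u t * X t \<omega>)"
  shows "gaussian_family P U Y (\<lambda>c. \<integral>\<omega>. (\<Sum>u\<in>U. c u * Y u \<omega>)\<^sup>2 \<partial>P)"
  unfolding gaussian_family_def
proof (intro conjI allI U)
  fix c
  have "(\<Sum>u\<in>U. c u * Y u \<omega>) = (\<Sum>t\<in>T. (\<Sum>u\<in>U. c u * B u t) * X t \<omega>)" for \<omega>
    using Y by (simp add: sum_distrib_left sum_distrib_right mult.assoc sum.swap[of _ U T])
  then have "centered_normal P (\<lambda>\<omega>. \<Sum>u\<in>U. c u * Y u \<omega>) (q (\<lambda>t. \<Sum>u\<in>U. c u * B u t))"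
    using gaussian_familyD[OF X] by simp
  from this centered_normal_second_moment[OF this]
  show "centered_normal P (\<lambda>\<omega>. \<Sum>u\<in>U. c u * Y u \<omega>) (\<integral>\<omega>. (\<Sum>u\<in>U. c u * Y u \<omega>)\<^sup>2 \<partial>P)" by simp
qed

lemma gaussian_family_subset:
  assumes X: "gaussian_family P T X q" and U: "U \<subseteq> T"
  shows "gaussian_family P U X (\<lambda>c. \<integral>\<omega>. (\<Sum>u\<in>U. c u * X u \<omega>)\<^sup>2 \<partial>P)"
proof (rule gaussian_family_linear_image[OF X, where B = "\<lambda>u t. if t = u then 1 else 0"])
  have T: "finite T" using X by (simp add: gaussian_family_def)
  then show "finite U" using U finite_subset by blast
  show "X u \<omega> = (\<Sum>t\<in>T. (if t = u then 1 else 0) * X t \<omega>)" if "u \<in> U" for u \<omega>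
    using T U that by (auto simp: if_distrib[of "\<lambda>c. c * _"] cong: if_cong)
qed

text \<open>Each block reads its own coordinate of the product space. Points of one block share a
  sample, and different blocks are independent by construction.\<close>

lemma gaussian_family_independent_blocks:
  fixes idx :: "'i \<Rightarrow> nat"
  assumes U: "finite U" and idx: "\<And>u. u \<in> U \<Longrightarrow> idx u < m" and P: "prob_space P"
    and Y: "\<And>i. i < m \<Longrightarrow> gaussian_family P {u \<in> U. idx u = i} Y (q i)"
  shows "gaussian_family (PiM {..<m} (\<lambda>_. P)) U (\<lambda>u \<omega>. Y u (\<omega> (idx u))) (\<lambda>c. \<Sum>i<m. q i c)"
  unfolding gaussian_family_def
proof (intro conjI allI U)
  fix c
  have "centered_normal (PiM {..<m} (\<lambda>_. P))
      (\<lambda>\<omega>. \<Sum>i<m. (\<lambda>\<omega>. \<Sum>u\<in>{u \<in> U. idx u = i}. c u * Y u \<omega>) (\<omega> i)) (\<Sum>i<m. q i c)"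
    by (intro centered_normal_PiM_sum gaussian_familyD Y P) auto
  moreover have "(\<Sum>i<m. \<Sum>u\<in>{u \<in> U. idx u = i}. c u * Y u (\<omega> i)) = (\<Sum>u\<in>U. c u * Y u (\<omega> (idx u)))" for \<omega>
  proof -
    have "(\<Sum>i<m. \<Sum>u\<in>{u \<in> U. idx u = i}. c u * Y u (\<omega> i)) = (\<Sum>i<m. \<Sum>u\<in>{u \<in> U. idx u = i}. c u * Y u (\<omega> (idx u)))"
      by (intro sum.cong) auto
    also have "\<dots> = (\<Sum>u\<in>U. c u * Y u (\<omega> (idx u)))"
      by (rule sum.group) (use U idx in auto)
    finally show ?thesis .
  qed
  ultimately show "centered_normal (PiM {..<m} (\<lambda>_. P)) (\<lambda>\<omega>. \<Sum>u\<in>U. c u * Y u (\<omega> (idx u))) (\<Sum>i<m. q i c)"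
    by simp
qed

lemma PiM_integral_component:
  fixes f :: "'a \<Rightarrow> real"
  assumes P: "prob_space P" and i: "i \<in> I" and [measurable]: "f \<in> borel_measurable P"
  shows "(\<integral>\<omega>. f (\<omega> i) \<partial>PiM I (\<lambda>_. P)) = (\<integral>x. f x \<partial>P)"
proof -
  interpret P: prob_space P by fact
  interpret PP: product_prob_space "\<lambda>_. P" I ..
  have "(\<integral>\<omega>. f (\<omega> i) \<partial>PiM I (\<lambda>_. P)) = (\<integral>x. f x \<partial>distr (PiM I (\<lambda>_. P)) P (\<lambda>\<omega>. \<omega> i))"
    using i by (subst integral_distr) auto
  then show ?thesis using PP.PiM_component[OF i] by simp
qed

lemma sum_difference_indicators:
  fixes f :: "'i \<Rightarrow> real"
  assumes "finite H"
  shows "(\<Sum>u\<in>H. ((if u = s then 1 else 0) - (if u = t then 1 else 0)) * f u)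
    = (if s \<in> H then f s else 0) - (if t \<in> H then f t else 0)"
  using assms by (simp add: left_diff_distrib sum_subtractf if_distrib[of "\<lambda>c. c * _"] cong: if_cong)

text \<open>There is no absolute value here, so subtracting a centered variable common to all of
  \<open>A\<close> leaves the functional unchanged. The clusters of the growth condition are
  recentered in this way.\<close>

definition gp_sup_mean :: "'w measure \<Rightarrow> ('i \<Rightarrow> 'w \<Rightarrow> real) \<Rightarrow> 'i set \<Rightarrow> real" where
  "gp_sup_mean M X A = (\<integral>\<omega>. Max ((\<lambda>t. X t \<omega>) ` A) \<partial>M)"

text \<open>Comparison with the process that has independent copies of \<open>X t - X (c i)\<close> on the clusters,
  shifted by independent normal variables, replaces the usual appeal to Gaussian concentration.\<close>

lemma gaussian_growth:
  fixes idx :: "'i \<Rightarrow> nat"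
  assumes X: "gaussian_family M T X q" and U: "U \<subseteq> T" and m: "0 < m" and s: "0 \<le> s"
    and idx: "\<And>u. u \<in> U \<Longrightarrow> idx u < m" and c: "\<And>i. i < m \<Longrightarrow> c i \<in> T"
    and ne: "\<And>i. i < m \<Longrightarrow> {u \<in> U. idx u = i} \<noteq> {}"
    and near: "\<And>u. u \<in> U \<Longrightarrow> gp_dist M X u (c (idx u)) \<le> s / 4"
    and far: "\<And>u v. u \<in> U \<Longrightarrow> v \<in> U \<Longrightarrow> idx u \<noteq> idx v \<Longrightarrow> s / 2 \<le> gp_dist M X u v"
    and v: "\<And>i. i < m \<Longrightarrow> v \<le> gp_sup_mean M X {u \<in> U. idx u = i}"
  shows "v + s / 4 * (\<integral>g. Max (g ` {..<m}) \<partial>PiM {..<m} (\<lambda>_. std_normal_distribution)) \<le> gp_sup_mean M X U"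
proof -
  let ?N = "std_normal_distribution"
  define P1 where "P1 = PiM {..<m} (\<lambda>_. ?N)"
  define P2 where "P2 = PiM {..<m} (\<lambda>_. M)"
  interpret N: prob_space ?N by (rule prob_space_std_normal)
  interpret M: prob_space M using X by (rule gaussian_family_prob_space)
  interpret P1: prob_space P1 unfolding P1_def by (intro prob_space_PiM N.prob_space_axioms)
  interpret P2: prob_space P2 unfolding P2_def by (intro prob_space_PiM M.prob_space_axioms)
  interpret PP: pair_prob_space P1 P2 ..
  have fT: "finite T" using X by (simp add: gaussian_family_def)
  have fU: "finite U" using U fT finite_subset by blast
  define H where "H i = {u \<in> U. idx u = i}" for i
  have fH: "finite (H i)" for i using fU by (simp add: H_def)
  have H_ne: "H i \<noteq> {}" if "i < m" for i using ne[OF that] by (simp add: H_def)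
  have U_ne: "U \<noteq> {}" using ne[OF m] by auto
  define Y where "Y u \<omega> = X u \<omega> - X (c (idx u)) \<omega>" for u \<omega>
  have mX[measurable]: "X t \<in> borel_measurable M" if "t \<in> T" for t
    using gaussian_family_measurable[OF X that] .
  have iX: "integrable M (X t)" if "t \<in> T" for t
    using gaussian_family_integrable[OF X that] .
  have gN: "gaussian_family ?N {u \<in> U. idx u = i} (\<lambda>u x. s / 4 * x) (\<lambda>a. (\<Sum>u\<in>H i. a u)\<^sup>2 * (s / 4)\<^sup>2)" for i
    unfolding gaussian_family_def
  proof (intro conjI allI)
    show "finite {u \<in> U. idx u = i}" using fU by simp
    fix a
    have "centered_normal ?N (\<lambda>x. ((\<Sum>u\<in>H i. a u) * (s / 4)) * x) (((\<Sum>u\<in>H i. a u) * (s / 4))\<^sup>2 * 1)"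
      by (rule centered_normal_cmult[OF centered_normal_std])
    moreover have "(\<lambda>x. \<Sum>u\<in>{u \<in> U. idx u = i}. a u * (s / 4 * x)) = (\<lambda>x. ((\<Sum>u\<in>H i. a u) * (s / 4)) * x)"
      unfolding H_def by (simp only: sum_distrib_right mult.assoc)
    ultimately show "centered_normal ?N (\<lambda>x. \<Sum>u\<in>{u \<in> U. idx u = i}. a u * (s / 4 * x)) ((\<Sum>u\<in>H i. a u)\<^sup>2 * (s / 4)\<^sup>2)"
      by (simp only: power_mult_distrib mult_1_right)
  qed
  have gM: "gaussian_family M {u \<in> U. idx u = i} Y (\<lambda>a. \<integral>\<omega>. (\<Sum>u\<in>H i. a u * Y u \<omega>)\<^sup>2 \<partial>M)" if i: "i < m" for i
    unfolding H_def
  proof (rule gaussian_family_linear_image[OF X, where B = "\<lambda>u t. (if t = u then 1 else 0) - (if t = c (idx u) then 1 else 0)"])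
    show "finite {u \<in> U. idx u = i}" using fU by simp
    fix u \<omega> assume "u \<in> {u \<in> U. idx u = i}"
    then have "u \<in> T" "c (idx u) \<in> T" using U c idx by auto
    then show "Y u \<omega> = (\<Sum>t\<in>T. ((if t = u then 1 else 0) - (if t = c (idx u) then 1 else 0)) * X t \<omega>)"
      unfolding sum_difference_indicators[OF fT] by (simp add: Y_def)
  qed
  \<comment> \<open>The comparison process: cluster \<open>i\<close> carries an independent copy of
    its recentered points, shifted as a whole by a normal variable of standard deviation
    \<open>s / 4\<close>.\<close>
  define Z where "Z u p = s / 4 * fst p (idx u) + Y u (snd p (idx u))" for u and p :: "(nat \<Rightarrow> real) \<times> (nat \<Rightarrow> _)"
  define r where "r a = (\<Sum>i<m. (\<Sum>u\<in>H i. a u)\<^sup>2 * (s / 4)\<^sup>2) + (\<Sum>i<m. \<integral>\<omega>. (\<Sum>u\<in>H i. a u * Y u \<omega>)\<^sup>2 \<partial>M)" for a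
  have gZ: "gaussian_family (P1 \<Otimes>\<^sub>M P2) U Z r"
    unfolding Z_def r_def P1_def P2_def
    by (intro gaussian_family_pair_add gaussian_family_independent_blocks[where Y = "\<lambda>u x. s / 4 * x", simplified]
        gaussian_family_independent_blocks fU idx gN gM N.prob_space_axioms M.prob_space_axioms)
  have gXU: "gaussian_family M U X (\<lambda>c. \<integral>\<omega>. (\<Sum>u\<in>U. c u * X u \<omega>)\<^sup>2 \<partial>M)"
    by (rule gaussian_family_subset[OF X U])
  have near': "(\<integral>\<omega>. (Y u \<omega>)\<^sup>2 \<partial>M) \<le> (s / 4)\<^sup>2" if "u \<in> U" for u
    using near[OF that] by (simp add: gp_dist_def Y_def real_sqrt_le_iff' real_le_lsqrt sqrt_le_D)
  have incr: "(\<integral>p. (Z u p - Z w p)\<^sup>2 \<partial>(P1 \<Otimes>\<^sub>M P2)) \<le> (\<integral>\<omega>. (X u \<omega> - X w \<omega>)\<^sup>2 \<partial>M)"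
    if uw: "u \<in> U" "w \<in> U" for u w
  proof -
    let ?a = "\<lambda>r. (if r = u then 1 else 0) - (if r = w then 1 else 0) :: real"
    have lin: "(\<Sum>t\<in>H i. ?a t * f t) = (if idx u = i then f u else 0) - (if idx w = i then f w else 0)" for i f
      unfolding sum_difference_indicators[OF fH] using uw by (auto simp: H_def)
    have lin1: "(\<Sum>t\<in>H i. ?a t) = (if idx u = i then 1 else 0) - (if idx w = i then 1 else 0)" for i
      using lin[of "\<lambda>_. 1" i] by simp
    have "(\<integral>p. (Z u p - Z w p)\<^sup>2 \<partial>(P1 \<Otimes>\<^sub>M P2)) = r ?a"
      by (rule centered_normal_second_moment[OF gaussian_family_difference[OF gZ uw]])
    also have "\<dots> = (\<Sum>i<m. ((if idx u = i then 1 else 0) - (if idx w = i then 1 else 0))\<^sup>2 * (s / 4)\<^sup>2)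
       + (\<Sum>i<m. \<integral>\<omega>. ((if idx u = i then Y u \<omega> else 0) - (if idx w = i then Y w \<omega> else 0))\<^sup>2 \<partial>M)"
      unfolding r_def lin lin1 ..
    also have "\<dots> \<le> (\<integral>\<omega>. (X u \<omega> - X w \<omega>)\<^sup>2 \<partial>M)"
    \<comment> \<open>Inside a cluster the shift and the centre cancel, so the increments agree
      exactly. Across clusters the variance of the increment of \<open>Z\<close> is at most
      \<open>4 * (s / 4)\<^sup>2 = (s / 2)\<^sup>2\<close>: two shifts and two recentered points
      contribute at most \<open>(s / 4)\<^sup>2\<close> each.\<close>
    proof (cases "idx u = idx w")
      case True
      have "(\<integral>\<omega>. ((if idx u = i then Y u \<omega> else 0) - (if idx w = i then Y w \<omega> else 0))\<^sup>2 \<partial>M)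
          = (if i = idx w then (\<integral>\<omega>. (X u \<omega> - X w \<omega>)\<^sup>2 \<partial>M) else 0)" for i
        using True by (auto simp: Y_def)
      then show ?thesis using True idx[OF uw(2)] by simp
    next
      case False
      have 1: "(\<integral>\<omega>. ((if idx u = i then Y u \<omega> else 0) - (if idx w = i then Y w \<omega> else 0))\<^sup>2 \<partial>M)
          = (if i = idx u then (\<integral>\<omega>. (Y u \<omega>)\<^sup>2 \<partial>M) else 0) + (if i = idx w then (\<integral>\<omega>. (Y w \<omega>)\<^sup>2 \<partial>M) else 0)" for i
        using False by auto
      have 2: "((if idx u = i then 1 else 0) - (if idx w = i then 1 else 0))\<^sup>2 * (s / 4)\<^sup>2
          = (if i = idx u then (s / 4)\<^sup>2 else 0) + (if i = idx w then (s / 4)\<^sup>2 else 0)" for i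
        using False by auto
      have "(s / 2)\<^sup>2 \<le> (gp_dist M X u w)\<^sup>2"
        using far[OF uw False] s by (intro power_mono) auto
      also have "\<dots> = (\<integral>\<omega>. (X u \<omega> - X w \<omega>)\<^sup>2 \<partial>M)" by (simp add: gp_dist_def)
      finally have "4 * (s / 4)\<^sup>2 \<le> (\<integral>\<omega>. (X u \<omega> - X w \<omega>)\<^sup>2 \<partial>M)" by (simp add: power2_eq_square)
      then show ?thesis
        unfolding 1 2 using near'[OF uw(1)] near'[OF uw(2)] idx[OF uw(1)] idx[OF uw(2)]
        by (simp add: sum.distrib)
    qed
    finally show ?thesis .
  qed
  have compare: "(\<integral>p. Max ((\<lambda>u. Z u p) ` U) \<partial>(P1 \<Otimes>\<^sub>M P2)) \<le> gp_sup_mean M X U"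
    unfolding gp_sup_mean_def by (rule sudakov_fernique[OF gXU gZ U_ne incr])
  have intZ: "integrable (P1 \<Otimes>\<^sub>M P2) (\<lambda>p. Max ((\<lambda>u. Z u p) ` U))"
    by (intro integrable_Max_image fU U_ne gaussian_family_integrable[OF gZ])
  \<comment> \<open>With the shifts \<open>g\<close> fixed, the supremum is restricted to the
    cluster with the largest shift; its centre has mean 0, so this cluster contributes at least
    \<open>v\<close> plus that shift.\<close>
  have inner: "v + s / 4 * Max (g ` {..<m}) \<le> (\<integral>\<omega>. Max ((\<lambda>u. Z u (g, \<omega>)) ` U) \<partial>P2)"
    if int: "integrable P2 (\<lambda>\<omega>. Max ((\<lambda>u. Z u (g, \<omega>)) ` U))" for g
  proof -
    have "Max (g ` {..<m}) \<in> g ` {..<m}" using m by (intro Max_in) auto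
    then obtain i where i: "i < m" "Max (g ` {..<m}) = g i" by auto
    define f where "f \<omega> = s / 4 * g i + (Max ((\<lambda>u. X u \<omega>) ` H i) - X (c i) \<omega>)" for \<omega>
    have HT: "H i \<subseteq> T" using U by (auto simp: H_def)
    have iMax: "integrable M (\<lambda>\<omega>. Max ((\<lambda>u. X u \<omega>) ` H i))"
      using HT by (intro integrable_Max_image fH H_ne[OF i(1)] iX) auto
    have f_int: "integrable M f"
      unfolding f_def using iMax iX[OF c[OF i(1)]] by simp
    have f_comp_int: "integrable P2 (\<lambda>\<omega>. f (\<omega> i))"
      unfolding P2_def
    proof (rule integrable_distr[where M' = M and T = "\<lambda>\<omega>. \<omega> i"])
      show "(\<lambda>\<omega>. \<omega> i) \<in> measurable (PiM {..<m} (\<lambda>_. M)) M" using i by simp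
      interpret QQ: product_prob_space "\<lambda>_. M" "{..<m}" ..
      show "integrable (distr (PiM {..<m} (\<lambda>_. M)) M (\<lambda>\<omega>. \<omega> i)) f"
        using QQ.PiM_component[of i] i f_int by simp
    qed
    have "v + s / 4 * Max (g ` {..<m}) \<le> gp_sup_mean M X (H i) + s / 4 * g i"
      using v[OF i(1)] i by (simp add: H_def)
    also have "\<dots> = (\<integral>\<omega>. f \<omega> \<partial>M)"
      unfolding f_def gp_sup_mean_def
      using iMax iX[OF c[OF i(1)]] M.prob_space
        centered_normal_mean[OF gaussian_family_component[OF X c[OF i(1)]]] by simp
    also have "\<dots> = (\<integral>\<omega>. f (\<omega> i) \<partial>P2)"
      unfolding P2_def using i f_int by (intro PiM_integral_component[symmetric] M.prob_space_axioms) auto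
    also have "\<dots> \<le> (\<integral>\<omega>. Max ((\<lambda>u. Z u (g, \<omega>)) ` U) \<partial>P2)"
    proof (rule integral_mono[OF f_comp_int int])
      fix \<omega> :: "nat \<Rightarrow> _"
      have "Max ((\<lambda>u. X u (\<omega> i)) ` H i) \<in> (\<lambda>u. X u (\<omega> i)) ` H i"
        using fH H_ne[OF i(1)] by (intro Max_in) auto
      then obtain u where u: "u \<in> H i" "Max ((\<lambda>u. X u (\<omega> i)) ` H i) = X u (\<omega> i)" by auto
      then have "f (\<omega> i) = Z u (g, \<omega>)" by (simp add: f_def Z_def Y_def H_def)
      also have "\<dots> \<le> Max ((\<lambda>u. Z u (g, \<omega>)) ` U)"
        using u fU by (intro Max_ge) (auto simp: H_def)
      finally show "f (\<omega> i) \<le> Max ((\<lambda>u. Z u (g, \<omega>)) ` U)" .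
    qed
    finally show ?thesis .
  qed
  interpret NN: product_prob_space "\<lambda>_. ?N" "{..<m}" ..
  have g_int: "integrable P1 (\<lambda>g. g i)" if "i < m" for i
    unfolding P1_def
  proof (rule integrable_distr[where M' = ?N and T = "\<lambda>g. g i"])
    show "(\<lambda>g. g i) \<in> measurable (PiM {..<m} (\<lambda>_. ?N)) ?N" using that by simp
    show "integrable (distr (PiM {..<m} (\<lambda>_. ?N)) ?N (\<lambda>g. g i)) (\<lambda>x. x)"
      using NN.PiM_component[of i] that integrable_std_normal_distribution_moment[of 1] by simp
  qed
  have iG: "integrable P1 (\<lambda>g. Max (g ` {..<m}))"
    using m by (intro integrable_Max_image[where X = "\<lambda>i g. g i"] g_int) auto
  have "v + s / 4 * (\<integral>g. Max (g ` {..<m}) \<partial>P1) = (\<integral>g. v + s / 4 * Max (g ` {..<m}) \<partial>P1)"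
    using iG P1.prob_space by simp
  also have "\<dots> \<le> (\<integral>g. (\<integral>\<omega>. Max ((\<lambda>u. Z u (g, \<omega>)) ` U) \<partial>P2) \<partial>P1)"
  proof (rule integral_mono_AE)
    show "integrable P1 (\<lambda>g. v + s / 4 * Max (g ` {..<m}))" using iG by simp
    show "integrable P1 (\<lambda>g. \<integral>\<omega>. Max ((\<lambda>u. Z u (g, \<omega>)) ` U) \<partial>P2)" using PP.integrable_fst'[OF intZ] .
    \<comment> \<open>Fubini yields an integrable section only for almost every
      \<open>g\<close>.\<close>
    show "AE g in P1. v + s / 4 * Max (g ` {..<m}) \<le> (\<integral>\<omega>. Max ((\<lambda>u. Z u (g, \<omega>)) ` U) \<partial>P2)"
      using PP.AE_integrable_fst'[OF intZ] inner by (auto elim: eventually_mono)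
  qed
  also have "\<dots> = (\<integral>p. Max ((\<lambda>u. Z u p) ` U) \<partial>(P1 \<Otimes>\<^sub>M P2))"
    using PP.integral_fst'[OF intZ] .
  finally show ?thesis using compare unfolding P1_def by simp
qed

section \<open>Construction of the majorizing measure\<close>

lemma sqrt_log_inv_antimono:
  assumes "0 \<le> p" "p \<le> q" "q \<le> 1"
  shows "sqrt_log_inv q \<le> sqrt_log_inv p"
proof (cases "p = 0")
  case False
  with assms have "p > 0" "q > 0" by auto
  then have "ln (1 / q) \<le> ln (1 / p)" using assms by (simp add: ln_div)
  then show ?thesis using \<open>p > 0\<close> \<open>q > 0\<close> by (simp add: sqrt_log_inv_def ennreal_leI)
qed (simp add: sqrt_log_inv_def)

text \<open>The square root of the logarithm is subadditive on products. It separates the cost of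
  choosing a piece from the cost of the measure inside the piece.\<close>

lemma sqrt_log_inv_mult_le:
  assumes "0 < p" "p \<le> 1" "0 \<le> q" "q \<le> 1"
  shows "sqrt_log_inv (p * q) \<le> sqrt_log_inv p + sqrt_log_inv q"
proof (cases "q = 0")
  case False
  with assms have q: "q > 0" by simp
  have "ln (1 / (p * q)) = ln (1 / p) + ln (1 / q)"
    using assms q by (simp add: ln_div ln_mult)
  moreover have "0 \<le> ln (1 / p)" "0 \<le> ln (1 / q)" using assms q by simp_all
  ultimately have "sqrt (ln (1 / (p * q))) \<le> sqrt (ln (1 / p)) + sqrt (ln (1 / q))"
    using sqrt_add_le_add_sqrt by simp
  moreover have "0 \<le> sqrt (ln (1 / p))" "0 \<le> sqrt (ln (1 / q))" using assms q by simp_all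
  ultimately show ?thesis
    using assms q by (simp add: sqrt_log_inv_def ennreal_plus[symmetric] ennreal_leI del: ennreal_plus)
qed (use assms in \<open>simp add: sqrt_log_inv_def\<close>)

lemma measurable_sqrt_log_inv[measurable]: "sqrt_log_inv \<in> borel_measurable borel"
  unfolding sqrt_log_inv_def[abs_def] by measurable

text \<open>The terms telescope as \<open>1 / (i + 1) - 1 / (i + 2)\<close>, hence these weights for
  the pieces never exceed total mass 1.\<close>

lemma sum_inverse_consecutive_le_1:
  assumes "finite (I :: nat set)"
  shows "(\<Sum>i\<in>I. 1 / (real (Suc i) * real (i + 2))) \<le> 1"
proof -
  obtain n where n: "I \<subseteq> {..<n}" using assms finite_nat_iff_bounded by blast
  have eq: "(\<Sum>i<n. 1 / (real (Suc i) * real (i + 2))) = 1 - 1 / real (Suc n)"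
  proof (induction n)
    case (Suc n)
    have "1 / (real (Suc n) * real (n + 2)) = 1 / real (Suc n) - 1 / real (Suc (Suc n))"
      by (simp add: field_simps)
    with Suc show ?case by simp
  qed simp
  have "(\<Sum>i\<in>I. 1 / (real (Suc i) * real (i + 2))) \<le> (\<Sum>i<n. 1 / (real (Suc i) * real (i + 2)))"
    by (rule sum_mono2) (use n in auto)
  also have "\<dots> \<le> 1" unfolding eq by simp
  finally show ?thesis .
qed

text \<open>The construction needs only a pseudometric and a monotone functional, so probability is
  abstracted away. For Gaussian processes \<open>F\<close> is the expected supremum and
  \<open>G m\<close> the expected maximum of \<open>m\<close> standard normals. Assumption
  \<open>G_ge\<close> is fitted to the weights: with \<open>m = i + 1\<close>, its left side is the
  entropy cost of the mass \<open>1 / ((i + 1) * (i + 2))\<close>.\<close>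

locale growth_functional =
  fixes T :: "'i set" and d :: "'i \<Rightarrow> 'i \<Rightarrow> real" and F :: "'i set \<Rightarrow> real" and G :: "nat \<Rightarrow> real" and c1 c2 :: real
  assumes finite_T: "finite T"
    and d_nonneg: "\<And>x y. 0 \<le> d x y" and d_refl: "\<And>x. d x x = 0" and d_sym: "\<And>x y. d x y = d y x"
    and d_triangle: "\<And>x y z. x \<in> T \<Longrightarrow> y \<in> T \<Longrightarrow> z \<in> T \<Longrightarrow> d x z \<le> d x y + d y z"
    and F_nonneg: "\<And>A. A \<subseteq> T \<Longrightarrow> A \<noteq> {} \<Longrightarrow> 0 \<le> F A"
    and F_mono: "\<And>A B. A \<subseteq> B \<Longrightarrow> B \<subseteq> T \<Longrightarrow> A \<noteq> {} \<Longrightarrow> F A \<le> F B"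
    and growth: "\<And>U m s idx c v. U \<subseteq> T \<Longrightarrow> 0 < m \<Longrightarrow> 0 \<le> s \<Longrightarrow>
        (\<And>u. u \<in> U \<Longrightarrow> idx u < m) \<Longrightarrow> (\<And>i. i < m \<Longrightarrow> c i \<in> T) \<Longrightarrow>
        (\<And>i. i < m \<Longrightarrow> {u \<in> U. idx u = i} \<noteq> {}) \<Longrightarrow>
        (\<And>u. u \<in> U \<Longrightarrow> d u (c (idx u)) \<le> s / 4) \<Longrightarrow>
        (\<And>u v. u \<in> U \<Longrightarrow> v \<in> U \<Longrightarrow> idx u \<noteq> idx v \<Longrightarrow> s / 2 \<le> d u v) \<Longrightarrow>
        (\<And>i. i < m \<Longrightarrow> v \<le> F {u \<in> U. idx u = i}) \<Longrightarrow> v + s / 4 * G m \<le> F U"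
    and c_nonneg: "0 \<le> c1" "0 \<le> c2"
    and G_ge: "\<And>m. 0 < m \<Longrightarrow> sqrt (ln (real m * real (m + 1))) \<le> c1 * G m + c2"
begin

definition local_sup :: "'i set \<Rightarrow> real \<Rightarrow> 'i \<Rightarrow> real" where
  "local_sup A r x = F {y \<in> A. d x y \<le> r}"

text \<open>Each centre maximizes \<open>local_sup\<close> over the points still present. For a
  point in piece \<open>k\<close>, its local supremum is therefore at most that of centre
  \<open>k\<close>, which is at most those of all earlier centres. The \<open>k + 1\<close> small
  balls around these centres are separated, and the growth condition then yields the gain
  \<open>G (k + 1)\<close>.\<close>

lemma greedy_partition:
  assumes A: "A \<subseteq> T" and s: "0 < s"
  obtains ind :: "'i \<Rightarrow> nat" where
    "\<And>x. x \<in> A \<Longrightarrow> \<exists>t\<in>A. \<forall>y\<in>A. ind y = ind x \<longrightarrow> d t y \<le> s"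
    "\<And>x. x \<in> A \<Longrightarrow> local_sup {y \<in> A. ind y = ind x} (s / 4) x + s / 4 * G (Suc (ind x)) \<le> F A"
proof -
  have fA: "finite A" using A finite_T finite_subset by blast
  define ctr where "ctr B = (SOME t. t \<in> B \<and> (\<forall>y\<in>B. local_sup B (s / 4) y \<le> local_sup B (s / 4) t))" for B
  define rem where "rem = rec_nat A (\<lambda>_ B. {x \<in> B. s < d (ctr B) x})"
  have rem_0: "rem 0 = A" and rem_Suc: "rem (Suc i) = {x \<in> rem i. s < d (ctr (rem i)) x}" for i
    by (simp_all add: rem_def)
  have rem_anti: "rem j \<subseteq> rem i" if "i \<le> j" for i j
    using that by (induction rule: dec_induct) (auto simp: rem_Suc)
  have rem_A: "rem i \<subseteq> A" for i using rem_anti[of 0 i] rem_0 by simp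
  have fin: "finite (rem i)" for i using rem_A fA finite_subset by blast
  have ctr: "ctr (rem i) \<in> rem i" "\<And>y. y \<in> rem i \<Longrightarrow> local_sup (rem i) (s / 4) y \<le> local_sup (rem i) (s / 4) (ctr (rem i))"
    if "rem i \<noteq> {}" for i
  proof -
    have "\<exists>t. t \<in> rem i \<and> (\<forall>y\<in>rem i. local_sup (rem i) (s / 4) y \<le> local_sup (rem i) (s / 4) t)"
    proof -
      have "Max (local_sup (rem i) (s / 4) ` rem i) \<in> local_sup (rem i) (s / 4) ` rem i"
        using fin that by (intro Max_in) auto
      then obtain t where t: "t \<in> rem i" "Max (local_sup (rem i) (s / 4) ` rem i) = local_sup (rem i) (s / 4) t"
        by auto
      then show ?thesis using fin[of i] by (metis Max_ge finite_imageI imageI)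
    qed
    from someI_ex[OF this] show "ctr (rem i) \<in> rem i"
      "\<And>y. y \<in> rem i \<Longrightarrow> local_sup (rem i) (s / 4) y \<le> local_sup (rem i) (s / 4) (ctr (rem i))"
      unfolding ctr_def[symmetric] by auto
  qed
  have card_rem: "card (rem i) \<le> card A - i" for i
  proof (induction i)
    case (Suc i)
    show ?case
    proof (cases "rem i = {}")
      case False
      have "ctr (rem i) \<notin> rem (Suc i)" using s by (simp add: rem_Suc d_refl)
      then have "rem (Suc i) \<subset> rem i" using rem_anti[of i "Suc i"] ctr(1)[OF False] by auto
      then have "card (rem (Suc i)) < card (rem i)" using fin by (intro psubset_card_mono)
      then show ?thesis using Suc by simp
    qed (simp add: rem_Suc)
  qed (simp add: rem_0)
  then have "rem (card A) = {}" using fin[of "card A"] by (metis card_0_eq diff_self_eq_0 le_zero_eq)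
  \<comment> \<open>The round in which \<open>x\<close> is removed. Counting starts at 0, so piece
    \<open>k\<close> is preceded by \<open>k\<close> pieces and \<open>Suc k\<close> balls are
    available.\<close>
  define ind where "ind x = (LEAST k. x \<notin> rem (Suc k))" for x
  have ind_ex: "\<exists>k. x \<notin> rem (Suc k)" for x
    using \<open>rem (card A) = {}\<close> rem_anti[of "card A" "Suc (card A)"] by auto
  have ind: "x \<in> rem (ind x)" "x \<notin> rem (Suc (ind x))" if "x \<in> A" for x
  proof -
    show "x \<notin> rem (Suc (ind x))" unfolding ind_def by (rule LeastI_ex[OF ind_ex])
    show "x \<in> rem (ind x)"
    proof (cases "ind x")
      case 0
      then show ?thesis using that rem_0 by simp
    next
      case (Suc k)
      then have "k < (LEAST k. x \<notin> rem (Suc k))" unfolding ind_def by simp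
      from not_less_Least[OF this] show ?thesis using Suc by simp
    qed
  qed
  have ind_eqI: "ind x = k" if "x \<in> rem k" "x \<notin> rem (Suc k)" for x k
    unfolding ind_def
  proof (rule Least_equality[of "\<lambda>k. x \<notin> rem (Suc k)", OF that(2)])
    fix j assume "x \<notin> rem (Suc j)"
    then show "k \<le> j" using that(1) rem_anti[of "Suc j" k] by (meson not_less_eq_eq subsetD)
  qed
  show thesis
  proof (rule that[of ind])
    fix x assume x: "x \<in> A"
    define k where "k = ind x"
    have ne: "rem i \<noteq> {}" if "i \<le> k" for i
      using ind(1)[OF x] rem_anti[OF that] by (auto simp: k_def)
    have near: "d (ctr (rem k)) y \<le> s" if "y \<in> A" "ind y = k" for y
      using ind[OF that(1)] that(2) by (auto simp: rem_Suc not_less)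
    show "\<exists>t\<in>A. \<forall>y\<in>A. ind y = ind x \<longrightarrow> d t y \<le> s"
      using near ctr(1)[OF ne[of k]] rem_A by (intro bexI[of _ "ctr (rem k)"]) (auto simp: k_def)
    \<comment> \<open>Centres of different rounds are more than \<open>s\<close> apart, hence points
      of different balls of radius \<open>s / 4\<close> around them are at least
      \<open>s / 2\<close> apart.\<close>
    define H where "H i = {y \<in> rem i. d (ctr (rem i)) y \<le> s / 4}" for i
    define U where "U = (\<Union>i\<le>k. H i)"
    have ctr_A: "ctr (rem i) \<in> A" if "i \<le> k" for i using ctr(1)[OF ne[OF that]] rem_A by blast
    have UA: "U \<subseteq> A" using rem_A by (auto simp: U_def H_def)
    have ind_H: "ind y = i" if "y \<in> H i" for y i
      using that s by (intro ind_eqI) (auto simp: H_def rem_Suc)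
    have block: "{u \<in> U. ind u = i} = H i" if "i \<le> k" for i
      using ind_H that by (auto simp: U_def)
    have H_ne: "H i \<noteq> {}" if "i \<le> k" for i
      using ctr(1)[OF ne[OF that]] s by (auto simp: H_def d_refl)
    have F_H: "F (H k) \<le> F (H i)" if i: "i \<le> k" for i
    proof -
      have "F (H k) \<le> local_sup (rem i) (s / 4) (ctr (rem k))"
        unfolding local_sup_def using rem_anti[OF i] H_ne[of k] rem_A A
        by (intro F_mono) (auto simp: H_def)
      also have "\<dots> \<le> local_sup (rem i) (s / 4) (ctr (rem i))"
        using ctr(1)[OF ne[of k]] rem_anti[OF i] by (intro ctr(2)[OF ne[OF i]]) auto
      finally show ?thesis by (simp add: local_sup_def H_def)
    qed
    have far: "s / 2 \<le> d u v" if "i < j" "j \<le> k" "u \<in> H i" "v \<in> H j" for i j u v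
    proof -
      have mem: "u \<in> T" "v \<in> T" "ctr (rem i) \<in> T" "ctr (rem j) \<in> T"
        using that rem_A A ctr_A[of i] ctr_A[of j] by (auto simp: H_def)
      have "ctr (rem j) \<in> rem (Suc i)" using ctr(1)[OF ne[OF that(2)]] rem_anti[of "Suc i" j] that(1) by auto
      then have "s < d (ctr (rem i)) (ctr (rem j))" by (simp add: rem_Suc)
      also have "\<dots> \<le> d (ctr (rem i)) u + d u (ctr (rem j))" using mem by (intro d_triangle)
      also have "\<dots> \<le> d (ctr (rem i)) u + (d u v + d v (ctr (rem j)))"
        using mem by (intro add_left_mono d_triangle)
      also have "\<dots> \<le> s / 4 + (d u v + s / 4)"
        using that d_sym[of v "ctr (rem j)"] by (intro add_mono) (auto simp: H_def)
      finally show ?thesis by simp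
    qed
    have "F (H k) + s / 4 * G (Suc k) \<le> F U"
    proof (rule growth[where idx = ind and c = "\<lambda>i. ctr (rem i)"])
      show "U \<subseteq> T" using UA A by blast
      show "0 < Suc k" "0 \<le> s" using s by auto
      show "ind u < Suc k" if "u \<in> U" for u using that ind_H by (auto simp: U_def)
      show "ctr (rem i) \<in> T" if "i < Suc k" for i using ctr_A[of i] A that by auto
      show "{u \<in> U. ind u = i} \<noteq> {}" if "i < Suc k" for i using that block[of i] H_ne[of i] by simp
      show "d u (ctr (rem (ind u))) \<le> s / 4" if "u \<in> U" for u
        using that ind_H d_sym[of u] by (auto simp: U_def H_def)
      show "s / 2 \<le> d u v" if "u \<in> U" "v \<in> U" "ind u \<noteq> ind v" for u v
      proof -
        have "u \<in> H (ind u)" "v \<in> H (ind v)" "ind u \<le> k" "ind v \<le> k"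
          using that ind_H by (auto simp: U_def)
        then show ?thesis using far[of "ind u" "ind v" u v] far[of "ind v" "ind u" v u] that(3) d_sym[of u v]
          by (cases "ind u < ind v") auto
      qed
      show "F (H k) \<le> F {u \<in> U. ind u = i}" if "i < Suc k" for i using that block[of i] F_H[of i] by simp
    qed
    also have "F U \<le> F A" using UA A H_ne[of k] by (intro F_mono) (auto simp: U_def)
    finally have "F (H k) + s / 4 * G (Suc k) \<le> F A" .
    moreover have "local_sup {y \<in> A. ind y = ind x} (s / 4) x \<le> F (H k)"
    proof -
      have "local_sup {y \<in> A. ind y = ind x} (s / 4) x \<le> local_sup (rem k) (s / 4) x"
        unfolding local_sup_def
      proof (rule F_mono)
        show "{y \<in> {y \<in> A. ind y = ind x}. d x y \<le> s / 4} \<subseteq> {y \<in> rem k. d x y \<le> s / 4}"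
          using ind(1) by (force simp: k_def)
        show "{y \<in> rem k. d x y \<le> s / 4} \<subseteq> T" using rem_A A by auto
        show "{y \<in> {y \<in> A. ind y = ind x}. d x y \<le> s / 4} \<noteq> {}" using x s by (auto simp: d_refl)
      qed
      also have "\<dots> \<le> F (H k)"
        using ctr(2)[OF ne[of k], of x] ind(1)[OF x] by (simp add: local_sup_def H_def k_def)
      finally show ?thesis .
    qed
    ultimately show "local_sup {y \<in> A. ind y = ind x} (s / 4) x + s / 4 * G (Suc (ind x)) \<le> F A"
      by (simp add: k_def)
  qed
qed

text \<open>Plain weight functions are used during the construction because measures of the pieces
  are rescaled and glued; only the final one becomes a \<open>pmf\<close>.\<close>

definition ball_mass :: "('i \<Rightarrow> real) \<Rightarrow> 'i \<Rightarrow> real \<Rightarrow> real" where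
  "ball_mass \<mu> x \<epsilon> = (\<Sum>y\<in>{y \<in> T. d x y \<le> \<epsilon>}. \<mu> y)"

definition entropy_integral :: "('i \<Rightarrow> real) \<Rightarrow> 'i \<Rightarrow> real \<Rightarrow> ennreal" where
  "entropy_integral \<mu> x a = (\<integral>\<^sup>+ \<epsilon> \<in> {0..a}. sqrt_log_inv (ball_mass \<mu> x \<epsilon>) \<partial>lborel)"

lemma borel_measurable_ball_mass[measurable]: "ball_mass \<mu> x \<in> borel_measurable borel"
proof -
  have "ball_mass \<mu> x = (\<lambda>\<epsilon>. \<Sum>y\<in>T. \<mu> y * indicator {d x y..} \<epsilon>)"
    unfolding ball_mass_def using finite_T
    by (auto simp: fun_eq_iff indicator_def sum.If_cases if_distrib Int_def cong: if_cong intro!: sum.cong)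
  also have "\<dots> \<in> borel_measurable borel" by measurable
  finally show ?thesis .
qed

lemma ball_mass_le_1:
  assumes "\<And>y. 0 \<le> \<mu> y" "(\<Sum>y\<in>T. \<mu> y) \<le> 1"
  shows "ball_mass \<mu> x \<epsilon> \<le> 1"
proof -
  have "ball_mass \<mu> x \<epsilon> \<le> (\<Sum>y\<in>T. \<mu> y)"
    unfolding ball_mass_def by (rule sum_mono2) (use finite_T assms in auto)
  then show ?thesis using assms by simp
qed

text \<open>The second term of the potential looks one scale ahead: a piece around \<open>t\<close> is contained in
  a ball of radius \<open>a / 4\<close>, so its supremum is paid for by \<open>local_sup A (a / 4)\<close>, while the
  growth condition controls the local suprema inside the piece.\<close>

definition potential :: "'i set \<Rightarrow> real \<Rightarrow> real" where
  "potential A a = F A + Max (local_sup A (a / 4) ` A)"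

lemma potential_piece_le:
  assumes A: "A \<subseteq> T" and a: "0 < a" and x: "x \<in> A"
    and cover: "\<exists>t\<in>A. \<forall>y\<in>A. ind y = ind x \<longrightarrow> d t y \<le> a / 4"
    and gr: "\<And>y. y \<in> A \<Longrightarrow> local_sup {z \<in> A. ind z = ind y} (a / 4 / 4) y + a / 4 / 4 * G (Suc (ind y)) \<le> F A"
  shows "potential {y \<in> A. ind y = ind x} (a / 4) + a / 16 * G (Suc (ind x)) \<le> potential A a"
proof -
  let ?P = "{y \<in> A. ind y = ind x}"
  have fA: "finite A" using A finite_T finite_subset by blast
  obtain t where t: "t \<in> A" "\<And>y. y \<in> ?P \<Longrightarrow> d t y \<le> a / 4" using cover by auto
  have "F ?P \<le> local_sup A (a / 4) t"
    unfolding local_sup_def using t x A by (intro F_mono) auto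
  also have "\<dots> \<le> Max (local_sup A (a / 4) ` A)" using fA t(1) by simp
  finally have 1: "F ?P \<le> Max (local_sup A (a / 4) ` A)" .
  have "Max (local_sup ?P (a / 4 / 4) ` ?P) \<in> local_sup ?P (a / 4 / 4) ` ?P"
    using fA x by (intro Max_in) auto
  then obtain y where y: "y \<in> ?P" "Max (local_sup ?P (a / 4 / 4) ` ?P) = local_sup ?P (a / 4 / 4) y" by blast
  have "local_sup ?P (a / 4 / 4) y + a / 16 * G (Suc (ind x)) \<le> F A"
    using gr[of y] y(1) by simp
  with 1 y(2) show ?thesis unfolding potential_def by simp
qed

text \<open>The measures of the pieces are glued with the weights \<open>w\<close>. At radii of at
  least \<open>a / 2\<close> a ball around \<open>x\<close> contains the whole piece of
  \<open>x\<close>, so only the weight of the piece is paid; the measure inside the piece matters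
  below \<open>a / 2\<close> alone.\<close>

lemma majorizing_measure_step:
  assumes A: "A \<subseteq> T" "A \<noteq> {}" and a: "0 < a"
    and cover: "\<And>x. x \<in> A \<Longrightarrow> \<exists>t\<in>A. \<forall>y\<in>A. ind y = ind x \<longrightarrow> d t y \<le> a / 4"
    and \<mu>: "\<And>k y. k \<in> ind ` A \<Longrightarrow> 0 \<le> \<mu> k y" "\<And>k y. k \<in> ind ` A \<Longrightarrow> y \<notin> {y \<in> A. ind y = k} \<Longrightarrow> \<mu> k y = 0"
      "\<And>k. k \<in> ind ` A \<Longrightarrow> (\<Sum>y\<in>T. \<mu> k y) = 1"
  obtains \<nu> where "\<And>y. 0 \<le> \<nu> y" "\<And>y. y \<notin> A \<Longrightarrow> \<nu> y = 0" "(\<Sum>y\<in>T. \<nu> y) = 1"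
    "\<And>x. x \<in> A \<Longrightarrow> entropy_integral \<nu> x (2 * a) \<le>
       ennreal (2 * a * sqrt (ln (real (Suc (ind x)) * real (ind x + 2)))) + entropy_integral (\<mu> (ind x)) x (a / 2)"
proof -
  have fA: "finite A" using A finite_T finite_subset by blast
  obtain p where p: "p \<in> A" using A by blast
  define w where "w i = 1 / (real (Suc i) * real (i + 2))" for i
  have w: "0 < w i" "w i \<le> 1" for i
  proof -
    show "0 < w i" by (simp add: w_def)
    have "1 * 1 \<le> real (Suc i) * real (i + 2)" by (intro mult_mono) auto
    then show "w i \<le> 1" by (simp add: w_def)
  qed
  define \<nu>0 where "\<nu>0 y = (if y \<in> A then w (ind y) * \<mu> (ind y) y else 0)" for y
  have \<nu>0_nonneg: "0 \<le> \<nu>0 y" for y using \<mu>(1) w(1)[of "ind y"] by (simp add: \<nu>0_def)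
  have "(\<Sum>y\<in>T. \<nu>0 y) = (\<Sum>y\<in>A. \<nu>0 y)"
    using A finite_T by (intro sum.mono_neutral_right) (auto simp: \<nu>0_def)
  also have "\<dots> = (\<Sum>k\<in>ind ` A. \<Sum>y\<in>{y \<in> A. ind y = k}. \<nu>0 y)"
    by (rule sum.group[symmetric]) (use fA in auto)
  also have "\<dots> = (\<Sum>k\<in>ind ` A. w k)"
  proof (intro sum.cong refl)
    fix k assume k: "k \<in> ind ` A"
    have "(\<Sum>y\<in>{y \<in> A. ind y = k}. \<nu>0 y) = (\<Sum>y\<in>{y \<in> A. ind y = k}. w k * \<mu> k y)"
      by (intro sum.cong) (auto simp: \<nu>0_def)
    also have "\<dots> = w k * (\<Sum>y\<in>{y \<in> A. ind y = k}. \<mu> k y)" by (simp add: sum_distrib_left)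
    also have "(\<Sum>y\<in>{y \<in> A. ind y = k}. \<mu> k y) = (\<Sum>y\<in>T. \<mu> k y)"
      using A finite_T \<mu>(2)[OF k] by (intro sum.mono_neutral_left) auto
    finally show "(\<Sum>y\<in>{y \<in> A. ind y = k}. \<nu>0 y) = w k" using \<mu>(3)[OF k] by simp
  qed
  also have "\<dots> \<le> 1" unfolding w_def by (rule sum_inverse_consecutive_le_1) (use fA in auto)
  finally have le1: "(\<Sum>y\<in>T. \<nu>0 y) \<le> 1" .
  \<comment> \<open>The weights may sum to less than 1. Placing the missing mass at an arbitrary
    point of \<open>A\<close> only increases the masses of balls.\<close>
  define \<nu> where "\<nu> y = \<nu>0 y + (if y = p then 1 - (\<Sum>y\<in>T. \<nu>0 y) else 0)" for y
  have pT: "p \<in> T" using p A by blast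
  have \<nu>_nonneg: "0 \<le> \<nu> y" for y using \<nu>0_nonneg le1 by (simp add: \<nu>_def)
  have \<nu>_sum: "(\<Sum>y\<in>T. \<nu> y) = 1" using finite_T pT by (simp add: \<nu>_def sum.distrib)
  have \<nu>_supp: "\<nu> y = 0" if "y \<notin> A" for y using that p by (auto simp: \<nu>_def \<nu>0_def)
  have \<nu>_ge: "w k * \<mu> k y \<le> \<nu> y" if "k \<in> ind ` A" for k y
  proof (cases "y \<in> A \<and> ind y = k")
    case True
    then show ?thesis using le1 by (auto simp: \<nu>_def \<nu>0_def)
  next
    case False
    then have "\<mu> k y = 0" using \<mu>(2)[OF that] by auto
    then show ?thesis using \<nu>_nonneg by simp
  qed
  show thesis
  proof (rule that[of \<nu>])
    fix x assume x: "x \<in> A"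
    define k where "k = ind x"
    have k: "k \<in> ind ` A" using x by (simp add: k_def)
    define l where "l = sqrt (ln (real (Suc k) * real (k + 2)))"
    have "1 * 1 \<le> real (Suc k) * real (k + 2)" by (intro mult_mono) auto
    then have l: "0 \<le> l" by (simp add: l_def)
    have sli_w: "sqrt_log_inv (w k) = ennreal l"
      using w(1)[of k] by (simp add: sqrt_log_inv_def l_def w_def)
    have mass: "w k * ball_mass (\<mu> k) x \<epsilon> \<le> ball_mass \<nu> x \<epsilon>" for \<epsilon>
      unfolding ball_mass_def sum_distrib_left using \<nu>_ge[OF k] by (intro sum_mono) auto
    have b0: "0 \<le> ball_mass (\<mu> k) x \<epsilon>" for \<epsilon>
      unfolding ball_mass_def using \<mu>(1)[OF k] by (intro sum_nonneg) auto
    have b1: "ball_mass (\<mu> k) x \<epsilon> \<le> 1" for \<epsilon>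
      using \<mu>(1,3)[OF k] by (intro ball_mass_le_1) auto
    have \<nu>1: "ball_mass \<nu> x \<epsilon> \<le> 1" for \<epsilon>
      using \<nu>_nonneg \<nu>_sum by (intro ball_mass_le_1) auto
    have small: "sqrt_log_inv (ball_mass \<nu> x \<epsilon>) \<le> ennreal l + sqrt_log_inv (ball_mass (\<mu> k) x \<epsilon>)" for \<epsilon>
    proof -
      have "sqrt_log_inv (ball_mass \<nu> x \<epsilon>) \<le> sqrt_log_inv (w k * ball_mass (\<mu> k) x \<epsilon>)"
        using mass b0 w(1)[of k] \<nu>1 by (intro sqrt_log_inv_antimono) (auto intro: mult_nonneg_nonneg)
      also have "\<dots> \<le> ennreal l + sqrt_log_inv (ball_mass (\<mu> k) x \<epsilon>)"
        unfolding sli_w[symmetric] using w[of k] b0 b1 by (intro sqrt_log_inv_mult_le) auto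
      finally show ?thesis .
    qed
    obtain t where t: "t \<in> A" "\<And>y. y \<in> A \<Longrightarrow> ind y = k \<Longrightarrow> d t y \<le> a / 4"
      using cover[OF x] by (auto simp: k_def)
    have large: "sqrt_log_inv (ball_mass \<nu> x \<epsilon>) \<le> ennreal l" if "a / 2 \<le> \<epsilon>" for \<epsilon>
    proof -
      have "d x y \<le> \<epsilon>" if "y \<in> A" "ind y = k" for y
      proof -
        have "x \<in> T" "t \<in> T" "y \<in> T" using A x t(1) that by auto
        then have "d x y \<le> d x t + d t y" by (rule d_triangle)
        then show ?thesis
          using t(2)[OF that] t(2)[OF x] d_sym[of x t] \<open>a / 2 \<le> \<epsilon>\<close> by (simp add: k_def)
      qed
      then have "ball_mass (\<mu> k) x \<epsilon> = (\<Sum>y\<in>T. \<mu> k y)"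
        unfolding ball_mass_def using finite_T A \<mu>(2)[OF k] by (intro sum.mono_neutral_left) auto
      then show ?thesis
        using \<mu>(3)[OF k] small[of \<epsilon>] by (simp add: sqrt_log_inv_def)
    qed
    have "entropy_integral \<nu> x (2 * a) \<le> (\<integral>\<^sup>+ \<epsilon>. ennreal l * indicator {0..2 * a} \<epsilon>
        + sqrt_log_inv (ball_mass (\<mu> k) x \<epsilon>) * indicator {0..a / 2} \<epsilon> \<partial>lborel)"
      unfolding entropy_integral_def using small large a
      by (intro nn_integral_mono) (auto split: split_indicator)
    also have "\<dots> = (\<integral>\<^sup>+ \<epsilon>. ennreal l * indicator {0..2 * a} \<epsilon> \<partial>lborel) + entropy_integral (\<mu> k) x (a / 2)"
      unfolding entropy_integral_def by (rule nn_integral_add) auto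
    also have "(\<integral>\<^sup>+ \<epsilon>. ennreal l * indicator {0..2 * a} \<epsilon> \<partial>lborel) = ennreal (2 * a * l)"
      using a l by (simp add: nn_integral_cmult_indicator ennreal_mult[symmetric] mult.commute)
    finally show "entropy_integral \<nu> x (2 * a) \<le>
       ennreal (2 * a * sqrt (ln (real (Suc (ind x)) * real (ind x + 2)))) + entropy_integral (\<mu> (ind x)) x (a / 2)"
      unfolding l_def k_def .
  qed (use \<nu>_nonneg \<nu>_sum \<nu>_supp in auto)
qed

text \<open>The number \<open>n\<close> counts the divisions of the radius by 4 until it lies below
  \<open>\<delta>\<close>. Then all points of \<open>A\<close> are at mutual distance 0 and a point
  mass has entropy 0. The upper limit \<open>2 * a\<close> is a bound for the diameter of
  \<open>A\<close>, and for a piece it becomes \<open>a / 2\<close>, as in the gluing step.\<close>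

lemma majorizing_measure_induct:
  assumes sep: "\<And>x y. x \<in> T \<Longrightarrow> y \<in> T \<Longrightarrow> d x y \<le> 2 * \<delta> \<Longrightarrow> d x y = 0"
    and "A \<subseteq> T" "A \<noteq> {}" "0 < a" "a \<le> 4 ^ n * \<delta>" "\<exists>t\<in>T. \<forall>x\<in>A. d t x \<le> a"
  shows "\<exists>\<mu>. (\<forall>y. 0 \<le> \<mu> y) \<and> (\<forall>y. y \<notin> A \<longrightarrow> \<mu> y = 0) \<and> (\<Sum>y\<in>T. \<mu> y) = 1 \<and>
    (\<forall>x\<in>A. entropy_integral \<mu> x (2 * a) \<le> ennreal (3 * c2 * a + 32 * c1 * potential A a))"
  using assms(2-)
proof (induction n arbitrary: A a)
  case 0
  obtain p where p: "p \<in> A" using 0 by blast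
  obtain t where t: "t \<in> T" "\<And>x. x \<in> A \<Longrightarrow> d t x \<le> a" using 0 by auto
  have zero: "d x p = 0" if "x \<in> A" for x
  proof (rule sep)
    show "x \<in> T" "p \<in> T" using that p 0 by auto
    then have "d x p \<le> d x t + d t p" using t(1) by (intro d_triangle)
    then show "d x p \<le> 2 * \<delta>" using t(2)[OF that] t(2)[OF p] d_sym[of x t] 0 by simp
  qed
  let ?\<mu> = "\<lambda>y. if y = p then 1 else 0 :: real"
  have pT: "p \<in> T" using p 0 by blast
  have mass: "ball_mass ?\<mu> x \<epsilon> = 1" if "x \<in> A" "0 \<le> \<epsilon>" for x \<epsilon>
    using zero[OF that(1)] that(2) finite_T pT by (simp add: ball_mass_def)
  have "entropy_integral ?\<mu> x (2 * a) = 0" if "x \<in> A" for x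
  proof -
    have "entropy_integral ?\<mu> x (2 * a) = (\<integral>\<^sup>+ (\<epsilon>::real). 0 \<partial>lborel)"
      unfolding entropy_integral_def using mass[OF that]
      by (intro nn_integral_cong) (auto simp: sqrt_log_inv_def split: split_indicator)
    then show ?thesis by simp
  qed
  then show ?case using p pT finite_T by (intro exI[of _ ?\<mu>]) auto
next
  case (Suc n)
  have a4: "0 < a / 4" using Suc.prems by simp
  obtain ind where ind: "\<And>x. x \<in> A \<Longrightarrow> \<exists>t\<in>A. \<forall>y\<in>A. ind y = ind x \<longrightarrow> d t y \<le> a / 4"
    "\<And>x. x \<in> A \<Longrightarrow> local_sup {y \<in> A. ind y = ind x} (a / 4 / 4) x + a / 4 / 4 * G (Suc (ind x)) \<le> F A"
    by (rule greedy_partition[OF Suc.prems(1) a4]) (rule that)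
  define P where "P k = {y \<in> A. ind y = k}" for k
  define good where "good k \<mu> \<longleftrightarrow> (\<forall>y. 0 \<le> \<mu> y) \<and> (\<forall>y. y \<notin> P k \<longrightarrow> \<mu> y = 0) \<and> (\<Sum>y\<in>T. \<mu> y) = 1 \<and>
    (\<forall>x\<in>P k. entropy_integral \<mu> x (2 * (a / 4)) \<le> ennreal (3 * c2 * (a / 4) + 32 * c1 * potential (P k) (a / 4)))"
    for k \<mu>
  have "\<exists>\<mu>. good k \<mu>" if k: "k \<in> ind ` A" for k
    unfolding good_def
  proof (rule Suc.IH)
    obtain x where x: "x \<in> A" "k = ind x" using k by auto
    show "P k \<subseteq> T" "P k \<noteq> {}" "0 < a / 4" using Suc.prems x by (auto simp: P_def)
    show "a / 4 \<le> 4 ^ n * \<delta>" using Suc.prems by simp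
    show "\<exists>t\<in>T. \<forall>x\<in>P k. d t x \<le> a / 4"
      using ind(1)[OF x(1)] Suc.prems(1) by (auto simp: P_def x(2))
  qed
  then have "\<forall>k\<in>ind ` A. \<exists>\<mu>. good k \<mu>" by (rule ballI)
  from bchoice[OF this] obtain \<mu> where "\<forall>k\<in>ind ` A. good k (\<mu> k)" ..
  then have \<mu>: "\<And>k y. k \<in> ind ` A \<Longrightarrow> 0 \<le> \<mu> k y"
    "\<And>k y. k \<in> ind ` A \<Longrightarrow> y \<notin> P k \<Longrightarrow> \<mu> k y = 0" "\<And>k. k \<in> ind ` A \<Longrightarrow> (\<Sum>y\<in>T. \<mu> k y) = 1"
    "\<And>k x. k \<in> ind ` A \<Longrightarrow> x \<in> P k \<Longrightarrow> entropy_integral (\<mu> k) x (2 * (a / 4))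
      \<le> ennreal (3 * c2 * (a / 4) + 32 * c1 * potential (P k) (a / 4))"
    unfolding good_def by auto
  obtain \<nu> where \<nu>: "\<And>y. 0 \<le> \<nu> y" "\<And>y. y \<notin> A \<Longrightarrow> \<nu> y = 0" "(\<Sum>y\<in>T. \<nu> y) = 1"
    "\<And>x. x \<in> A \<Longrightarrow> entropy_integral \<nu> x (2 * a) \<le>
       ennreal (2 * a * sqrt (ln (real (Suc (ind x)) * real (ind x + 2)))) + entropy_integral (\<mu> (ind x)) x (a / 2)"
    by (rule majorizing_measure_step[OF Suc.prems(1-3) ind(1) \<mu>(1) \<mu>(2)[unfolded P_def] \<mu>(3)]) (assumption | rule that)+
  have "entropy_integral \<nu> x (2 * a) \<le> ennreal (3 * c2 * a + 32 * c1 * potential A a)" if x: "x \<in> A" for x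
  proof -
    define l where "l = sqrt (ln (real (Suc (ind x)) * real (ind x + 2)))"
    have "1 * 1 \<le> real (Suc (ind x)) * real (ind x + 2)" by (intro mult_mono) auto
    then have l0: "0 \<le> l" by (simp add: l_def)
    have l: "l \<le> c1 * G (Suc (ind x)) + c2" using G_ge[of "Suc (ind x)"] by (simp add: l_def)
    define b where "b = 3 * c2 * (a / 4) + 32 * c1 * potential (P (ind x)) (a / 4)"
    have pot: "potential (P (ind x)) (a / 4) + a / 16 * G (Suc (ind x)) \<le> potential A a"
      unfolding P_def by (rule potential_piece_le[OF Suc.prems(1,3) x ind(1)[OF x] ind(2)])
    have xP: "x \<in> P (ind x)" using x by (simp add: P_def)
    have PT: "P (ind x) \<subseteq> T" using Suc.prems(1) by (auto simp: P_def)
    have "0 \<le> F (P (ind x))" using PT xP by (intro F_nonneg) auto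
    moreover have "0 \<le> Max (local_sup (P (ind x)) (a / 4 / 4) ` P (ind x))"
    proof -
      have "0 \<le> local_sup (P (ind x)) (a / 4 / 4) x"
        unfolding local_sup_def using PT xP a4 by (intro F_nonneg) (auto simp: d_refl)
      also have "\<dots> \<le> Max (local_sup (P (ind x)) (a / 4 / 4) ` P (ind x))"
        using xP finite_subset[OF PT finite_T] by simp
      finally show ?thesis .
    qed
    ultimately have "0 \<le> b" using c_nonneg a4 by (simp add: b_def potential_def)
    have "entropy_integral \<nu> x (2 * a) \<le> ennreal (2 * a * l) + ennreal b"
      using \<nu>(4)[OF x] \<mu>(4)[of "ind x" x] xP x by (auto simp: l_def b_def intro: order_trans add_left_mono)
    also have "\<dots> = ennreal (2 * a * l + b)"
      using \<open>0 \<le> b\<close> l0 Suc.prems by (simp add: ennreal_plus)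
    also have "\<dots> \<le> ennreal (3 * c2 * a + 32 * c1 * potential A a)"
    \<comment> \<open>The term \<open>2 * a * c1 * G\<close> is exactly \<open>32 * c1\<close> times
      the drop \<open>a / 16 * G\<close> of the potential. The rest is \<open>2 * c2 * a\<close>
      plus the inherited \<open>3 / 4 * c2 * a\<close>, which is below
      \<open>3 * c2 * a\<close>.\<close>
    proof (rule ennreal_leI)
      have "2 * a * l \<le> 2 * a * (c1 * G (Suc (ind x)) + c2)"
        using l Suc.prems(3) by (intro mult_left_mono) auto
      moreover have "32 * c1 * (potential (P (ind x)) (a / 4) + a / 16 * G (Suc (ind x))) \<le> 32 * c1 * potential A a"
        using pot c_nonneg by (intro mult_left_mono) auto
      moreover have "0 \<le> c2 * a" using c_nonneg Suc.prems(3) by simp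
      ultimately show "2 * a * l + b \<le> 3 * c2 * a + 32 * c1 * potential A a"
        unfolding b_def by (simp add: algebra_simps)
    qed
    finally show ?thesis .
  qed
  then show ?case using \<nu>(1-3) by blast
qed

lemma majorizing_measure_exists:
  assumes T: "t \<in> T" and R: "0 < R" "\<And>x. x \<in> T \<Longrightarrow> d t x \<le> R"
  shows "\<exists>\<mu>. (\<forall>y. 0 \<le> \<mu> y) \<and> (\<Sum>y\<in>T. \<mu> y) = 1 \<and>
    (\<forall>x\<in>T. entropy_integral \<mu> x (2 * R) \<le> ennreal (3 * c2 * R + 64 * c1 * F T))"
proof -
  \<comment> \<open>The element 1 keeps the set nonempty when all distances vanish.\<close>
  define D where "D = insert 1 {d x y | x y. x \<in> T \<and> y \<in> T \<and> d x y \<noteq> 0}"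
  have D: "finite D"
  proof -
    have "D \<subseteq> insert 1 ((\<lambda>(x, y). d x y) ` (T \<times> T))" by (auto simp: D_def)
    then show ?thesis by (rule finite_subset) (use finite_T in auto)
  qed
  have "Min D \<in> D" using D by (intro Min_in) (auto simp: D_def)
  moreover have "e > 0" if "e \<in> D" for e
    using that d_nonneg by (auto simp: D_def order_less_le)
  ultimately have MinD: "Min D > 0" by blast
  define \<delta> where "\<delta> = Min D / 4"
  have sep: "d x y = 0" if "x \<in> T" "y \<in> T" "d x y \<le> 2 * \<delta>" for x y
  proof (rule ccontr)
    assume "d x y \<noteq> 0"
    then have "Min D \<le> d x y" using that D by (intro Min_le) (auto simp: D_def)
    then show False using that(3) MinD by (simp add: \<delta>_def)
  qed
  obtain n where n: "R / \<delta> < 4 ^ n" using real_arch_pow[of 4 "R / \<delta>"] by auto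
  then have n: "R \<le> 4 ^ n * \<delta>" using MinD by (simp add: \<delta>_def field_simps)
  obtain \<mu> where \<mu>: "\<And>y. 0 \<le> \<mu> y" "(\<Sum>y\<in>T. \<mu> y) = 1"
     "\<And>x. x \<in> T \<Longrightarrow> entropy_integral \<mu> x (2 * R) \<le> ennreal (3 * c2 * R + 32 * c1 * potential T R)"
    using majorizing_measure_induct[of \<delta> T R n, OF sep order_refl _ R(1) n] T R(2) by blast
  have "Max (local_sup T (R / 4) ` T) \<le> F T"
    using T finite_T R(1) unfolding local_sup_def
    by (intro Max.boundedI) (auto intro!: F_mono simp: d_refl intro: exI[of _ "_ :: 'i"])
  then have "32 * c1 * potential T R \<le> 32 * c1 * (2 * F T)"
    unfolding potential_def using c_nonneg by (intro mult_left_mono) auto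
  then have "ennreal (3 * c2 * R + 32 * c1 * potential T R) \<le> ennreal (3 * c2 * R + 64 * c1 * F T)"
    by (intro ennreal_leI) simp
  then show ?thesis using \<mu> by (meson order_trans)
qed

end

section \<open>The two bounds for an anchored Gaussian process\<close>

text \<open>Minkowski's inequality via Cauchy--Schwarz, the latter by expanding the square of
  \<open>\<beta> * f x - \<alpha> * g x\<close>; when a norm vanishes the product is almost
  everywhere 0. It supplies the triangle inequality for \<open>gp_dist\<close>.\<close>

lemma l2_triangle:
  fixes f g :: "'a \<Rightarrow> real"
  assumes [measurable]: "f \<in> borel_measurable M" "g \<in> borel_measurable M"
    and f: "integrable M (\<lambda>x. (f x)\<^sup>2)" and g: "integrable M (\<lambda>x. (g x)\<^sup>2)"
  shows "sqrt (\<integral>x. (f x + g x)\<^sup>2 \<partial>M) \<le> sqrt (\<integral>x. (f x)\<^sup>2 \<partial>M) + sqrt (\<integral>x. (g x)\<^sup>2 \<partial>M)"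
proof -
  define \<alpha> where "\<alpha> = sqrt (\<integral>x. (f x)\<^sup>2 \<partial>M)"
  define \<beta> where "\<beta> = sqrt (\<integral>x. (g x)\<^sup>2 \<partial>M)"
  have nonneg: "0 \<le> \<alpha>" "0 \<le> \<beta>" by (simp_all add: \<alpha>_def \<beta>_def)
  have sq: "\<alpha>\<^sup>2 = (\<integral>x. (f x)\<^sup>2 \<partial>M)" "\<beta>\<^sup>2 = (\<integral>x. (g x)\<^sup>2 \<partial>M)" by (simp_all add: \<alpha>_def \<beta>_def)
  have fg: "integrable M (\<lambda>x. f x * g x)"
  proof (rule Bochner_Integration.integrable_bound[OF Bochner_Integration.integrable_add[OF f g]])
    have "\<bar>a * b\<bar> \<le> a\<^sup>2 + b\<^sup>2" for a b :: real
      using sum_squares_bound[of "\<bar>a\<bar>" "\<bar>b\<bar>"] zero_le_power2[of a] zero_le_power2[of b]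
      unfolding abs_mult power2_abs by linarith
    then show "AE x in M. norm (f x * g x) \<le> norm ((f x)\<^sup>2 + (g x)\<^sup>2)" by simp
  qed measurable
  have cs: "(\<integral>x. f x * g x \<partial>M) \<le> \<alpha> * \<beta>"
  proof (cases "\<alpha> = 0 \<or> \<beta> = 0")
    case True
    then have "AE x in M. f x = 0 \<or> g x = 0"
    proof
      assume "\<alpha> = 0"
      then have "AE x in M. (f x)\<^sup>2 = 0"
        using integral_nonneg_eq_0_iff_AE[OF f] sq by simp
      then show ?thesis by eventually_elim simp
    next
      assume "\<beta> = 0"
      then have "AE x in M. (g x)\<^sup>2 = 0"
        using integral_nonneg_eq_0_iff_AE[OF g] sq by simp
      then show ?thesis by eventually_elim simp
    qed
    then have "(\<integral>x. f x * g x \<partial>M) = (\<integral>x. 0 \<partial>M)" by (intro integral_cong_AE) auto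
    then show ?thesis using nonneg by simp
  next
    case False
    then have pos: "0 < \<alpha> * \<beta>" using nonneg by simp
    have "(\<integral>x. 2 * (\<alpha> * \<beta>) * (f x * g x) \<partial>M) \<le> (\<integral>x. \<beta>\<^sup>2 * (f x)\<^sup>2 + \<alpha>\<^sup>2 * (g x)\<^sup>2 \<partial>M)"
    proof (rule integral_mono)
      fix x
      have "0 \<le> (\<beta> * f x - \<alpha> * g x)\<^sup>2" by simp
      then show "2 * (\<alpha> * \<beta>) * (f x * g x) \<le> \<beta>\<^sup>2 * (f x)\<^sup>2 + \<alpha>\<^sup>2 * (g x)\<^sup>2"
        by (simp add: power2_eq_square algebra_simps)
    qed (use f g fg in auto)
    also have "\<dots> = \<beta>\<^sup>2 * \<alpha>\<^sup>2 + \<alpha>\<^sup>2 * \<beta>\<^sup>2" using f g sq by simp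
    finally have "(\<alpha> * \<beta>) * (\<integral>x. f x * g x \<partial>M) \<le> (\<alpha> * \<beta>) * (\<alpha> * \<beta>)"
      by (simp only: integral_mult_right_zero) (simp add: power2_eq_square mult_ac)
    then show ?thesis using pos by (simp only: mult_le_cancel_left_pos)
  qed
  have "(\<integral>x. (f x + g x)\<^sup>2 \<partial>M) = (\<integral>x. (f x)\<^sup>2 + 2 * (f x * g x) + (g x)\<^sup>2 \<partial>M)"
    by (simp add: power2_eq_square algebra_simps)
  also have "\<dots> = \<alpha>\<^sup>2 + 2 * (\<integral>x. f x * g x \<partial>M) + \<beta>\<^sup>2" using f g fg sq by simp
  also have "\<dots> \<le> (\<alpha> + \<beta>)\<^sup>2" using cs by (simp add: power2_eq_square algebra_simps)
  finally have "sqrt (\<integral>x. (f x + g x)\<^sup>2 \<partial>M) \<le> \<alpha> + \<beta>"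
    using nonneg by (intro real_le_lsqrt) auto
  then show ?thesis by (simp add: \<alpha>_def \<beta>_def)
qed

text \<open>Only the excess over \<open>l = sqrt (ln a)\<close> needs a bound. It is at most
  \<open>exp ((u - l)\<^sup>2)\<close>, and for \<open>u \<ge> l \<ge> 0\<close> the square
  \<open>(u - l)\<^sup>2\<close> is at most \<open>u\<^sup>2 - l\<^sup>2\<close>.\<close>

lemma le_sqrt_ln_plus_exp_square:
  fixes u a :: real
  assumes "1 \<le> a" "0 \<le> u"
  shows "u \<le> sqrt (ln a) + exp (u\<^sup>2) / a"
proof (cases "u \<le> sqrt (ln a)")
  case True
  then show ?thesis using assms by (simp add: add_increasing2)
next
  case False
  define l where "l = sqrt (ln a)"
  have l: "0 \<le> l" "l\<^sup>2 = ln a" "l < u" using assms False by (auto simp: l_def)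
  have "u - l \<le> 1 + (u - l)\<^sup>2"
    using sum_squares_bound[of "u - l" 1] l(3) by simp
  also have "\<dots> \<le> exp ((u - l)\<^sup>2)" by (rule exp_ge_add_one_self)
  also have "(u - l)\<^sup>2 \<le> u\<^sup>2 - l\<^sup>2"
    using mult_left_mono[of l u l] l by (simp add: power2_eq_square algebra_simps)
  then have "exp ((u - l)\<^sup>2) \<le> exp (u\<^sup>2 - l\<^sup>2)" by simp
  also have "exp (u\<^sup>2 - l\<^sup>2) = exp (u\<^sup>2) / a" using assms l by (simp add: exp_diff)
  finally show ?thesis by (simp add: l_def)
qed

text \<open>The preceding inequality is used with \<open>a = 1 / sum p I\<close>. Its factor
  \<open>1 / a\<close> cancels the normalization of the average, so the remaining sum of
  exponentials is unnormalized and can be enlarged to an index set that no longer depends on the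
  ball.\<close>

lemma weighted_average_le:
  fixes p u g :: "'j \<Rightarrow> real"
  assumes I: "finite I" and p: "\<And>i. i \<in> I \<Longrightarrow> 0 \<le> p i" and P: "0 < sum p I" "sum p I \<le> 1" and D: "0 \<le> D"
    and u: "\<And>i. i \<in> I \<Longrightarrow> 0 \<le> u i" and g: "\<And>i. i \<in> I \<Longrightarrow> \<bar>g i\<bar> \<le> 2 * D * u i"
  shows "\<bar>\<Sum>i\<in>I. p i * g i\<bar> / sum p I \<le> 2 * D * (sqrt (ln (1 / sum p I)) + (\<Sum>i\<in>I. p i * exp ((u i)\<^sup>2)))"
proof -
  define S where "S = sum p I"
  have S: "0 < S" "1 \<le> 1 / S" using P by (auto simp: S_def)
  have "\<bar>\<Sum>i\<in>I. p i * g i\<bar> \<le> (\<Sum>i\<in>I. \<bar>p i * g i\<bar>)" by (rule sum_abs)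
  also have "\<dots> \<le> (\<Sum>i\<in>I. 2 * D * (p i * sqrt (ln (1 / S)) + S * (p i * exp ((u i)\<^sup>2))))"
  proof (rule sum_mono)
    fix i assume i: "i \<in> I"
    have "\<bar>g i\<bar> \<le> 2 * D * (sqrt (ln (1 / S)) + exp ((u i)\<^sup>2) / (1 / S))"
      using g[OF i] le_sqrt_ln_plus_exp_square[OF S(2) u[OF i]] D
      by (meson mult_left_mono order_trans mult_nonneg_nonneg zero_le_numeral)
    then have "p i * \<bar>g i\<bar> \<le> p i * (2 * D * (sqrt (ln (1 / S)) + exp ((u i)\<^sup>2) / (1 / S)))"
      using p[OF i] by (intro mult_left_mono)
    then show "\<bar>p i * g i\<bar> \<le> 2 * D * (p i * sqrt (ln (1 / S)) + S * (p i * exp ((u i)\<^sup>2)))"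
      using p[OF i] by (simp add: abs_mult algebra_simps)
  qed
  also have "\<dots> = S * (2 * D * (sqrt (ln (1 / S)) + (\<Sum>i\<in>I. p i * exp ((u i)\<^sup>2))))"
    by (simp only: sum_distrib_left[symmetric] sum_distrib_right[symmetric] sum.distrib S_def[symmetric])
      (simp add: algebra_simps)
  finally show ?thesis using S(1) unfolding S_def[symmetric] by (simp add: pos_divide_le_eq mult.commute)
qed

locale anchored_gp =
  fixes M :: "'w measure" and T :: "'i set" and X :: "'i \<Rightarrow> 'w \<Rightarrow> real" and x0 :: 'i
  assumes anchored: "anchored_gaussian_process M T X x0"
begin

sublocale prob_space M using anchored by (simp add: anchored_gaussian_process_def)

section \<open>The canonical pseudometric of the process\<close>

lemma finite_T: "finite T" and x0: "x0 \<in> T" and AE_x0: "AE \<omega> in M. X x0 \<omega> = 0"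
  using anchored by (auto simp: anchored_gaussian_process_def)

lemma T_ne: "T \<noteq> {}" using x0 by auto

lemma gaussian_family: "gaussian_family M T X (\<lambda>c. \<integral>\<omega>. (\<Sum>t\<in>T. c t * X t \<omega>)\<^sup>2 \<partial>M)"
  unfolding gaussian_family_def
proof (intro conjI allI finite_T)
  fix c
  have rv: "gaussian_rv M (\<lambda>\<omega>. \<Sum>t\<in>T. c t * X t \<omega>)" for c
    using anchored by (simp add: anchored_gaussian_process_def gaussian_process_def)
  have int: "integrable M (X t)" if t: "t \<in> T" for t
  proof -
    have "(\<lambda>\<omega>. \<Sum>s\<in>T. (if s = t then 1 else 0) * X s \<omega>) = X t"
      using finite_T t by (simp add: if_distrib[of "\<lambda>c. c * _"] cong: if_cong)
    then have "gaussian_rv M (X t)" using rv[of "\<lambda>s. if s = t then 1 else 0"] by simp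
    then show ?thesis by (rule gaussian_rv_integrable[OF prob_space_axioms])
  qed
  have "(\<integral>\<omega>. (\<Sum>t\<in>T. c t * X t \<omega>) \<partial>M) = 0"
    using int anchored by (simp add: Bochner_Integration.integral_sum anchored_gaussian_process_def)
  then show "centered_normal M (\<lambda>\<omega>. \<Sum>t\<in>T. c t * X t \<omega>) (\<integral>\<omega>. (\<Sum>t\<in>T. c t * X t \<omega>)\<^sup>2 \<partial>M)"
    by (intro gaussian_rv_centered_normal prob_space_axioms rv)
qed

lemma normal_X: "x \<in> T \<Longrightarrow> centered_normal M (X x) ((gp_sd M X x)\<^sup>2)"
  using gaussian_family_component[OF gaussian_family, of x]
    centered_normal_second_moment[OF gaussian_family_component[OF gaussian_family, of x]]
  by (simp add: gp_sd_def)

lemma normal_diff: "x \<in> T \<Longrightarrow> y \<in> T \<Longrightarrow> centered_normal M (\<lambda>\<omega>. X x \<omega> - X y \<omega>) ((gp_dist M X x y)\<^sup>2)"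
  using gaussian_family_difference[OF gaussian_family, of x y]
    centered_normal_second_moment[OF gaussian_family_difference[OF gaussian_family, of x y]]
  by (simp add: gp_dist_def)

lemma measurable_X[measurable]: "x \<in> T \<Longrightarrow> X x \<in> borel_measurable M"
  using centered_normalD(2)[OF normal_X] .

lemma integrable_X: "x \<in> T \<Longrightarrow> integrable M (X x)"
  using centered_normal_integrable[OF normal_X] .

lemma gp_dist_nonneg: "0 \<le> gp_dist M X x y" by (simp add: gp_dist_def)

lemma gp_dist_refl: "gp_dist M X x x = 0" by (simp add: gp_dist_def)

lemma gp_dist_sym: "gp_dist M X x y = gp_dist M X y x"
  by (simp add: gp_dist_def abs_minus_commute)

lemma gp_dist_triangle:
  assumes "x \<in> T" "y \<in> T" "z \<in> T"
  shows "gp_dist M X x z \<le> gp_dist M X x y + gp_dist M X y z"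
proof -
  have "sqrt (\<integral>\<omega>. ((X x \<omega> - X y \<omega>) + (X y \<omega> - X z \<omega>))\<^sup>2 \<partial>M)
      \<le> sqrt (\<integral>\<omega>. (X x \<omega> - X y \<omega>)\<^sup>2 \<partial>M) + sqrt (\<integral>\<omega>. (X y \<omega> - X z \<omega>)\<^sup>2 \<partial>M)"
    using assms by (intro l2_triangle centered_normal_integrable_square[OF normal_diff]) auto
  then show ?thesis by (simp add: gp_dist_def)
qed

lemma gp_sd_eq_dist:
  assumes "x \<in> T"
  shows "gp_sd M X x = gp_dist M X x x0"
proof -
  have "(\<integral>\<omega>. (X x \<omega>)\<^sup>2 \<partial>M) = (\<integral>\<omega>. \<bar>X x \<omega> - X x0 \<omega>\<bar>\<^sup>2 \<partial>M)"
    using AE_x0 assms x0 by (intro integral_cong_AE) auto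
  then show ?thesis by (simp add: gp_sd_def gp_dist_def)
qed

lemma gp_sd_le_radius: "x \<in> T \<Longrightarrow> gp_sd M X x \<le> gp_radius M T X"
  unfolding gp_radius_def using finite_T by (intro cSUP_upper) auto

lemma gp_sd_nonneg: "0 \<le> gp_sd M X x" by (simp add: gp_sd_def)

text \<open>Finiteness of \<open>T\<close> gives one null set for all pairs. Off this set, the
  convention \<open>x / 0 = 0\<close> in the exponents of the chaining weight loses no
  increment.\<close>

lemma AE_eq_if_dist_0: "AE \<omega> in M. \<forall>y\<in>T. \<forall>z\<in>T. gp_dist M X y z = 0 \<longrightarrow> X y \<omega> = X z \<omega>"
proof (intro AE_finite_allI[OF finite_T])
  fix y z assume yz: "y \<in> T" "z \<in> T"
  show "AE \<omega> in M. gp_dist M X y z = 0 \<longrightarrow> X y \<omega> = X z \<omega>"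
  proof (cases "gp_dist M X y z = 0")
    case True
    then have "(\<integral>\<omega>. (X y \<omega> - X z \<omega>)\<^sup>2 \<partial>M) = 0" by (simp add: gp_dist_def)
    then have "AE \<omega> in M. (X y \<omega> - X z \<omega>)\<^sup>2 = 0"
      using integral_nonneg_eq_0_iff_AE[OF centered_normal_integrable_square[OF normal_diff[OF yz]]] by simp
    then show ?thesis by eventually_elim simp
  qed simp
qed

text \<open>The double sum controls consecutive averages. The single sum controls the coarsest
  average, which is compared with the anchor, where the process vanishes.\<close>

definition chaining_weight :: "'i pmf \<Rightarrow> ('i \<Rightarrow> real) \<Rightarrow> real" where
  "chaining_weight \<mu> f =
     (\<Sum>(y, z)\<in>T \<times> T. pmf \<mu> y * pmf \<mu> z * exp ((f y - f z)\<^sup>2 / (4 * (gp_dist M X y z)\<^sup>2)))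
     + (\<Sum>y\<in>T. pmf \<mu> y * exp ((f y)\<^sup>2 / (4 * (gp_sd M X y)\<^sup>2)))"

lemma prob_measures_on_sum:
  assumes "\<mu> \<in> prob_measures_on T"
  shows "(\<Sum>y\<in>T. pmf \<mu> y) = 1"
  using assms finite_T by (intro sum_pmf_eq_1) (auto simp: prob_measures_on_def)

lemma prob_ball_eq: "measure_pmf.prob \<mu> (gp_ball M T X x \<epsilon>) = (\<Sum>y\<in>gp_ball M T X x \<epsilon>. pmf \<mu> y)"
  using finite_T by (intro measure_measure_pmf_finite) (simp add: gp_ball_def)

lemma chaining_weight_integral:
  assumes \<mu>: "\<mu> \<in> prob_measures_on T"
  shows "integrable M (\<lambda>\<omega>. chaining_weight \<mu> (\<lambda>y. X y \<omega>))"
    and "(\<integral>\<omega>. chaining_weight \<mu> (\<lambda>y. X y \<omega>) \<partial>M) \<le> 4"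
proof -
  note s1 = prob_measures_on_sum[OF \<mu>]
  have i1: "integrable M (\<lambda>\<omega>. exp ((X y \<omega> - X z \<omega>)\<^sup>2 / (4 * (gp_dist M X y z)\<^sup>2)))" if "y \<in> T" "z \<in> T" for y z
    using centered_normal_integrable_exp_square[OF normal_diff[OF that]] .
  have i2: "integrable M (\<lambda>\<omega>. exp ((X y \<omega>)\<^sup>2 / (4 * (gp_sd M X y)\<^sup>2)))" if "y \<in> T" for y
    using centered_normal_integrable_exp_square[OF normal_X[OF that]] .
  have int1: "integrable M (\<lambda>\<omega>. \<Sum>(y, z)\<in>T \<times> T. pmf \<mu> y * pmf \<mu> z * exp ((X y \<omega> - X z \<omega>)\<^sup>2 / (4 * (gp_dist M X y z)\<^sup>2)))"
    using i1 by (intro Bochner_Integration.integrable_sum) (auto intro!: integrable_mult_right)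
  have int2: "integrable M (\<lambda>\<omega>. \<Sum>y\<in>T. pmf \<mu> y * exp ((X y \<omega>)\<^sup>2 / (4 * (gp_sd M X y)\<^sup>2)))"
    using i2 by (intro Bochner_Integration.integrable_sum) (auto intro!: integrable_mult_right)
  show "integrable M (\<lambda>\<omega>. chaining_weight \<mu> (\<lambda>y. X y \<omega>))"
    unfolding chaining_weight_def by (rule Bochner_Integration.integrable_add[OF int1 int2])
  have "(\<integral>\<omega>. chaining_weight \<mu> (\<lambda>y. X y \<omega>) \<partial>M)
     = (\<Sum>p\<in>T \<times> T. \<integral>\<omega>. (case p of (y, z) \<Rightarrow> pmf \<mu> y * pmf \<mu> z * exp ((X y \<omega> - X z \<omega>)\<^sup>2 / (4 * (gp_dist M X y z)\<^sup>2))) \<partial>M)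
     + (\<Sum>y\<in>T. \<integral>\<omega>. pmf \<mu> y * exp ((X y \<omega>)\<^sup>2 / (4 * (gp_sd M X y)\<^sup>2)) \<partial>M)"
    unfolding chaining_weight_def
    by (subst Bochner_Integration.integral_add[OF int1 int2], subst (1 2) Bochner_Integration.integral_sum)
       (auto intro!: integrable_mult_right i1 i2)
  also have "\<dots> \<le> (\<Sum>p\<in>T \<times> T. pmf \<mu> (fst p) * pmf \<mu> (snd p) * 2) + (\<Sum>y\<in>T. pmf \<mu> y * 2)"
    using centered_normal_exp_square_le[OF normal_diff] centered_normal_exp_square_le[OF normal_X]
    by (intro add_mono sum_mono) (auto intro!: mult_left_mono)
  also have "(\<Sum>p\<in>T \<times> T. pmf \<mu> (fst p) * pmf \<mu> (snd p) * 2) = (\<Sum>y\<in>T. \<Sum>z\<in>T. pmf \<mu> y * pmf \<mu> z * 2)"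
    by (simp add: sum.cartesian_product case_prod_unfold)
  also have "\<dots> = (\<Sum>y\<in>T. pmf \<mu> y) * (\<Sum>y\<in>T. pmf \<mu> y) * 2"
    by (simp only: sum_distrib_left[symmetric] sum_distrib_right[symmetric])
  also have "(\<Sum>y\<in>T. pmf \<mu> y * 2) = (\<Sum>y\<in>T. pmf \<mu> y) * 2" by (simp add: sum_distrib_right)
  finally show "(\<integral>\<omega>. chaining_weight \<mu> (\<lambda>y. X y \<omega>) \<partial>M) \<le> 4" using s1 by simp
qed

lemma measurable_prob_ball[measurable]: "(\<lambda>\<epsilon>. measure_pmf.prob \<mu> (gp_ball M T X x \<epsilon>)) \<in> borel_measurable borel"
proof -
  have "(\<lambda>\<epsilon>. measure_pmf.prob \<mu> (gp_ball M T X x \<epsilon>)) = (\<lambda>\<epsilon>. \<Sum>y\<in>T. pmf \<mu> y * indicator {gp_dist M X x y..} \<epsilon>)"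
    unfolding prob_ball_eq unfolding gp_ball_def using finite_T
    by (auto simp: fun_eq_iff indicator_def sum.If_cases if_distrib Int_def cong: if_cong intro!: sum.cong)
  also have "\<dots> \<in> borel_measurable borel" by measurable
  finally show ?thesis .
qed

lemma sqrt_log_inv_ball_antimono:
  "r \<le> s \<Longrightarrow> sqrt_log_inv (measure_pmf.prob \<mu> (gp_ball M T X x s)) \<le> sqrt_log_inv (measure_pmf.prob \<mu> (gp_ball M T X x r))"
  by (intro sqrt_log_inv_antimono measure_pmf.finite_measure_mono) (auto simp: gp_ball_def)

text \<open>The integrand decreases in the radius, so the interval from \<open>r (Suc k)\<close> to
  \<open>r k\<close>, of length \<open>r k / 2\<close>, contributes at least \<open>r k / 2\<close>
  times the value at \<open>r k\<close>; this explains the factor 2. A ball of mass 0 would make the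
  integral infinite.\<close>

lemma mm_integral_dyadic_sum:
  assumes x: "x \<in> T" and fin: "mm_integral M T X \<mu> x < \<infinity>"
    and pos: "0 < gp_sd M X x"
  defines "r \<equiv> \<lambda>k. gp_sd M X x / 2 ^ k" and "m \<equiv> \<lambda>k::nat. measure_pmf.prob \<mu> (gp_ball M T X x (gp_sd M X x / 2 ^ k))"
  shows "0 < m k" and "(\<Sum>k<n. r k * sqrt (ln (1 / m k))) \<le> 2 * enn2real (mm_integral M T X \<mu> x)"
proof -
  let ?g = "\<lambda>\<epsilon>. sqrt_log_inv (measure_pmf.prob \<mu> (gp_ball M T X x \<epsilon>))"
  define J where "J s = (\<integral>\<^sup>+ \<epsilon> \<in> {0..s}. ?g \<epsilon> \<partial>lborel)" for s
  have r: "0 < r k" "r (Suc k) = r k / 2" for k using pos by (auto simp: r_def)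
  have step: "?g b * ennreal (b - a) + J a \<le> J b" if "0 \<le> a" "a \<le> b" for a b
  proof -
    have "?g b * ennreal (b - a) = (\<integral>\<^sup>+ \<epsilon>. ?g b * indicator {a<..b} \<epsilon> \<partial>lborel)"
      using that by (simp add: nn_integral_cmult_indicator)
    then have "?g b * ennreal (b - a) + J a = (\<integral>\<^sup>+ \<epsilon>. ?g b * indicator {a<..b} \<epsilon> + ?g \<epsilon> * indicator {0..a} \<epsilon> \<partial>lborel)"
      unfolding J_def by (simp add: nn_integral_add)
    also have "\<dots> \<le> J b"
      unfolding J_def using that sqrt_log_inv_ball_antimono[of _ b \<mu> x]
      by (intro nn_integral_mono) (auto split: split_indicator)
    finally show ?thesis .
  qed
  \<comment> \<open>Restriction to radii up to \<open>gp_sd M X x\<close>, a part of the domain that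
    reaches to four times this value.\<close>
  have Jr: "J (r 0) \<le> mm_integral M T X \<mu> x"
    unfolding J_def mm_integral_def using pos
    by (intro nn_integral_mono) (auto simp: r_def split: split_indicator)
  have r_mono: "r k \<le> r 0" for k using pos by (simp add: r_def divide_le_eq)
  show m_pos: "0 < m k" for k
  proof (rule ccontr)
    assume "\<not> 0 < m k"
    then have "m k = 0" by (simp add: m_def zero_less_measure_iff measure_le_0_iff)
    then have "?g (r k) = \<infinity>" by (simp add: m_def r_def sqrt_log_inv_def)
    then have "J (r k) = \<infinity>"
      using step[of 0 "r k"] r(1)[of k] by (simp add: ennreal_top_mult top_unique)
    moreover have "J (r k) \<le> J (r 0)"
      unfolding J_def using r_mono[of k] by (intro nn_integral_mono) (auto split: split_indicator)
    ultimately show False using Jr fin by (simp add: top_unique)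
  qed
  have g_eq: "?g (r k) = ennreal (sqrt (ln (1 / m k)))" for k
    using m_pos[of k] by (simp add: m_def r_def sqrt_log_inv_def)
  have m1: "m k \<le> 1" for k by (simp add: m_def)
  have b: "0 \<le> sqrt (ln (1 / m k))" for k using m_pos[of k] m1[of k] by simp
  have "ennreal (\<Sum>k<n. r k / 2 * sqrt (ln (1 / m k))) + J (r n) \<le> J (r 0)"
  proof (induction n)
    case (Suc n)
    have "ennreal (\<Sum>k<Suc n. r k / 2 * sqrt (ln (1 / m k))) + J (r (Suc n))
       = ennreal (\<Sum>k<n. r k / 2 * sqrt (ln (1 / m k))) + (ennreal (r n / 2 * sqrt (ln (1 / m n))) + J (r (Suc n)))"
      using b r(1) by (simp add: ennreal_plus sum_nonneg less_imp_le add.assoc del: real_sqrt_ge_0_iff)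
    also have "ennreal (r n / 2 * sqrt (ln (1 / m n))) = ?g (r n) * ennreal (r n - r (Suc n))"
      unfolding g_eq r(2) using b[of n] r(1)[of n]
      by (subst ennreal_mult[symmetric]) (auto simp: mult.commute simp del: real_sqrt_ge_0_iff)
    also have "\<dots> + J (r (Suc n)) \<le> J (r n)"
      using r(1)[of "Suc n"] r(1)[of n] r(2)[of n] by (intro step) auto
    finally show ?case using Suc.IH by (meson add_left_mono order_trans)
  qed simp
  then have "ennreal (\<Sum>k<n. r k / 2 * sqrt (ln (1 / m k))) \<le> mm_integral M T X \<mu> x"
    using Jr by (meson le_add1 order_trans le_iff_add)
  then have "(\<Sum>k<n. r k / 2 * sqrt (ln (1 / m k))) \<le> enn2real (mm_integral M T X \<mu> x)"
    using fin b r(1)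
    by (subst enn2real_ennreal[symmetric]) (auto intro!: enn2real_mono sum_nonneg mult_nonneg_nonneg simp: less_imp_le simp del: real_sqrt_ge_0_iff)
  moreover have "(\<Sum>k<n. r k / 2 * sqrt (ln (1 / m k))) = (\<Sum>k<n. r k * sqrt (ln (1 / m k))) / 2"
    by (simp add: sum_divide_distrib)
  ultimately show "(\<Sum>k<n. r k * sqrt (ln (1 / m k))) \<le> 2 * enn2real (mm_integral M T X \<mu> x)" by simp
qed

lemma chaining_weight_nonneg: "0 \<le> chaining_weight \<mu> f"
  unfolding chaining_weight_def by (intro add_nonneg_nonneg sum_nonneg) auto

text \<open>The estimate is pathwise: averages over dyadic balls interpolate between \<open>f x\<close> and \<open>f x0\<close>,
  and consecutive averages are compared by \<open>weighted_average_le\<close>; all randomness is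
  collected in the single quantity \<open>chaining_weight\<close>, whose mean is bounded.\<close>

lemma chaining_bound:
  assumes \<mu>: "\<mu> \<in> prob_measures_on T" and x: "x \<in> T" and fin: "mm_integral M T X \<mu> x < \<infinity>"
    and f: "\<And>y z. y \<in> T \<Longrightarrow> z \<in> T \<Longrightarrow> gp_dist M X y z = 0 \<Longrightarrow> f y = f z" and fx0: "f x0 = 0"
  shows "\<bar>f x\<bar> \<le> 32 * enn2real (mm_integral M T X \<mu> x) + 12 * gp_sd M X x * chaining_weight \<mu> f"
proof (cases "gp_sd M X x = 0")
  case True
  then have "f x = 0" using f[OF x x0] fx0 gp_sd_eq_dist[OF x] by simp
  then show ?thesis using True by simp
next
  case False
  let ?d = "gp_dist M X" and ?w = "pmf \<mu>"
  define \<sigma> where "\<sigma> = gp_sd M X x"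
  define W where "W = chaining_weight \<mu> f"
  have \<sigma>: "0 < \<sigma>" using False gp_sd_nonneg[of x] by (simp add: \<sigma>_def)
  define r where "r k = \<sigma> / 2 ^ k" for k
  define B where "B k = gp_ball M T X x (r k)" for k
  define m where "m k = sum ?w (B k)" for k
  define b where "b k = sqrt (ln (1 / m k))" for k
  define avg where "avg k = (\<Sum>y\<in>B k. ?w y * f y) / m k" for k
  have r: "0 < r k" "r (Suc k) = r k / 2" for k using \<sigma> by (auto simp: r_def)
  have BT: "B k \<subseteq> T" and fB: "finite (B k)" for k
    using finite_T by (auto simp: B_def gp_ball_def)
  have m_prob: "m k = measure_pmf.prob \<mu> (gp_ball M T X x (gp_sd M X x / 2 ^ k))" for k
    unfolding prob_ball_eq by (simp add: m_def B_def r_def \<sigma>_def)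
  have m_pos: "0 < m k" for k
    unfolding m_prob using \<sigma> by (intro mm_integral_dyadic_sum(1)[OF x fin]) (simp add: \<sigma>_def)
  have m_le: "m k \<le> 1" for k unfolding m_prob by simp
  have b_nonneg: "0 \<le> b k" for k using m_pos[of k] m_le[of k] by (simp add: b_def)
  have W: "0 \<le> W" by (simp add: W_def chaining_weight_nonneg)
  have S_le: "(\<Sum>k<n. r k * b k) \<le> 2 * enn2real (mm_integral M T X \<mu> x)" for n
    unfolding b_def r_def \<sigma>_def m_prob using \<sigma> by (intro mm_integral_dyadic_sum(2)[OF x fin]) (simp add: \<sigma>_def)
  have ball_dist: "?d x y \<le> r k" if "y \<in> B k" for y k using that by (simp add: B_def gp_ball_def)
  \<comment> \<open>On the ball of radius \<open>\<sigma>\<close> around \<open>x\<close>, the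
    distance to the anchor is at most \<open>2 * \<sigma>\<close>, and \<open>f\<close> vanishes at
    the anchor.\<close>
  have start: "\<bar>avg 0\<bar> \<le> 4 * \<sigma> * (b 0 + W)"
  proof -
    have "\<bar>\<Sum>y\<in>B 0. ?w y * f y\<bar> / sum ?w (B 0)
       \<le> 2 * (2 * \<sigma>) * (sqrt (ln (1 / sum ?w (B 0))) + (\<Sum>y\<in>B 0. ?w y * exp ((\<bar>f y\<bar> / (2 * gp_sd M X y))\<^sup>2)))"
    proof (rule weighted_average_le[OF fB])
      fix y assume y: "y \<in> B 0"
      then have yT: "y \<in> T" using BT by blast
      show "0 \<le> \<bar>f y\<bar> / (2 * gp_sd M X y)" using gp_sd_nonneg[of y] by simp
      have "gp_sd M X y \<le> ?d x y + \<sigma>"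
        using gp_dist_triangle[OF yT x x0] gp_sd_eq_dist[OF yT] gp_sd_eq_dist[OF x] gp_dist_sym[of x y]
        by (simp add: \<sigma>_def)
      then have le: "gp_sd M X y \<le> 2 * \<sigma>" using ball_dist[OF y] by (simp add: r_def)
      show "\<bar>f y\<bar> \<le> 2 * (2 * \<sigma>) * (\<bar>f y\<bar> / (2 * gp_sd M X y))"
      proof (cases "gp_sd M X y = 0")
        case True
        then have "f y = 0" using f[OF yT x0] fx0 gp_sd_eq_dist[OF yT] by simp
        then show ?thesis by simp
      next
        case False
        then have "0 < gp_sd M X y" using gp_sd_nonneg[of y] by simp
        then show ?thesis using mult_left_mono[OF le, of "\<bar>f y\<bar>"] by (simp add: field_simps)
      qed
    qed (use m_pos[of 0] m_le[of 0] \<sigma> in \<open>auto simp: m_def\<close>)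
    also have "(\<Sum>y\<in>B 0. ?w y * exp ((\<bar>f y\<bar> / (2 * gp_sd M X y))\<^sup>2))
        \<le> (\<Sum>y\<in>T. ?w y * exp ((\<bar>f y\<bar> / (2 * gp_sd M X y))\<^sup>2))"
      using BT finite_T by (intro sum_mono2) auto
    also have "\<dots> = (\<Sum>y\<in>T. ?w y * exp ((f y)\<^sup>2 / (4 * (gp_sd M X y)\<^sup>2)))"
      by (simp add: power_divide power_mult_distrib)
    also have "\<dots> \<le> W"
      unfolding W_def chaining_weight_def by (auto intro!: sum_nonneg)
    finally show ?thesis
      using \<sigma> m_pos[of 0] by (simp add: avg_def b_def m_def abs_divide)
  qed
  \<comment> \<open>The difference of two averages is an average of \<open>f y - f z\<close> over
    the product of the two balls, whose mass is \<open>m (Suc k) * m k\<close>; this is why both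
    logarithms appear. Points of the two balls are at distance at most
    \<open>2 * r k\<close>.\<close>
  have step: "\<bar>avg (Suc k) - avg k\<bar> \<le> 4 * r k * (b (Suc k) + b k + W)" for k
  proof -
    let ?I = "B (Suc k) \<times> B k" and ?p = "\<lambda>(y, z). ?w y * ?w z" and ?g = "\<lambda>(y, z). f y - f z"
      and ?u = "\<lambda>(y, z). \<bar>f y - f z\<bar> / (2 * ?d y z)"
    have sum_p: "sum ?p ?I = m (Suc k) * m k"
      unfolding m_def sum_product by (simp add: sum.cartesian_product)
    have "(\<Sum>i\<in>?I. ?p i * ?g i) = (\<Sum>y\<in>B (Suc k). \<Sum>z\<in>B k. ?w y * f y * ?w z - ?w y * (?w z * f z))"
      unfolding sum.cartesian_product by (intro sum.cong) (auto simp: algebra_simps)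
    also have "\<dots> = (\<Sum>y\<in>B (Suc k). ?w y * f y) * m k - m (Suc k) * (\<Sum>z\<in>B k. ?w z * f z)"
      unfolding m_def sum_subtractf sum_product ..
    finally have sum_pg: "(\<Sum>i\<in>?I. ?p i * ?g i) = (\<Sum>y\<in>B (Suc k). ?w y * f y) * m k - m (Suc k) * (\<Sum>z\<in>B k. ?w z * f z)" .
    have "avg (Suc k) - avg k = (\<Sum>i\<in>?I. ?p i * ?g i) / sum ?p ?I"
      unfolding sum_pg sum_p avg_def using m_pos[of k] m_pos[of "Suc k"] by (simp add: field_simps)
    then have "\<bar>avg (Suc k) - avg k\<bar> = \<bar>\<Sum>i\<in>?I. ?p i * ?g i\<bar> / sum ?p ?I"
      using m_pos[of k] m_pos[of "Suc k"] sum_p by (simp add: abs_divide abs_mult)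
    also have "\<dots> \<le> 2 * (2 * r k) * (sqrt (ln (1 / sum ?p ?I)) + (\<Sum>i\<in>?I. ?p i * exp ((?u i)\<^sup>2)))"
    proof (rule weighted_average_le)
      show "finite ?I" using fB by simp
      show "0 < sum ?p ?I" unfolding sum_p using m_pos by simp
      show "sum ?p ?I \<le> 1" unfolding sum_p using m_pos[of k] m_le by (intro mult_le_one) (auto intro: less_imp_le)
      fix i assume i: "i \<in> ?I"
      obtain y z where yz: "i = (y, z)" "y \<in> B (Suc k)" "z \<in> B k" using i by auto
      then have T: "y \<in> T" "z \<in> T" using BT by auto
      have "?d y z \<le> ?d x y + ?d x z"
        using gp_dist_triangle[OF T(1) x T(2)] gp_dist_sym[of x y] by simp
      then have le: "?d y z \<le> 2 * r k" using ball_dist[OF yz(2)] ball_dist[OF yz(3)] r[of k] by simp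
      have "\<bar>f y - f z\<bar> \<le> 2 * (2 * r k) * (\<bar>f y - f z\<bar> / (2 * ?d y z))"
      proof (cases "?d y z = 0")
        case True
        then show ?thesis using f[OF T] by simp
      next
        case False
        then have "0 < ?d y z" using gp_dist_nonneg[of y z] by simp
        then show ?thesis using mult_left_mono[OF le, of "\<bar>f y - f z\<bar>"] by (simp add: field_simps)
      qed
      then show "\<bar>?g i\<bar> \<le> 2 * (2 * r k) * ?u i" using yz by simp
      show "0 \<le> ?p i" "0 \<le> ?u i" using yz gp_dist_nonneg[of y z] by auto
    qed (use r(1)[of k] in auto)
    also have "\<dots> \<le> 2 * (2 * r k) * ((b (Suc k) + b k) + W)"
    proof (intro mult_left_mono add_mono)
      have "1 / sum ?p ?I = (1 / m (Suc k)) * (1 / m k)" unfolding sum_p by simp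
      then have "ln (1 / sum ?p ?I) = ln (1 / m (Suc k)) + ln (1 / m k)"
        using m_pos[of k] m_pos[of "Suc k"] by (simp only:) (subst ln_mult, auto)
      then show "sqrt (ln (1 / sum ?p ?I)) \<le> b (Suc k) + b k"
        using sqrt_add_le_add_sqrt[of "ln (1 / m (Suc k))" "ln (1 / m k)"] m_pos m_le
        by (simp add: b_def)
      have "(\<Sum>i\<in>?I. ?p i * exp ((?u i)\<^sup>2)) \<le> (\<Sum>i\<in>T \<times> T. ?p i * exp ((?u i)\<^sup>2))"
        using BT finite_T by (intro sum_mono2) auto
      also have "\<dots> = (\<Sum>(y, z)\<in>T \<times> T. ?w y * ?w z * exp ((f y - f z)\<^sup>2 / (4 * (?d y z)\<^sup>2)))"
        by (intro sum.cong) (auto simp: power_divide power_mult_distrib)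
      also have "\<dots> \<le> W"
        unfolding W_def chaining_weight_def by (auto intro!: sum_nonneg)
      finally show "(\<Sum>i\<in>?I. ?p i * exp ((?u i)\<^sup>2)) \<le> W" .
    qed (use r(1)[of k] in auto)
    finally show ?thesis by (simp add: mult.assoc)
  qed
  have avg_le: "\<bar>avg n\<bar> \<le> 4 * \<sigma> * (b 0 + W) + (\<Sum>k<n. 4 * r k * (b (Suc k) + b k + W))" for n
  proof (induction n)
    case (Suc n)
    then show ?case using step[of n] by simp
  qed (use start in simp)
  \<comment> \<open>Once the radius is below all positive distances from \<open>x\<close>, the ball
    contains only points with \<open>f y = f x\<close>, and the chain of averages ends exactly at
    \<open>f x\<close>.\<close>
  have "\<forall>\<^sub>F k in sequentially. \<forall>y\<in>T. ?d x y \<le> r k \<longrightarrow> ?d x y = 0"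
  proof (intro eventually_ball_finite finite_T ballI)
    fix y
    have r_lim: "r \<longlonglongrightarrow> 0"
      unfolding r_def using tendsto_mult[OF tendsto_const[of \<sigma>] LIMSEQ_power_zero[of "1 / 2 :: real"]]
      by (simp add: power_divide)
    show "\<forall>\<^sub>F k in sequentially. ?d x y \<le> r k \<longrightarrow> ?d x y = 0"
    proof (cases "?d x y = 0")
      case False
      then have "0 < ?d x y" using gp_dist_nonneg[of x y] by simp
      from order_tendstoD(2)[OF r_lim this] show ?thesis by eventually_elim simp
    qed simp
  qed
  then obtain K where K: "\<And>y. y \<in> T \<Longrightarrow> ?d x y \<le> r K \<Longrightarrow> ?d x y = 0"
    by (auto simp: eventually_sequentially)
  have "(\<Sum>y\<in>B K. ?w y * f y) = (\<Sum>y\<in>B K. ?w y * f x)"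
    using K f[OF x] BT by (intro sum.cong) (auto simp: B_def gp_ball_def)
  also have "\<dots> = m K * f x" by (simp add: m_def sum_distrib_right)
  finally have "avg K = f x" using m_pos[of K] by (simp add: avg_def)
  define S where "S = (\<Sum>k<Suc K. r k * b k)"
  have S_K: "(\<Sum>k<K. r k * b k) \<le> S" using r(1)[of K] b_nonneg[of K] by (simp add: S_def)
  \<comment> \<open>Because \<open>r k\<close> is twice \<open>r (Suc k)\<close>, the sum with
    shifted entropy is twice the dyadic sum without its first term.\<close>
  have S_Suc: "(\<Sum>k<K. r k * b (Suc k)) = 2 * (S - \<sigma> * b 0)"
  proof -
    have "S = r 0 * b 0 + (\<Sum>k<K. r (Suc k) * b (Suc k))" unfolding S_def by (rule sum.lessThan_Suc_shift)
    also have "(\<Sum>k<K. r (Suc k) * b (Suc k)) = (\<Sum>k<K. r k * b (Suc k)) / 2"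
      by (simp add: r(2) sum_divide_distrib)
    finally show ?thesis by (simp add: r_def)
  qed
  have sum_r: "(\<Sum>k<K. r k) \<le> 2 * \<sigma>"
  proof -
    have "(\<Sum>k<n. r k) = 2 * \<sigma> - 2 * r n" for n
      by (induction n) (auto simp: r(2) r_def)
    then show ?thesis using r(1)[of K] by simp
  qed
  have \<sigma>b: "0 \<le> \<sigma> * b 0" using \<sigma> b_nonneg[of 0] by simp
  have "(\<Sum>k<K. 4 * r k * (b (Suc k) + b k + W))
      = 4 * ((\<Sum>k<K. r k * b (Suc k)) + (\<Sum>k<K. r k * b k) + (\<Sum>k<K. r k) * W)"
    by (simp add: sum_distrib_left sum_distrib_right sum.distrib[symmetric] algebra_simps)
  also have "\<dots> \<le> 4 * (2 * (S - \<sigma> * b 0) + S + 2 * \<sigma> * W)"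
    using S_K S_Suc mult_right_mono[OF sum_r W] by simp
  finally have "\<bar>f x\<bar> \<le> 4 * \<sigma> * (b 0 + W) + 4 * (2 * (S - \<sigma> * b 0) + S + 2 * \<sigma> * W)"
    using avg_le[of K] \<open>avg K = f x\<close> by simp
  \<comment> \<open>The left side equals
    \<open>12 * S - 4 * \<sigma> * b 0 + 12 * \<sigma> * W\<close>; the bound
    \<open>S \<le> 2 * \<Phi>\<close> then turns 16 into 32.\<close>
  also have "\<dots> \<le> 16 * S + 12 * \<sigma> * W"
    using \<sigma>b S_K S_Suc sum_nonneg[of "{..<K}" "\<lambda>k. r k * b (Suc k)"] r(1) b_nonneg
    by (simp add: algebra_simps less_imp_le)
  also have "\<dots> \<le> 32 * enn2real (mm_integral M T X \<mu> x) + 12 * \<sigma> * W"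
    using S_le[of "Suc K"] by (simp add: S_def)
  finally show ?thesis unfolding \<sigma>_def W_def .
qed

end

text \<open>A lower bound, uniform in \<open>m\<close>, for the probability that one of
  \<open>m\<close> independent standard normals reaches \<open>sqrt (ln m)\<close>.\<close>

definition normal_max_rate :: real where
  "normal_max_rate = 1 - exp (- 1 / (exp 1 * sqrt (2 * pi)))"

text \<open>The first entry is \<open>12 * 4\<close>, from the factor of \<open>W\<close> and the
  bound on its mean. The second comes from inserting \<open>R \<le> 2 * S\<close> and
  \<open>F \<le> S\<close> into the radius plus the entropy bound, where \<open>S\<close> is the
  mean of the supremum of absolute values.\<close>

definition mm_const :: real where
  "mm_const = max 48 (8 + 12 / normal_max_rate + 128 / normal_max_rate)"

lemma normal_max_rate_pos: "0 < normal_max_rate"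
  by (simp add: normal_max_rate_def)

lemma mm_const_ge: "48 \<le> mm_const" "8 + 12 / normal_max_rate + 128 / normal_max_rate \<le> mm_const"
  by (simp_all add: mm_const_def)

text \<open>This is assumption \<open>G_ge\<close> for the Gaussian case. Since
  \<open>m * (m + 1) \<le> 2 * m\<^sup>2\<close>, the left side is at most
  \<open>1 + 2 * sqrt (ln m)\<close>, and the lower bound on the normal maximum replaces
  \<open>sqrt (ln m)\<close>.\<close>

lemma sqrt_ln_consecutive_le:
  assumes m: "0 < m"
  shows "sqrt (ln (real m * real (m + 1))) \<le> 2 / normal_max_rate
    * (\<integral>g. Max (g ` {..<m}) \<partial>PiM {..<m} (\<lambda>_. std_normal_distribution)) + (1 + 2 / normal_max_rate)"
proof -
  define g where "g = (\<integral>g. Max (g ` {..<m}) \<partial>PiM {..<m} (\<lambda>_. std_normal_distribution))"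
  have m1: "1 \<le> real m" using m by simp
  have "real m * real (m + 1) \<le> 2 * (real m)\<^sup>2"
    using mult_left_mono[of "real (m + 1)" "2 * real m" "real m"] m1 by (simp add: power2_eq_square)
  then have "ln (real m * real (m + 1)) \<le> ln (2 * (real m)\<^sup>2)"
    using m by (subst ln_le_cancel_iff) auto
  also have "\<dots> = ln 2 + 2 * ln (real m)" using m by (simp add: ln_mult ln_realpow)
  also have "\<dots> \<le> 1 + (2 * sqrt (ln m))\<^sup>2" using ln_ge_zero[OF m1] ln_le_minus_one[of "2::real"] by (simp add: power_mult_distrib)
  finally have "sqrt (ln (real m * real (m + 1))) \<le> sqrt (1 + (2 * sqrt (ln m))\<^sup>2)" by simp
  also have "\<dots> \<le> 1 + 2 * sqrt (ln m)"
    using sqrt_add_le_add_sqrt[of 1 "(2 * sqrt (ln m))\<^sup>2"] m1 by (simp add: real_sqrt_mult)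
  finally have 1: "sqrt (ln (real m * real (m + 1))) \<le> 1 + 2 * sqrt (ln m)" .
  have "sqrt (ln m) * normal_max_rate - 1 \<le> g"
    using PiM_std_normal_Max_ge[OF m] by (simp add: normal_max_rate_def g_def)
  then have "sqrt (ln m) \<le> (g + 1) / normal_max_rate"
    using normal_max_rate_pos by (simp add: field_simps)
  with 1 have "sqrt (ln (real m * real (m + 1))) \<le> 1 + 2 * ((g + 1) / normal_max_rate)" by linarith
  also have "\<dots> = 2 / normal_max_rate * g + (1 + 2 / normal_max_rate)" by (simp add: add_divide_distrib)
  finally show ?thesis unfolding g_def .
qed

lemma cSUP_eq_Max: "finite T \<Longrightarrow> T \<noteq> {} \<Longrightarrow> (SUP x\<in>T. f x :: real) = Max (f ` T)"
  by (intro cSup_eq_Max) auto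

section \<open>Bounds in expectation\<close>

context anchored_gp
begin

lemma AE_chaining_bound:
  assumes \<mu>: "\<mu> \<in> prob_measures_on T" and fin: "mm_sup M T X \<mu> < \<infinity>"
  shows "AE \<omega> in M. \<forall>x\<in>T. \<bar>X x \<omega>\<bar> \<le> 32 * enn2real (mm_integral M T X \<mu> x)
    + 12 * gp_sd M X x * chaining_weight \<mu> (\<lambda>y. X y \<omega>)"
  using AE_eq_if_dist_0 AE_x0
proof eventually_elim
  case (elim \<omega>)
  show ?case
  proof
    fix x assume x: "x \<in> T"
    have "mm_integral M T X \<mu> x \<le> mm_sup M T X \<mu>"
      unfolding mm_sup_def using x by (rule SUP_upper)
    then show "\<bar>X x \<omega>\<bar> \<le> 32 * enn2real (mm_integral M T X \<mu> x)
        + 12 * gp_sd M X x * chaining_weight \<mu> (\<lambda>y. X y \<omega>)"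
      using elim fin by (intro chaining_bound[where f = "\<lambda>y. X y \<omega>"] \<mu> x) (auto intro: le_less_trans)
  qed
qed

lemma one_le_scale_count:
  assumes "0 < s0" "s0 \<le> gp_radius M T X"
  shows "1 \<le> scale_count M T X \<mu> r0 s0"
proof -
  have "0 \<le> log 2 (gp_radius M T X / s0)" using assms by simp
  then have "0 \<le> \<lceil>log 2 (gp_radius M T X / s0)\<rceil>" by linarith
  moreover have "0 \<le> log2_plus (enn2real (mm_sup M T X \<mu>) / r0)" by (simp add: log2_plus_def)
  then have "0 \<le> \<lceil>log2_plus (enn2real (mm_sup M T X \<mu>) / r0)\<rceil>" by linarith
  ultimately show ?thesis
    unfolding scale_count_def
    using mult_mono[of 1 "1 + \<lceil>log2_plus (enn2real (mm_sup M T X \<mu>) / r0)\<rceil>" 1 "1 + \<lceil>log 2 (gp_radius M T X / s0)\<rceil>"]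
    by simp
qed

lemma normalized_sup_le:
  assumes \<mu>: "\<mu> \<in> prob_measures_on T" and fin: "mm_sup M T X \<mu> < \<infinity>" and s0: "0 < s0" and C: "32 \<le> C"
  shows "(\<integral>\<omega>. (SUP x\<in>T. max (\<bar>X x \<omega>\<bar> - C * max (enn2real (mm_integral M T X \<mu> x)) r0) 0 / max (gp_sd M X x) s0) \<partial>M) \<le> 48"
proof -
  let ?W = "\<lambda>\<omega>. chaining_weight \<mu> (\<lambda>y. X y \<omega>)"
  let ?f = "\<lambda>\<omega> x. max (\<bar>X x \<omega>\<bar> - C * max (enn2real (mm_integral M T X \<mu> x)) r0) 0 / max (gp_sd M X x) s0"
  have "(\<integral>\<omega>. (SUP x\<in>T. ?f \<omega> x) \<partial>M) \<le> (\<integral>\<omega>. 12 * ?W \<omega> \<partial>M)"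
  \<comment> \<open>This form of monotonicity asks for integrability and nonnegativity of the
    majorant only.\<close>
  proof (rule integral_mono_AE')
    show "integrable M (\<lambda>\<omega>. 12 * ?W \<omega>)" using chaining_weight_integral(1)[OF \<mu>] by simp
    show "AE \<omega> in M. (SUP x\<in>T. ?f \<omega> x) \<le> 12 * ?W \<omega>"
      using AE_chaining_bound[OF \<mu> fin]
    proof eventually_elim
      case (elim \<omega>)
      show ?case
      proof (rule cSUP_least[OF T_ne])
        fix x assume x: "x \<in> T"
        let ?\<Phi> = "enn2real (mm_integral M T X \<mu> x)"
        have "32 * ?\<Phi> \<le> C * max ?\<Phi> r0" using C by (intro mult_mono) auto
        then have "\<bar>X x \<omega>\<bar> - C * max ?\<Phi> r0 \<le> 12 * gp_sd M X x * ?W \<omega>" using elim x by fastforce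
        also have "\<dots> \<le> 12 * max (gp_sd M X x) s0 * ?W \<omega>"
          by (intro mult_right_mono) (auto simp: chaining_weight_nonneg)
        finally have "max (\<bar>X x \<omega>\<bar> - C * max ?\<Phi> r0) 0 \<le> 12 * max (gp_sd M X x) s0 * ?W \<omega>"
          using s0 by (auto simp: chaining_weight_nonneg intro!: mult_nonneg_nonneg)
        then show "?f \<omega> x \<le> 12 * ?W \<omega>" using s0 by (simp add: pos_divide_le_eq mult_ac)
      qed
    qed
    show "AE \<omega> in M. 0 \<le> 12 * ?W \<omega>" by (simp add: chaining_weight_nonneg)
  qed
  also have "\<dots> \<le> 12 * 4" using chaining_weight_integral[OF \<mu>] by simp
  finally show ?thesis by simp
qed

lemma mean_abs_le:
  assumes \<mu>: "\<mu> \<in> prob_measures_on T" and fin: "mm_sup M T X \<mu> < \<infinity>" and x: "x \<in> T"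
  shows "(\<integral>\<omega>. \<bar>X x \<omega>\<bar> \<partial>M) \<le> 32 * enn2real (mm_integral M T X \<mu> x) + 48 * gp_sd M X x"
proof -
  note W = chaining_weight_integral[OF \<mu>]
  have "(\<integral>\<omega>. \<bar>X x \<omega>\<bar> \<partial>M)
     \<le> (\<integral>\<omega>. 32 * enn2real (mm_integral M T X \<mu> x) + 12 * gp_sd M X x * chaining_weight \<mu> (\<lambda>y. X y \<omega>) \<partial>M)"
    using AE_chaining_bound[OF \<mu> fin] W(1) integrable_X[OF x] x
    by (intro integral_mono_AE) (auto elim: eventually_mono)
  also have "\<dots> = 32 * enn2real (mm_integral M T X \<mu> x) + 12 * gp_sd M X x * (\<integral>\<omega>. chaining_weight \<mu> (\<lambda>y. X y \<omega>) \<partial>M)"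
    using W(1) prob_space by simp
  also have "12 * gp_sd M X x * (\<integral>\<omega>. chaining_weight \<mu> (\<lambda>y. X y \<omega>) \<partial>M) \<le> 12 * gp_sd M X x * 4"
    using W(2) by (intro mult_left_mono) (auto simp: gp_sd_nonneg)
  finally show ?thesis by simp
qed

lemma mean_sup_le:
  assumes \<mu>: "\<mu> \<in> prob_measures_on T" and fin: "mm_sup M T X \<mu> < \<infinity>"
  shows "(\<integral>\<omega>. (SUP x\<in>T. \<bar>X x \<omega>\<bar>) \<partial>M) \<le> 32 * enn2real (mm_sup M T X \<mu>) + 48 * gp_radius M T X"
proof -
  note W = chaining_weight_integral[OF \<mu>]
  have R: "0 \<le> gp_radius M T X" using gp_sd_le_radius[OF x0] gp_sd_nonneg[of x0] by simp
  let ?b = "\<lambda>\<omega>. 32 * enn2real (mm_sup M T X \<mu>) + 12 * gp_radius M T X * chaining_weight \<mu> (\<lambda>y. X y \<omega>)"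
  have "(\<integral>\<omega>. (SUP x\<in>T. \<bar>X x \<omega>\<bar>) \<partial>M) \<le> (\<integral>\<omega>. ?b \<omega> \<partial>M)"
  proof (rule integral_mono_AE')
    show "integrable M ?b" using W(1) by simp
    show "AE \<omega> in M. (SUP x\<in>T. \<bar>X x \<omega>\<bar>) \<le> ?b \<omega>"
      using AE_chaining_bound[OF \<mu> fin]
    proof eventually_elim
      case (elim \<omega>)
      show ?case
      proof (rule cSUP_least[OF T_ne])
        fix x assume x: "x \<in> T"
        have "enn2real (mm_integral M T X \<mu> x) \<le> enn2real (mm_sup M T X \<mu>)"
          using fin x unfolding mm_sup_def by (intro enn2real_mono SUP_upper) auto
        moreover have "12 * gp_sd M X x * chaining_weight \<mu> (\<lambda>y. X y \<omega>)
            \<le> 12 * gp_radius M T X * chaining_weight \<mu> (\<lambda>y. X y \<omega>)"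
          using gp_sd_le_radius[OF x] by (intro mult_right_mono) (auto simp: chaining_weight_nonneg)
        ultimately show "\<bar>X x \<omega>\<bar> \<le> ?b \<omega>" using elim x by fastforce
      qed
    qed
    show "AE \<omega> in M. 0 \<le> ?b \<omega>" using R by (simp add: chaining_weight_nonneg)
  qed
  also have "\<dots> = 32 * enn2real (mm_sup M T X \<mu>) + 12 * gp_radius M T X * (\<integral>\<omega>. chaining_weight \<mu> (\<lambda>y. X y \<omega>) \<partial>M)"
    using W(1) prob_space by simp
  also have "12 * gp_radius M T X * (\<integral>\<omega>. chaining_weight \<mu> (\<lambda>y. X y \<omega>) \<partial>M) \<le> 12 * gp_radius M T X * 4"
    using W(2) R by (intro mult_left_mono) auto
  finally show ?thesis by simp
qed

lemma integrable_sup_abs: "integrable M (\<lambda>\<omega>. SUP x\<in>T. \<bar>X x \<omega>\<bar>)"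
  unfolding cSUP_eq_Max[OF finite_T T_ne]
  using integrable_X by (intro integrable_Max_image finite_T T_ne) auto

lemma gp_sup_mean_le: "gp_sup_mean M X T \<le> (\<integral>\<omega>. (SUP x\<in>T. \<bar>X x \<omega>\<bar>) \<partial>M)"
  unfolding gp_sup_mean_def
proof (rule integral_mono)
  show "integrable M (\<lambda>\<omega>. Max ((\<lambda>t. X t \<omega>) ` T))"
    by (intro integrable_Max_image finite_T T_ne integrable_X)
  show "integrable M (\<lambda>\<omega>. SUP x\<in>T. \<bar>X x \<omega>\<bar>)" by (rule integrable_sup_abs)
  fix \<omega>
  show "Max ((\<lambda>t. X t \<omega>) ` T) \<le> (SUP x\<in>T. \<bar>X x \<omega>\<bar>)"
    unfolding cSUP_eq_Max[OF finite_T T_ne]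
  proof (rule Max.boundedI)
    fix a assume "a \<in> (\<lambda>t. X t \<omega>) ` T"
    then obtain t where t: "t \<in> T" "a = X t \<omega>" by auto
    have "a \<le> \<bar>X t \<omega>\<bar>" using t(2) by simp
    also have "\<dots> \<le> Max ((\<lambda>x. \<bar>X x \<omega>\<bar>) ` T)" using t(1) finite_T by (intro Max_ge) auto
    finally show "a \<le> Max ((\<lambda>x. \<bar>X x \<omega>\<bar>) ` T)" .
  qed (use finite_T T_ne in auto)
qed

lemma gp_radius_le: "gp_radius M T X \<le> 2 * (\<integral>\<omega>. (SUP x\<in>T. \<bar>X x \<omega>\<bar>) \<partial>M)"
  unfolding gp_radius_def
proof (rule cSUP_least[OF T_ne])
  fix x assume x: "x \<in> T"
  have "gp_sd M X x \<le> 2 * (\<integral>\<omega>. \<bar>X x \<omega>\<bar> \<partial>M)"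
    using centered_normal_sd_le[OF normal_X[OF x]] gp_sd_nonneg[of x] by simp
  also have "(\<integral>\<omega>. \<bar>X x \<omega>\<bar> \<partial>M) \<le> (\<integral>\<omega>. (SUP x\<in>T. \<bar>X x \<omega>\<bar>) \<partial>M)"
    using integrable_X[OF x] integrable_sup_abs x finite_T
    by (intro integral_mono) (auto intro!: cSUP_upper)
  finally show "gp_sd M X x \<le> 2 * (\<integral>\<omega>. (SUP x\<in>T. \<bar>X x \<omega>\<bar>) \<partial>M)" by simp
qed

sublocale growth: growth_functional T "gp_dist M X" "gp_sup_mean M X"
  "\<lambda>m. \<integral>g. Max (g ` {..<m}) \<partial>PiM {..<m} (\<lambda>_. std_normal_distribution)"
  "2 / normal_max_rate" "1 + 2 / normal_max_rate"
proof
  fix A assume A: "A \<subseteq> T" "A \<noteq> {}"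
  have fA: "finite A" using A finite_T finite_subset by blast
  obtain t where t: "t \<in> A" using A by blast
  have "0 = (\<integral>\<omega>. X t \<omega> \<partial>M)" using centered_normal_mean[OF normal_X, of t] t A by auto
  also have "\<dots> \<le> gp_sup_mean M X A"
    unfolding gp_sup_mean_def using A fA t
    by (intro integral_mono integrable_Max_image integrable_X) auto
  finally show "0 \<le> gp_sup_mean M X A" .
next
  fix A B assume AB: "A \<subseteq> B" "B \<subseteq> T" "A \<noteq> {}"
  have fB: "finite B" using AB finite_T finite_subset by blast
  show "gp_sup_mean M X A \<le> gp_sup_mean M X B"
    unfolding gp_sup_mean_def using AB fB finite_subset[OF AB(1) fB]
    by (intro integral_mono integrable_Max_image integrable_X Max_mono) auto
next
  fix U and m :: nat and s v :: real and idx :: "'i \<Rightarrow> nat" and c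
  assume "U \<subseteq> T" "0 < m" "0 \<le> s" "\<And>u. u \<in> U \<Longrightarrow> idx u < m" "\<And>i. i < m \<Longrightarrow> c i \<in> T"
    "\<And>i. i < m \<Longrightarrow> {u \<in> U. idx u = i} \<noteq> {}" "\<And>u. u \<in> U \<Longrightarrow> gp_dist M X u (c (idx u)) \<le> s / 4"
    "\<And>u v. u \<in> U \<Longrightarrow> v \<in> U \<Longrightarrow> idx u \<noteq> idx v \<Longrightarrow> s / 2 \<le> gp_dist M X u v"
    "\<And>i. i < m \<Longrightarrow> v \<le> gp_sup_mean M X {u \<in> U. idx u = i}"
  then show "v + s / 4 * (\<integral>g. Max (g ` {..<m}) \<partial>PiM {..<m} (\<lambda>_. std_normal_distribution)) \<le> gp_sup_mean M X U"
    by (rule gaussian_growth[OF gaussian_family])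
qed (use finite_T gp_dist_nonneg gp_dist_refl gp_dist_sym gp_dist_triangle normal_max_rate_pos
      sqrt_ln_consecutive_le in auto)

lemma exists_majorizing_measure:
  assumes R: "0 < gp_radius M T X"
  shows "\<exists>\<mu>\<in>prob_measures_on T. mm_sup M T X \<mu> \<le> ennreal (3 * (1 + 2 / normal_max_rate) * gp_radius M T X
      + 64 * (2 / normal_max_rate) * gp_sup_mean M X T)" (is "\<exists>\<mu>\<in>_. _ \<le> ?b")
proof -
  let ?R = "gp_radius M T X"
  have near: "gp_dist M X x0 x \<le> ?R" if "x \<in> T" for x
    using gp_sd_le_radius[OF that] gp_sd_eq_dist[OF that] gp_dist_sym[of x x0] by simp
  obtain \<nu> where \<nu>: "\<And>y. 0 \<le> \<nu> y" "(\<Sum>y\<in>T. \<nu> y) = 1"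
    "\<And>x. x \<in> T \<Longrightarrow> growth.entropy_integral \<nu> x (2 * ?R) \<le> ?b"
    using growth.majorizing_measure_exists[OF x0 R near] by auto
  \<comment> \<open>The construction controls the sum of \<open>\<nu>\<close> over \<open>T\<close>
    alone, so the function is cut off outside \<open>T\<close> before it becomes a
    \<open>pmf\<close>.\<close>
  define \<nu>' where "\<nu>' y = (if y \<in> T then \<nu> y else 0)" for y
  define \<mu> where "\<mu> = embed_pmf \<nu>'"
  have pmf_\<mu>: "pmf \<mu> y = \<nu>' y" for y
    unfolding \<mu>_def
  proof (rule pmf_embed_pmf)
    show "0 \<le> \<nu>' x" for x using \<nu>(1) by (simp add: \<nu>'_def)
    have "(\<integral>\<^sup>+ x. ennreal (\<nu>' x) \<partial>count_space UNIV) = (\<Sum>x\<in>T. ennreal (\<nu>' x))"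
      using finite_T by (intro nn_integral_count_space') (auto simp: \<nu>'_def)
    also have "\<dots> = ennreal (\<Sum>x\<in>T. \<nu> x)"
      using \<nu>(1) by (subst sum_ennreal[symmetric]) (auto simp: \<nu>'_def)
    finally show "(\<integral>\<^sup>+ x. ennreal (\<nu>' x) \<partial>count_space UNIV) = 1" using \<nu>(2) by simp
  qed
  have \<mu>: "\<mu> \<in> prob_measures_on T"
    by (auto simp: prob_measures_on_def set_pmf_iff pmf_\<mu> \<nu>'_def split: if_splits)
  have mass: "measure_pmf.prob \<mu> (gp_ball M T X x \<epsilon>) = growth.ball_mass \<nu> x \<epsilon>" for x \<epsilon>
    unfolding prob_ball_eq growth.ball_mass_def unfolding gp_ball_def by (simp add: pmf_\<mu> \<nu>'_def)
  have "mm_integral M T X \<mu> x \<le> ?b" if x: "x \<in> T" for x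
  proof -
    \<comment> \<open>Beyond \<open>2 * R\<close> every ball is all of \<open>T\<close> and the
      integrand vanishes. The integral up to \<open>4 * \<sigma> x\<close> is therefore bounded by
      the one up to \<open>2 * R\<close>, whichever limit is larger.\<close>
    have all: "growth.ball_mass \<nu> x \<epsilon> = 1" if "2 * ?R < \<epsilon>" for \<epsilon>
    proof -
      have "gp_dist M X x y \<le> \<epsilon>" if "y \<in> T" for y
        using gp_dist_triangle[OF x x0 that] near[OF x] near[OF that] gp_dist_sym[of x x0] \<open>2 * ?R < \<epsilon>\<close> by simp
      then have "{y \<in> T. gp_dist M X x y \<le> \<epsilon>} = T" by auto
      then show ?thesis by (simp add: growth.ball_mass_def \<nu>(2))
    qed
    have "mm_integral M T X \<mu> x \<le> growth.entropy_integral \<nu> x (2 * ?R)"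
      unfolding mm_integral_def growth.entropy_integral_def mass
      using all by (intro nn_integral_mono) (auto simp: sqrt_log_inv_def split: split_indicator)
    then show ?thesis using \<nu>(3)[OF x] by (rule order_trans)
  qed
  then have "mm_sup M T X \<mu> \<le> ?b" unfolding mm_sup_def by (rule SUP_least)
  then show ?thesis using \<mu> by blast
qed

lemma mean_sup_le_INF:
  assumes C: "48 \<le> C"
  shows "ennreal (\<integral>\<omega>. (SUP x\<in>T. \<bar>X x \<omega>\<bar>) \<partial>M)
    \<le> ennreal C * (ennreal (gp_radius M T X) + (INF \<mu>\<in>prob_measures_on T. mm_sup M T X \<mu>))"
proof -
  let ?S = "\<integral>\<omega>. (SUP x\<in>T. \<bar>X x \<omega>\<bar>) \<partial>M" and ?R = "gp_radius M T X"
  have R: "0 \<le> ?R" using gp_sd_le_radius[OF x0] gp_sd_nonneg[of x0] by simp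
  \<comment> \<open>Isolating the functional lets the infimum be taken on the right. A negative left
    side is sent to 0 by \<open>ennreal\<close>, so no case distinction on its sign is needed
    here.\<close>
  have "ennreal (?S / C - ?R) \<le> mm_sup M T X \<mu>" if \<mu>: "\<mu> \<in> prob_measures_on T" for \<mu>
  proof (cases "mm_sup M T X \<mu> < \<infinity>")
    case True
    have "?S \<le> C * enn2real (mm_sup M T X \<mu>) + C * ?R"
      using mean_sup_le[OF \<mu> True] mult_right_mono[of 32 C "enn2real (mm_sup M T X \<mu>)"]
        mult_right_mono[OF C R] C by simp
    then have "?S / C - ?R \<le> enn2real (mm_sup M T X \<mu>)" using C by (simp add: field_simps)
    then have "ennreal (?S / C - ?R) \<le> ennreal (enn2real (mm_sup M T X \<mu>))" by (rule ennreal_leI)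
    also have "ennreal (enn2real (mm_sup M T X \<mu>)) = mm_sup M T X \<mu>" using True by (intro ennreal_enn2real) simp
    finally show ?thesis .
  qed (simp add: not_less top_unique)
  then have INF: "ennreal (?S / C - ?R) \<le> (INF \<mu>\<in>prob_measures_on T. mm_sup M T X \<mu>)"
    by (rule INF_greatest)
  have "ennreal ?S = ennreal (C * (?R + (?S / C - ?R)))" using C by simp
  also have "\<dots> = ennreal C * ennreal (?R + (?S / C - ?R))" using C by (intro ennreal_mult') simp
  also have "ennreal (?R + (?S / C - ?R)) \<le> ennreal (?R + max 0 (?S / C - ?R))"
    by (intro ennreal_leI) simp
  also have "\<dots> = ennreal ?R + ennreal (?S / C - ?R)"
    using R by (subst ennreal_plus) (auto simp: max_def ennreal_neg)
  also have "\<dots> \<le> ennreal ?R + (INF \<mu>\<in>prob_measures_on T. mm_sup M T X \<mu>)"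
    using INF by (rule add_left_mono)
  finally show ?thesis by (simp add: mult_left_mono)
qed

lemma INF_le_mean_sup:
  assumes R: "0 < gp_radius M T X" and C: "8 + 12 / normal_max_rate + 128 / normal_max_rate \<le> C"
  shows "ennreal (gp_radius M T X) + (INF \<mu>\<in>prob_measures_on T. mm_sup M T X \<mu>)
    \<le> ennreal C * ennreal (\<integral>\<omega>. (SUP x\<in>T. \<bar>X x \<omega>\<bar>) \<partial>M)"
proof -
  let ?S = "\<integral>\<omega>. (SUP x\<in>T. \<bar>X x \<omega>\<bar>) \<partial>M" and ?R = "gp_radius M T X" and ?F = "gp_sup_mean M X T"
    and ?n = "normal_max_rate"
  obtain \<mu> where \<mu>: "\<mu> \<in> prob_measures_on T"
    "mm_sup M T X \<mu> \<le> ennreal (3 * (1 + 2 / ?n) * ?R + 64 * (2 / ?n) * ?F)"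
    using exists_majorizing_measure[OF R] by blast
  have F: "0 \<le> ?F" using growth.F_nonneg[of T] T_ne by simp
  have S: "?R \<le> 2 * ?S" "?F \<le> ?S" using gp_radius_le gp_sup_mean_le by auto
  have n: "0 < ?n" by (rule normal_max_rate_pos)
  have "(INF \<mu>\<in>prob_measures_on T. mm_sup M T X \<mu>) \<le> ennreal (3 * (1 + 2 / ?n) * ?R + 64 * (2 / ?n) * ?F)"
    using INF_lower[OF \<mu>(1)] \<mu>(2) by (rule order_trans)
  then have "ennreal ?R + (INF \<mu>\<in>prob_measures_on T. mm_sup M T X \<mu>)
      \<le> ennreal ?R + ennreal (3 * (1 + 2 / ?n) * ?R + 64 * (2 / ?n) * ?F)" by (rule add_left_mono)
  also have "\<dots> = ennreal (?R + (3 * (1 + 2 / ?n) * ?R + 64 * (2 / ?n) * ?F))"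
    using R F n by (intro ennreal_plus[symmetric]) auto
  also have "\<dots> \<le> ennreal (C * ?S)"
  proof (rule ennreal_leI)
    have "3 * (1 + 2 / ?n) * ?R \<le> 3 * (1 + 2 / ?n) * (2 * ?S)"
      using S n by (intro mult_left_mono) auto
    moreover have "64 * (2 / ?n) * ?F \<le> 64 * (2 / ?n) * ?S" using S n by (intro mult_left_mono) auto
    \<comment> \<open>\<open>R \<le> 2 * S\<close> contributes \<open>2 + 6 * (1 + 2 / n)\<close>
      and \<open>F \<le> S\<close> contributes \<open>128 / n\<close>.\<close>
    ultimately have "?R + (3 * (1 + 2 / ?n) * ?R + 64 * (2 / ?n) * ?F) \<le> (8 + 12 / ?n + 128 / ?n) * ?S"
      using S(1) by (simp add: algebra_simps)
    also have "\<dots> \<le> C * ?S" using C S F by (intro mult_right_mono) auto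
    finally show "?R + (3 * (1 + 2 / ?n) * ?R + 64 * (2 / ?n) * ?F) \<le> C * ?S" .
  qed
  also have "\<dots> = ennreal C * ennreal ?S"
    using S F by (intro ennreal_mult'') auto
  finally show ?thesis .
qed

end

text \<open>The conclusion of \<open>admissible_constant\<close> for one process, isolated so that
  it can be transported from a process to its law.\<close>

definition gp_estimates :: "real \<Rightarrow> 'w measure \<Rightarrow> 'i set \<Rightarrow> ('i \<Rightarrow> 'w \<Rightarrow> real) \<Rightarrow> bool" where
  "gp_estimates C M T X \<longleftrightarrow>
      (let \<sigma> = gp_sd M X; R = gp_radius M T X;
           \<Phi> = (\<lambda>\<mu> x. enn2real (mm_integral M T X \<mu> x));
           N = (\<lambda>\<mu> r0 s0. real_of_int (scale_count M T X \<mu> r0 s0))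
       in
        (\<forall>\<mu>\<in>prob_measures_on T. \<forall>r0 s0 :: real.
          mm_sup M T X \<mu> < \<infinity> \<and> 0 < r0 \<and> 0 < s0 \<and> s0 \<le> R \<longrightarrow>
            (LINT \<omega>|M. (SUP x\<in>T. max (\<bar>X x \<omega>\<bar> - C * max (\<Phi> \<mu> x) r0) 0 / max (\<sigma> x) s0))
              \<le> C * sqrt (ln (exp 1 * N \<mu> r0 s0)) \<and>
            (\<forall>x\<in>T. (LINT \<omega>|M. \<bar>X x \<omega>\<bar>)
              \<le> C * max (\<Phi> \<mu> x) r0 + C * max (\<sigma> x) s0 * sqrt (ln (exp 1 * N \<mu> r0 s0))) \<and>
            (mm_sup M T X \<mu> \<le> ennreal r0 \<and> s0 = R \<longrightarrow>
              scale_count M T X \<mu> r0 s0 = 1 \<and>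
              (LINT \<omega>|M. (SUP x\<in>T. \<bar>X x \<omega>\<bar>)) \<le> C * (r0 + R))) \<and>
        ennreal (LINT \<omega>|M. (SUP x\<in>T. \<bar>X x \<omega>\<bar>))
          \<le> ennreal C * (ennreal R + (INF \<mu>\<in>prob_measures_on T. mm_sup M T X \<mu>)) \<and>
        ennreal R + (INF \<mu>\<in>prob_measures_on T. mm_sup M T X \<mu>)
          \<le> ennreal C * ennreal (LINT \<omega>|M. (SUP x\<in>T. \<bar>X x \<omega>\<bar>)))"

lemma admissible_constant_iff:
  "admissible_constant TYPE('w) TYPE('i) C \<longleftrightarrow>
    (\<forall>(M :: 'w measure) (T :: 'i set) X x0. anchored_gaussian_process M T X x0 \<and> 0 < gp_radius M T X
      \<longrightarrow> gp_estimates C M T X)"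
  unfolding admissible_constant_def gp_estimates_def ..

lemma (in anchored_gp) gp_estimates_mm_const:
  assumes R: "0 < gp_radius M T X"
  shows "gp_estimates mm_const M T X"
proof -
  have C: "48 \<le> mm_const" by (rule mm_const_ge)
  have C0: "0 \<le> mm_const" using C by simp
  let ?\<Phi> = "\<lambda>\<mu> x. enn2real (mm_integral M T X \<mu> x)"
  have est1: "(LINT \<omega>|M. (SUP x\<in>T. max (\<bar>X x \<omega>\<bar> - mm_const * max (?\<Phi> \<mu> x) r0) 0 / max (gp_sd M X x) s0))
        \<le> mm_const * sqrt (ln (exp 1 * real_of_int (scale_count M T X \<mu> r0 s0)))" (is ?A)
    and est2: "(\<forall>x\<in>T. (LINT \<omega>|M. \<bar>X x \<omega>\<bar>) \<le> mm_const * max (?\<Phi> \<mu> x) r0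
         + mm_const * max (gp_sd M X x) s0 * sqrt (ln (exp 1 * real_of_int (scale_count M T X \<mu> r0 s0))))" (is ?B)
    and est3: "mm_sup M T X \<mu> \<le> ennreal r0 \<and> s0 = gp_radius M T X \<longrightarrow> scale_count M T X \<mu> r0 s0 = 1 \<and>
           (LINT \<omega>|M. (SUP x\<in>T. \<bar>X x \<omega>\<bar>)) \<le> mm_const * (r0 + gp_radius M T X)" (is ?D)
    if \<mu>: "\<mu> \<in> prob_measures_on T" and fin: "mm_sup M T X \<mu> < \<infinity>" and r0: "0 < r0" and s0: "0 < s0" "s0 \<le> gp_radius M T X"
    for \<mu> r0 s0
  proof -
    define n where "n = real_of_int (scale_count M T X \<mu> r0 s0)"
    have n: "1 \<le> n" using one_le_scale_count[OF s0, of \<mu> r0] by (simp add: n_def)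
    then have "1 \<le> ln (exp 1 * n)" by (simp add: ln_mult)
    then have root: "1 \<le> sqrt (ln (exp 1 * n))" by simp
    have "48 * 1 \<le> mm_const * sqrt (ln (exp 1 * n))" using C root by (intro mult_mono) auto
    then show ?A
      using normalized_sup_le[OF \<mu> fin s0(1), of mm_const r0] C unfolding n_def[symmetric] by linarith
    show ?B
    proof
      fix x assume x: "x \<in> T"
      have "32 * ?\<Phi> \<mu> x \<le> mm_const * max (?\<Phi> \<mu> x) r0" using C by (intro mult_mono) auto
      moreover have "48 * gp_sd M X x * 1 \<le> mm_const * max (gp_sd M X x) s0 * sqrt (ln (exp 1 * n))"
        using C root gp_sd_nonneg[of x] by (intro mult_mono) (auto intro!: mult_nonneg_nonneg)
      ultimately show "(LINT \<omega>|M. \<bar>X x \<omega>\<bar>) \<le> mm_const * max (?\<Phi> \<mu> x) r0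
         + mm_const * max (gp_sd M X x) s0 * sqrt (ln (exp 1 * real_of_int (scale_count M T X \<mu> r0 s0)))"
        using mean_abs_le[OF \<mu> fin x] unfolding n_def[symmetric] by linarith
    qed
    show ?D
    proof (intro impI conjI)
      assume a: "mm_sup M T X \<mu> \<le> ennreal r0 \<and> s0 = gp_radius M T X"
      then have le: "enn2real (mm_sup M T X \<mu>) \<le> r0" using r0 enn2real_mono[of "mm_sup M T X \<mu>" "ennreal r0"] by simp
      have "log2_plus (enn2real (mm_sup M T X \<mu>) / r0) = 0"
      proof (cases "enn2real (mm_sup M T X \<mu>) = 0")
        case False
        then have "0 < enn2real (mm_sup M T X \<mu>)" using enn2real_nonneg[of "mm_sup M T X \<mu>"] by linarith
        then have "log 2 (enn2real (mm_sup M T X \<mu>) / r0) \<le> 0" using le r0 by simp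
        then show ?thesis by (simp add: log2_plus_def)
      qed (simp add: log2_plus_def log_def)
      then show "scale_count M T X \<mu> r0 s0 = 1" using a R by (simp add: scale_count_def)
      have "mm_const * (r0 + gp_radius M T X) = mm_const * r0 + mm_const * gp_radius M T X" by (simp add: distrib_left)
      moreover have "32 * enn2real (mm_sup M T X \<mu>) \<le> mm_const * r0" using le C r0 by (intro mult_mono) auto
      moreover have "48 * gp_radius M T X \<le> mm_const * gp_radius M T X" using C R by (intro mult_right_mono) auto
      ultimately show "(LINT \<omega>|M. (SUP x\<in>T. \<bar>X x \<omega>\<bar>)) \<le> mm_const * (r0 + gp_radius M T X)"
        using mean_sup_le[OF \<mu> fin] by linarith
    qed
  qed
  show ?thesis
    unfolding gp_estimates_def Let_def
    by (rule conjI[OF _ conjI[OF mean_sup_le_INF[OF mm_const_ge(1)] INF_le_mean_sup[OF R mm_const_ge(2)]]])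
      (intro ballI allI impI, elim conjE, (rule conjI[OF est1 conjI[OF est2 est3]]; assumption))
qed

section \<open>Transfer between sample spaces and index types\<close>

text \<open>Both alternatives in \<open>gaussian_rv\<close>, the point mass and the density, depend
  only on the law.\<close>

lemma gaussian_rv_distr:
  assumes f[measurable]: "f \<in> measurable M N" and h[measurable]: "h \<in> borel_measurable N"
    and rv: "gaussian_rv M (\<lambda>\<omega>. h (f \<omega>))"
  shows "gaussian_rv (distr M N f) h"
proof -
  have "distributed (distr M N f) lborel h p \<longleftrightarrow> distributed M lborel (\<lambda>\<omega>. h (f \<omega>)) p" for p
    by (simp add: distributed_def distr_distr comp_def)
  moreover have "(AE \<omega> in distr M N f. h \<omega> = c) \<longleftrightarrow> (AE \<omega> in M. h (f \<omega>) = c)" for c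
    by (rule AE_distr_iff[OF f]) measurable
  ultimately show ?thesis using rv by (simp add: gaussian_rv_def)
qed

locale gp_transfer = anchored_gp M T X x0
  for M :: "'w measure" and T :: "'i set" and X :: "'i \<Rightarrow> 'w \<Rightarrow> real" and x0 :: 'i +
  fixes n :: nat and e :: "nat \<Rightarrow> 'i"
  assumes e: "bij_betw e {..<n} T"
begin

text \<open>The sequence space is the same for every \<open>n\<close>, so that all processes share
  one sample type; coordinates from \<open>n\<close> on are padded with 0.\<close>

definition path :: "'w \<Rightarrow> nat \<Rightarrow> real" where
  "path \<omega> k = (if k < n then X (e k) \<omega> else 0)"

definition law :: "(nat \<Rightarrow> real) measure" where
  "law = distr M (PiM UNIV (\<lambda>_. borel)) path"

definition coord :: "nat \<Rightarrow> (nat \<Rightarrow> real) \<Rightarrow> real" where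
  "coord k \<omega> = \<omega> k"

lemma e_in: "k < n \<Longrightarrow> e k \<in> T" using e by (auto simp: bij_betw_def)

lemma T_eq: "T = e ` {..<n}" using e by (simp add: bij_betw_def)

lemma inj_e: "inj_on e {..<n}" using e by (simp add: bij_betw_def)

lemma path_measurable[measurable]: "path \<in> measurable M (PiM UNIV (\<lambda>_. borel))"
proof (rule measurable_PiM_single')
  fix k
  show "(\<lambda>\<omega>. path \<omega> k) \<in> borel_measurable M"
    by (cases "k < n") (auto simp: path_def e_in)
qed (auto simp: PiE_iff)

lemma coord_measurable[measurable]: "coord k \<in> borel_measurable (PiM UNIV (\<lambda>_. borel))"
  unfolding coord_def[abs_def] by measurable

lemma coord_path: "k < n \<Longrightarrow> coord k (path \<omega>) = X (e k) \<omega>"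
  by (simp add: coord_def path_def)

lemma integral_law:
  assumes "g \<in> borel_measurable (PiM UNIV (\<lambda>_. borel))"
  shows "(\<integral>\<omega>. g \<omega> \<partial>law) = (\<integral>\<omega>. g (path \<omega>) \<partial>M :: real)"
  unfolding law_def by (rule integral_distr[OF path_measurable assms])

lemma anchored_law: "anchored_gaussian_process law {..<n} coord (inv_into {..<n} e x0)"
proof -
  let ?k = "inv_into {..<n} e x0"
  have k: "?k < n" "e ?k = x0" using x0 T_eq inv_into_into[of x0 e "{..<n}"] f_inv_into_f[of x0 e "{..<n}"] by auto
  have "gaussian_process law {..<n} coord"
    unfolding gaussian_process_def law_def
  proof (intro allI gaussian_rv_distr path_measurable)
    fix a :: "nat \<Rightarrow> real"
    show "(\<lambda>\<omega>. \<Sum>k<n. a k * coord k \<omega>) \<in> borel_measurable (PiM UNIV (\<lambda>_. borel))" by measurable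
    have "(\<lambda>\<omega>. \<Sum>k<n. a k * coord k (path \<omega>)) = (\<lambda>\<omega>. \<Sum>x\<in>T. a (inv_into {..<n} e x) * X x \<omega>)"
      unfolding T_eq sum.reindex[OF inj_e] comp_def
      by (intro ext sum.cong) (auto simp: coord_path inv_into_f_f[OF inj_e])
    moreover have "gaussian_rv M (\<lambda>\<omega>. \<Sum>x\<in>T. a (inv_into {..<n} e x) * X x \<omega>)"
      using anchored by (simp add: anchored_gaussian_process_def gaussian_process_def)
    ultimately show "gaussian_rv M (\<lambda>\<omega>. \<Sum>k<n. a k * coord k (path \<omega>))" by simp
  qed
  moreover have "prob_space law" unfolding law_def by (rule prob_space_distr) simp
  moreover have "(\<integral>\<omega>. coord k \<omega> \<partial>law) = 0" if "k < n" for k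
    using that anchored e_in[OF that] by (simp add: integral_law coord_path anchored_gaussian_process_def)
  moreover have "AE \<omega> in law. coord ?k \<omega> = 0"
    unfolding law_def using AE_x0 k by (subst AE_distr_iff) (auto simp: coord_path)
  ultimately show ?thesis using k by (simp add: anchored_gaussian_process_def)
qed

lemma gp_dist_law: "j < n \<Longrightarrow> k < n \<Longrightarrow> gp_dist law coord j k = gp_dist M X (e j) (e k)"
  by (simp add: gp_dist_def integral_law coord_path)

lemma gp_sd_law: "k < n \<Longrightarrow> gp_sd law coord k = gp_sd M X (e k)"
  by (simp add: gp_sd_def integral_law coord_path)

lemma SUP_T: "(SUP x\<in>T. f x) = (SUP k\<in>{..<n}. f (e k))" for f :: "'i \<Rightarrow> 'c::{Sup}"
  unfolding T_eq by (simp add: image_image)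

lemma gp_radius_law: "gp_radius law {..<n} coord = gp_radius M T X"
  unfolding gp_radius_def SUP_T by (intro SUP_cong) (auto simp: gp_sd_law)

lemma mm_integral_law:
  assumes \<mu>: "\<mu> \<in> prob_measures_on {..<n}" and k: "k < n"
  shows "mm_integral law {..<n} coord \<mu> k = mm_integral M T X (map_pmf e \<mu>) (e k)"
proof -
  have "measure_pmf.prob \<mu> (gp_ball law {..<n} coord k \<epsilon>) = measure_pmf.prob (map_pmf e \<mu>) (gp_ball M T X (e k) \<epsilon>)" for \<epsilon>
  proof -
    have "measure_pmf.prob (map_pmf e \<mu>) (gp_ball M T X (e k) \<epsilon>) = measure_pmf.prob \<mu> (e -` gp_ball M T X (e k) \<epsilon>)"
      by simp
    also have "\<dots> = measure_pmf.prob \<mu> (gp_ball law {..<n} coord k \<epsilon>)"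
    \<comment> \<open>\<open>e\<close> is arbitrary from \<open>n\<close> on, so the preimage of the
      ball may contain further indices, but these carry no mass.\<close>
    proof (rule measure_prob_cong_0)
      fix j assume "j \<in> e -` gp_ball M T X (e k) \<epsilon> - gp_ball law {..<n} coord k \<epsilon>"
      then have "\<not> j < n" using k by (auto simp: gp_ball_def gp_dist_law)
      then show "pmf \<mu> j = 0" using \<mu> by (auto simp: prob_measures_on_def set_pmf_iff)
    next
      fix j assume "j \<in> gp_ball law {..<n} coord k \<epsilon> - e -` gp_ball M T X (e k) \<epsilon>"
      then have False using k by (auto simp: gp_ball_def gp_dist_law e_in)
      then show "pmf \<mu> j = 0" ..
    qed
    finally show ?thesis ..
  qed
  then show ?thesis unfolding mm_integral_def gp_sd_law[OF k] by simp
qed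

lemma mm_sup_law:
  "\<mu> \<in> prob_measures_on {..<n} \<Longrightarrow> mm_sup law {..<n} coord \<mu> = mm_sup M T X (map_pmf e \<mu>)"
  unfolding mm_sup_def SUP_T by (intro SUP_cong) (auto simp: mm_integral_law)

lemma scale_count_law:
  "\<mu> \<in> prob_measures_on {..<n} \<Longrightarrow>
    scale_count law {..<n} coord \<mu> r0 s0 = scale_count M T X (map_pmf e \<mu>) r0 s0"
  by (simp add: scale_count_def mm_sup_law gp_radius_law)

text \<open>Surjectivity is essential: the universal statement over measures and the infimum on
  \<open>T\<close> must both be reached from measures on the indices.\<close>

lemma prob_measures_on_eq: "prob_measures_on T = map_pmf e ` prob_measures_on {..<n}"
proof (intro equalityI subsetI)
  fix \<nu> assume \<nu>: "\<nu> \<in> prob_measures_on T"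
  let ?i = "inv_into {..<n} e"
  have "map_pmf e (map_pmf ?i \<nu>) = map_pmf id \<nu>"
    unfolding map_pmf_comp using \<nu> T_eq
    by (intro map_pmf_cong) (auto simp: prob_measures_on_def intro!: f_inv_into_f)
  moreover have "map_pmf ?i \<nu> \<in> prob_measures_on {..<n}"
    using \<nu> T_eq inv_into_into[of _ e "{..<n}"] by (auto simp: prob_measures_on_def)
  ultimately show "\<nu> \<in> map_pmf e ` prob_measures_on {..<n}" by (metis image_eqI map_pmf_id id_apply)
next
  fix \<nu> assume "\<nu> \<in> map_pmf e ` prob_measures_on {..<n}"
  then obtain \<mu> where "\<nu> = map_pmf e \<mu>" "set_pmf \<mu> \<subseteq> {..<n}" by (auto simp: prob_measures_on_def)
  then show "\<nu> \<in> prob_measures_on T"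
    using image_mono[of "set_pmf \<mu>" "{..<n}" e] by (simp add: prob_measures_on_def T_eq)
qed

lemma INF_law:
  "(INF \<mu>\<in>prob_measures_on {..<n}. mm_sup law {..<n} coord \<mu>) = (INF \<mu>\<in>prob_measures_on T. mm_sup M T X \<mu>)"
  unfolding prob_measures_on_eq image_image by (intro INF_cong) (auto simp: mm_sup_law)

lemma integral_SUP_law:
  fixes h :: "nat \<Rightarrow> real \<Rightarrow> real"
  assumes h[measurable]: "\<And>k. h k \<in> borel_measurable borel"
    and h': "\<And>k y. k < n \<Longrightarrow> h k y = h' (e k) y"
  shows "(\<integral>\<omega>. (SUP k\<in>{..<n}. h k (coord k \<omega>)) \<partial>law) = (\<integral>\<omega>. (SUP x\<in>T. h' x (X x \<omega>)) \<partial>M)"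
proof -
  have ne: "{..<n} \<noteq> {}" using T_ne T_eq by auto
  have "(\<integral>\<omega>. (SUP k\<in>{..<n}. h k (coord k \<omega>)) \<partial>law) = (\<integral>\<omega>. (SUP k\<in>{..<n}. h k (coord k (path \<omega>))) \<partial>M)"
    unfolding cSUP_eq_Max[OF finite_lessThan ne] using ne
    by (intro integral_law borel_measurable_Max_image) auto
  also have "\<dots> = (\<integral>\<omega>. (SUP x\<in>T. h' x (X x \<omega>)) \<partial>M)"
    unfolding SUP_T by (intro Bochner_Integration.integral_cong SUP_cong) (auto simp: coord_path h')
  finally show ?thesis .
qed

lemma gp_estimates_law:
  assumes est: "gp_estimates C law {..<n} coord"
  shows "gp_estimates C M T X"
proof -
  have sup_abs: "(\<integral>\<omega>. (SUP k\<in>{..<n}. \<bar>coord k \<omega>\<bar>) \<partial>law) = (\<integral>\<omega>. (SUP x\<in>T. \<bar>X x \<omega>\<bar>) \<partial>M)"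
    by (rule integral_SUP_law[where h = "\<lambda>_ y. \<bar>y\<bar>"]) auto
  have sup_norm: "(\<integral>\<omega>. (SUP k\<in>{..<n}. max (\<bar>coord k \<omega>\<bar> - C * max (enn2real (mm_integral M T X \<mu> (e k))) r0) 0 / max (gp_sd M X (e k)) s0) \<partial>law)
     = (\<integral>\<omega>. (SUP x\<in>T. max (\<bar>X x \<omega>\<bar> - C * max (enn2real (mm_integral M T X \<mu> x)) r0) 0 / max (gp_sd M X x) s0) \<partial>M)"
    for \<mu> r0 s0
    by (rule integral_SUP_law[where h = "\<lambda>k y. max (\<bar>y\<bar> - C * max (enn2real (mm_integral M T X \<mu> (e k))) r0) 0 / max (gp_sd M X (e k)) s0"])
       auto
  have abs_law: "(\<integral>\<omega>. \<bar>coord k \<omega>\<bar> \<partial>law) = (\<integral>\<omega>. \<bar>X (e k) \<omega>\<bar> \<partial>M)" if "k < n" for k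
    using that by (simp add: integral_law coord_path)
  have all_T: "(\<forall>x\<in>T. P x) \<longleftrightarrow> (\<forall>k\<in>{..<n}. P (e k))" for P unfolding T_eq by auto
  show ?thesis
    using est unfolding gp_estimates_def Let_def gp_radius_law INF_law sup_abs
    unfolding prob_measures_on_eq ball_simps all_T
    by (auto simp: sup_norm mm_sup_law scale_count_law mm_integral_law gp_sd_law abs_law)
qed

end

lemma admissible_constant_mm_const: "admissible_constant TYPE('w) TYPE('i) mm_const"
  unfolding admissible_constant_iff
proof (intro allI impI)
  fix M :: "'w measure" and T :: "'i set" and X x0
  assume "anchored_gaussian_process M T X x0 \<and> 0 < gp_radius M T X"
  then interpret anchored_gp M T X x0 by unfold_locales simp
  show "gp_estimates mm_const M T X"
    using \<open>_ \<and> 0 < gp_radius M T X\<close> by (intro gp_estimates_mm_const) simp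
qed

lemma admissible_constant_transfer:
  assumes C: "admissible_constant TYPE(nat \<Rightarrow> real) TYPE(nat) C"
  shows "admissible_constant TYPE('w) TYPE('i) C"
  unfolding admissible_constant_iff
proof (intro allI impI)
  fix M :: "'w measure" and T :: "'i set" and X x0
  assume gp: "anchored_gaussian_process M T X x0 \<and> 0 < gp_radius M T X"
  interpret anchored_gp M T X x0 using gp by unfold_locales simp
  obtain e where "bij_betw e {0..<card T} T" using ex_bij_betw_nat_finite[OF finite_T] by blast
  then interpret gp_transfer M T X x0 "card T" e by unfold_locales (simp add: atLeast0LessThan)
  have "gp_estimates C law {..<card T} coord"
    using C anchored_law gp gp_radius_law unfolding admissible_constant_iff by metis
  then show "gp_estimates C M T X" by (rule gp_estimates_law)
qed

text \<open>The constant is chosen at closed types, where it cannot depend on \<open>'w\<close> and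
  \<open>'i\<close>; the second conjunct moves any such constant to every pair of types. Together
  they express an absolute constant.\<close>

theorem corollary1p3:
  shows "(\<exists>C>0. admissible_constant TYPE(nat \<Rightarrow> real) TYPE(nat) C) \<and>
         (\<forall>C>0. admissible_constant TYPE(nat \<Rightarrow> real) TYPE(nat) C
                   \<longrightarrow> admissible_constant TYPE('w) TYPE('i) C)"
proof (intro conjI allI impI)
  show "\<exists>C>0. admissible_constant TYPE(nat \<Rightarrow> real) TYPE(nat) C"
    using admissible_constant_mm_const mm_const_ge(1) by (intro exI[of _ mm_const]) auto
qed (rule admissible_constant_transfer)

end
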